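(* Fix $d,\Omega,k,\Psi,\rho$ as below and $\varepsilon>0$, and let $\mathbf G_n^\varepsilon=\mathbf G^\varepsilon_{n,\mathrm{reg}}(d,\Omega,k,\Psi,\rho)$. Assume $$\lim_{n\to\infty}\frac1{n^2}\sum_{i,j=1}^n\mathbb E\left\|\mu_{\mathbf G^\varepsilon_n,x_i,x_j}-\mu_{\mathbf G^\varepsilon_n,x_i}\otimes\mu_{\mathbf G^\varepsilon_n,x_j}\right\|_{TV}=0 .$$ Then there is a sequence $(\delta_n)_n\to0$ such that with probability tending to $1$ as $n\to\infty$ the messages $(\mu_{\mathbf G^\varepsilon_n,x\to a},\mu_{\mathbf G^\varepsilon_n,a\to x})_{x\in V,a\in\partial x}$ form a $\delta_n$-Belief Propagation fixed point on $\mathbf G_n^\varepsilon$.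
   Context: Factor graphs: Fix a finite set $\Omega$ of spins. A factor graph $G$ consists of a finite set $V(G)$ of variable nodes, a finite set $F(G)$ of constraint nodes, for each $a\in F(G)$ an ordered tuple $\partial a=(y_1,\ldots,y_{d(a)})$ of variable nodes, and a weight function $\psi_a:\Omega^{d(a)}\to(0,\infty)$. For $x\in V(G)$ let $\partial x$ be the set of $a\in F(G)$ with $x$ appearing in $\partial a$; we also write $\partial a$ for the set of variable nodes appearing in the tuple. For $\tau\in\Omega^{\partial a}$ write $\psi_a(\tau)=\psi_a(\tau(y_1),\ldots,\tau(y_{d(a)}))$. The Gibbs measure is $\mu_G(\sigma)=Z_G^{-1}\prod_{a}\psi_a(\sigma(\partial a))$, $\sigma\in\Omega^{V(G)}$, with partition function $Z_G$. $\mu_{G,x}$, $\mu_{G,x,y}$ are the one- and two-point marginals. For $x\in\partial a$ the message $\mu_{G,x\to a}$ is the marginal of $x$ in the Gibbs measure of $G-a$, and $\mu_{G,a\to x}$ the marginal of $x$ in the Gibbs measure of $G$ with all $b\in\partial x\setminus\{a\}$ deleted. $\varepsilon$-BP fixed point: for $G$ with $n$ variable nodes, the messages form a $\delta$-Belief Propagation fixed point if $$\sum_{x}\sum_{a\in\partial x}\sum_{\sigma\in\Omega}\left|\mu_{G,x\to a}(\sigma)-\frac{\prod_{b\in\partial x\setminus a}\mu_{G,b\to x}(\sigma)}{\sum_{\tau}\prod_{b\in\partial x\setminus a}\mu_{G,b\to x}(\tau)}\right|+\left|\mu_{G,a\to x}(\sigma)-\frac{\sum_{\tau\in\Omega^{\partial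 a}}\mathbf 1\{\tau(x)=\sigma\}\psi_a(\tau)\prod_{y\in\partial a\setminus x}\mu_{G,y\to a}(\tau(y))}{\sum_{\tau\in\Omega^{\partial a}}\psi_a(\tau)\prod_{y\in\partial a\setminus x}\mu_{G,y\to a}(\tau(y))}\right|<\delta n.$$ Percolated regular model: $d$ a positive integer, $k\geq3$, $\Psi$ a finite nonempty set of functions $\Omega^k\to(0,\infty)$, $\rho$ a distribution on $\Psi$, all fixed as $n\to\infty$. For $\psi\in\Psi$ and $J\subset[k]$ let $\psi^J:\Omega^J\to(0,\infty)$, $\psi^J((\sigma_j)_{j\in J})=|\Omega|^{|J|-k}\sum_{(\sigma_j)_{j\notin J}}\psi(\sigma_1,\ldots,\sigma_k)$. $\mathbf G^\varepsilon_{n,\mathrm{reg}}(d,\Omega,k,\Psi,\rho)$ has variable nodes $x_1,\ldots,x_n$ and is generated by: (REG1) choose $m\sim\mathrm{Po}(dn/k)$; (REG2) independently for $i\in[m]$ obtain $J_i\subset[k]$ by including each element with probability $1-\varepsilon$ independently, choose $\psi_i\sim\rho$, and let constraint node $a_i$ have weight $\psi_{a_i}=\psi_i^{J_i}$ and $|J_i|$ ordered neighbour slots; (REG3) if $\sum_i|J_i|>dn$ start over, otherwise choose the neighbour tuples uniformly at random subject to every variable node having degree (number of slots it occupies) at most $d$. *)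

theory Defs
  imports "HOL-Probability.Probability"
begin

text \<open>Conventions. Spins: a finite type 'w.  Variable nodes x_1..x_n are 0..n-1.
A factor graph on n variables is a triple (m, nb, w): constraint nodes 0..m-1,
nb a = ordered neighbour tuple of a (list of variable nodes, entries < n),
w a = weight function of a, applied to the list of spins on the tuple nb a.\<close>

type_synonym 'w fgraph = "nat \<times> (nat \<Rightarrow> nat list) \<times> (nat \<Rightarrow> 'w list \<Rightarrow> real)"

definition configs :: "nat \<Rightarrow> (nat \<Rightarrow> 'w) set" where
  "configs n = PiE {..<n} (\<lambda>_. UNIV)"

definition gweight :: "(nat \<Rightarrow> nat list) \<Rightarrow> (nat \<Rightarrow> 'w list \<Rightarrow> real) \<Rightarrow> nat set \<Rightarrow> (nat \<Rightarrow> 'w) \<Rightarrow> real" where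
  "gweight nb w F \<sigma> = (\<Prod>a\<in>F. w a (map \<sigma> (nb a)))"

definition partition_fun :: "nat \<Rightarrow> (nat \<Rightarrow> nat list) \<Rightarrow> (nat \<Rightarrow> 'w list \<Rightarrow> real) \<Rightarrow> nat set \<Rightarrow> real" where
  "partition_fun n nb w F = (\<Sum>\<sigma>\<in>configs n. gweight nb w F \<sigma>)"

definition marg1 :: "nat \<Rightarrow> (nat \<Rightarrow> nat list) \<Rightarrow> (nat \<Rightarrow> 'w list \<Rightarrow> real) \<Rightarrow> nat set \<Rightarrow> nat \<Rightarrow> 'w \<Rightarrow> real" where
  "marg1 n nb w F x s = (\<Sum>\<sigma>\<in>{\<sigma>\<in>configs n. \<sigma> x = s}. gweight nb w F \<sigma>) / partition_fun n nb w F"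

definition marg2 :: "nat \<Rightarrow> (nat \<Rightarrow> nat list) \<Rightarrow> (nat \<Rightarrow> 'w list \<Rightarrow> real) \<Rightarrow> nat set \<Rightarrow> nat \<Rightarrow> nat \<Rightarrow> 'w \<times> 'w \<Rightarrow> real" where
  "marg2 n nb w F x y st = (\<Sum>\<sigma>\<in>{\<sigma>\<in>configs n. \<sigma> x = fst st \<and> \<sigma> y = snd st}. gweight nb w F \<sigma>) / partition_fun n nb w F"

definition mu1 :: "nat \<Rightarrow> 'w fgraph \<Rightarrow> nat \<Rightarrow> 'w \<Rightarrow> real" where
  "mu1 n G x = (case G of (m, nb, w) \<Rightarrow> marg1 n nb w {..<m} x)"

definition mu2 :: "nat \<Rightarrow> 'w fgraph \<Rightarrow> nat \<Rightarrow> nat \<Rightarrow> 'w \<times> 'w \<Rightarrow> real" where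
  "mu2 n G x y = (case G of (m, nb, w) \<Rightarrow> marg2 n nb w {..<m} x y)"

definition tv_pair :: "nat \<Rightarrow> 'w::finite fgraph \<Rightarrow> nat \<Rightarrow> nat \<Rightarrow> real" where
  "tv_pair n G x y = (1/2) * (\<Sum>st\<in>(UNIV :: ('w \<times> 'w) set).
      \<bar>mu2 n G x y st - mu1 n G x (fst st) * mu1 n G y (snd st)\<bar>)"

definition var_nbhd :: "nat \<Rightarrow> (nat \<Rightarrow> nat list) \<Rightarrow> nat \<Rightarrow> nat set" where
  "var_nbhd m nb x = {a\<in>{..<m}. x \<in> set (nb a)}"

definition msg_va :: "nat \<Rightarrow> 'w fgraph \<Rightarrow> nat \<Rightarrow> nat \<Rightarrow> 'w \<Rightarrow> real" where
  "msg_va n G x a = (case G of (m, nb, w) \<Rightarrow> marg1 n nb w ({..<m} - {a}) x)"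

definition msg_av :: "nat \<Rightarrow> 'w fgraph \<Rightarrow> nat \<Rightarrow> nat \<Rightarrow> 'w \<Rightarrow> real" where
  "msg_av n G a x = (case G of (m, nb, w) \<Rightarrow>
      marg1 n nb w ({..<m} - (var_nbhd m nb x - {a})) x)"

definition bp_error :: "nat \<Rightarrow> 'w::finite fgraph \<Rightarrow> real" where
  "bp_error n G = (case G of (m, nb, w) \<Rightarrow>
     (\<Sum>x<n. \<Sum>a\<in>var_nbhd m nb x. \<Sum>s\<in>(UNIV :: 'w set).
        \<bar>msg_va n G x a s
          - (\<Prod>b\<in>var_nbhd m nb x - {a}. msg_av n G b x s)
            / (\<Sum>t\<in>UNIV. \<Prod>b\<in>var_nbhd m nb x - {a}. msg_av n G b x t)\<bar>
      + \<bar>msg_av n G a x s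
          - (\<Sum>\<tau>\<in>{\<tau>\<in>PiE (set (nb a)) (\<lambda>_. UNIV). \<tau> x = s}.
               w a (map \<tau> (nb a)) * (\<Prod>y\<in>set (nb a) - {x}. msg_va n G y a (\<tau> y)))
            / (\<Sum>\<tau>\<in>PiE (set (nb a)) (\<lambda>_. UNIV).
               w a (map \<tau> (nb a)) * (\<Prod>y\<in>set (nb a) - {x}. msg_va n G y a (\<tau> y)))\<bar>))"

definition is_bp_fixpoint :: "real \<Rightarrow> nat \<Rightarrow> 'w::finite fgraph \<Rightarrow> bool" where
  "is_bp_fixpoint \<delta> n G \<longleftrightarrow> bp_error n G < \<delta> * real n"

text \<open>psi^J for psi : 'w^k \<rightarrow> (0,\<infinity>) (given on lists of length k, positions 0..k-1) and J \<subseteq> {0..<k}.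
The |J| slots are the elements of J in increasing order, so (sigma_j)_{j\<in>J} is nths tau J.\<close>
definition psi_restrict :: "nat \<Rightarrow> ('w::finite list \<Rightarrow> real) \<Rightarrow> nat set \<Rightarrow> 'w list \<Rightarrow> real" where
  "psi_restrict k psi J ts =
     real CARD('w) powi (int (card J) - int k) *
     (\<Sum>\<tau>\<in>{\<tau>. length \<tau> = k \<and> nths \<tau> J = ts}. psi \<tau>)"

definition J_pmf :: "nat \<Rightarrow> real \<Rightarrow> nat set pmf" where
  "J_pmf k eps = map_pmf (\<lambda>b. {j\<in>{..<k}. b j}) (Pi_pmf {..<k} False (\<lambda>_. bernoulli_pmf (1 - eps)))"

text \<open>Steps REG1, REG2 and the rejection in REG3 (restarting = conditioning on the event).\<close>
definition reg_stage1 :: "nat \<Rightarrow> nat \<Rightarrow> real \<Rightarrow> ('w list \<Rightarrow> real) pmf \<Rightarrow> nat \<Rightarrow> (nat \<times> (nat \<Rightarrow> nat set \<times> ('w list \<Rightarrow> real))) pmf" where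
  "reg_stage1 d k eps \<rho> n =
     cond_pmf
       (bind_pmf (poisson_pmf (real d * real n / real k)) (\<lambda>m.
          map_pmf (\<lambda>c. (m, c)) (Pi_pmf {..<m} undefined (\<lambda>_. pair_pmf (J_pmf k eps) \<rho>))))
       {(m, c). (\<Sum>i<m. card (fst (c i))) \<le> d * n}"

definition slot_assignments :: "nat \<Rightarrow> nat \<Rightarrow> nat \<Rightarrow> (nat \<Rightarrow> nat) \<Rightarrow> (nat \<Rightarrow> nat list) set" where
  "slot_assignments n d m sl =
     {nb \<in> PiE {..<m} (\<lambda>i. {xs. length xs = sl i \<and> set xs \<subseteq> {..<n}}).
        \<forall>x<n. (\<Sum>i<m. count_list (nb i) x) \<le> d}"

definition reg_model :: "nat \<Rightarrow> nat \<Rightarrow> real \<Rightarrow> ('w::finite list \<Rightarrow> real) pmf \<Rightarrow> nat \<Rightarrow> 'w fgraph pmf" where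
  "reg_model d k eps \<rho> n =
     bind_pmf (reg_stage1 d k eps \<rho> n) (\<lambda>(m, c).
       map_pmf (\<lambda>nb. (m, nb, \<lambda>i. psi_restrict k (snd (c i)) (fst (c i))))
         (pmf_of_set (slot_assignments n d m (\<lambda>i. card (fst (c i))))))"

end

theory Submission
  imports Defs
begin

text \<open>
  Fix a factor graph whose Gibbs measure has small average pairwise correlations. By Cauchy--Schwarz,
  every bounded observable is then almost uncorrelated with the spin of a typical variable node.
  This property survives reweighting the Gibbs measure by a function that is bounded above and away
  from zero, so it also holds after the deletion of boundedly many constraint nodes, and by
  induction it extends from one spin to the joint law of the spins on a typical tuple.

  Once all constraint nodes at \<open>x\<close> are deleted, the spin of \<open>x\<close> is uniform and independent of the rest,
  so both Belief Propagation equations at an edge \<open>(x, a)\<close> reduce to an approximate factorisation over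
  \<open>\<partial>a - x\<close>. Given all other neighbour tuples, the tuple of \<open>a\<close> is uniform over a set that contains a
  positive proportion of all tuples, because percolation with \<open>\<epsilon> > 0\<close> leaves linearly many variable
  nodes of degree less than \<open>d\<close> with high probability. Hence the tuple of \<open>a\<close> is typical in the above sense.
\<close>

section \<open>Gibbs expectations\<close>

text \<open>The obstacle is that small correlations are an event depending on the very tuple that is
  to be resampled. It is resolved fibre by fibre, with all tuples fixed except that of
  \<open>a\<close>. If one completion in the fibre has small correlations, deleting \<open>a\<close>
  turns this into mixing of the measure without \<open>a\<close>. That measure is common to the
  whole fibre, so the error bound covers every completion. If there is no such completion, the fibre
  contributes nothing. Replacing the fibre by all \<open>n^l\<close> tuples costs a factor
  \<open>(2/c)^k\<close>, where \<open>c\<close> is half of \<open>min eps 1\<close>: a Chernoff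
  bound keeps the occupied slots below \<open>(1 - c) d n\<close>, while their mean before
  conditioning is \<open>(1 - min eps 1) d n\<close>. A second obstacle is that the messages from
  \<open>y\<close> to \<open>a\<close> are marginals of the graph without \<open>a\<close>, whereas
  the natural measure at \<open>x\<close> lacks all constraint nodes at \<open>x\<close>. Mixing is
  therefore stated against prescribed reference marginals, so that the former can serve as reference
  for the latter. All weights take finitely many positive values, so every deletion of boundedly
  many nodes is a bounded reweighting.\<close>

definition positive_on :: "(nat \<Rightarrow> nat list) \<Rightarrow> (nat \<Rightarrow> 'w list \<Rightarrow> real) \<Rightarrow> nat set \<Rightarrow> bool" where
  "positive_on nb w F \<longleftrightarrow> (\<forall>a\<in>F. \<forall>\<sigma>. 0 < w a (map \<sigma> (nb a)))"

definition gibbs :: "nat \<Rightarrow> (nat \<Rightarrow> nat list) \<Rightarrow> (nat \<Rightarrow> 'w list \<Rightarrow> real) \<Rightarrow> nat set \<Rightarrow> ((nat \<Rightarrow> 'w) \<Rightarrow> real) \<Rightarrow> real" where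
  "gibbs n nb w F f = (\<Sum>\<sigma>\<in>configs n. gweight nb w F \<sigma> * f \<sigma>) / partition_fun n nb w F"

lemma finite_configs [simp]: "finite (configs n :: (nat \<Rightarrow> 'w::finite) set)"
  by (simp add: configs_def finite_PiE)

lemma configs_nonempty [simp]: "configs n \<noteq> ({} :: (nat \<Rightarrow> 'w) set)"
  by (simp add: configs_def PiE_eq_empty_iff)

lemma gweight_pos: "positive_on nb w F \<Longrightarrow> 0 < gweight nb w F \<sigma>"
  unfolding positive_on_def gweight_def by (intro prod_pos) auto

lemma partition_fun_pos:
  "positive_on nb (w :: nat \<Rightarrow> 'w::finite list \<Rightarrow> real) F \<Longrightarrow> 0 < partition_fun n nb w F"
  unfolding partition_fun_def by (intro sum_pos gweight_pos) auto

lemma gibbs_add: "gibbs n nb w F (\<lambda>\<sigma>. f \<sigma> + g \<sigma>) = gibbs n nb w F f + gibbs n nb w F g"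
  by (simp add: gibbs_def algebra_simps sum.distrib add_divide_distrib)

lemma gibbs_diff: "gibbs n nb w F (\<lambda>\<sigma>. f \<sigma> - g \<sigma>) = gibbs n nb w F f - gibbs n nb w F g"
  by (simp add: gibbs_def algebra_simps sum_subtractf diff_divide_distrib)

lemma gibbs_cmult: "gibbs n nb w F (\<lambda>\<sigma>. c * f \<sigma>) = c * gibbs n nb w F f"
  by (simp add: gibbs_def sum_distrib_left algebra_simps)

lemma gibbs_multc: "gibbs n nb w F (\<lambda>\<sigma>. f \<sigma> * c) = gibbs n nb w F f * c"
  using gibbs_cmult[of n nb w F c f] by (simp add: mult.commute)

lemma gibbs_sum: "gibbs n nb w F (\<lambda>\<sigma>. \<Sum>i\<in>I. f i \<sigma>) = (\<Sum>i\<in>I. gibbs n nb w F (f i))"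
proof (cases "finite I")
  case True
  then show ?thesis
    by (induction I rule: finite_induct) (simp_all add: gibbs_add, simp add: gibbs_def)
qed (simp add: gibbs_def)

lemma gibbs_const:
  "positive_on nb (w :: nat \<Rightarrow> 'w::finite list \<Rightarrow> real) F \<Longrightarrow> gibbs n nb w F (\<lambda>_. c) = c"
  using partition_fun_pos[of nb w F n]
  by (simp add: gibbs_def partition_fun_def flip: sum_distrib_right)

lemma gibbs_mono:
  fixes w :: "nat \<Rightarrow> 'w::finite list \<Rightarrow> real"
  assumes "positive_on nb w F" "\<And>\<sigma>. \<sigma> \<in> configs n \<Longrightarrow> f \<sigma> \<le> g \<sigma>"
  shows "gibbs n nb w F f \<le> gibbs n nb w F g"
  unfolding gibbs_def using assms gweight_pos[OF assms(1)] partition_fun_pos[OF assms(1), of n]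
  by (intro divide_right_mono sum_mono mult_left_mono) (auto simp: less_imp_le)

lemma gibbs_bounds:
  fixes w :: "nat \<Rightarrow> 'w::finite list \<Rightarrow> real"
  assumes "positive_on nb w F" "\<And>\<sigma>. \<sigma> \<in> configs n \<Longrightarrow> A \<le> f \<sigma>" "\<And>\<sigma>. \<sigma> \<in> configs n \<Longrightarrow> f \<sigma> \<le> B"
  shows "A \<le> gibbs n nb w F f" "gibbs n nb w F f \<le> B"
  using gibbs_mono[OF assms(1), of n "\<lambda>_. A" f] gibbs_mono[OF assms(1), of n f "\<lambda>_. B"]
    gibbs_const[OF assms(1)] assms(2,3) by simp_all

lemma abs_gibbs_le:
  fixes w :: "nat \<Rightarrow> 'w::finite list \<Rightarrow> real"
  assumes "positive_on nb w F" "\<And>\<sigma>. \<sigma> \<in> configs n \<Longrightarrow> \<bar>f \<sigma>\<bar> \<le> M"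
  shows "\<bar>gibbs n nb w F f\<bar> \<le> M"
proof -
  have "- M \<le> f \<sigma>" "f \<sigma> \<le> M" if "\<sigma> \<in> configs n" for \<sigma>
    using assms(2)[OF that] by auto
  then show ?thesis
    using gibbs_bounds[OF assms(1), of n "- M" f M] by auto
qed

lemma marg1_eq_gibbs:
  fixes w :: "nat \<Rightarrow> 'w::finite list \<Rightarrow> real"
  shows "marg1 n nb w F x s = gibbs n nb w F (\<lambda>\<sigma>. of_bool (\<sigma> x = s))"
  by (simp add: marg1_def gibbs_def sum.inter_filter of_bool_def if_distrib cong: if_cong)

lemma marg2_eq_gibbs:
  fixes w :: "nat \<Rightarrow> 'w::finite list \<Rightarrow> real"
  shows "marg2 n nb w F x y st
    = gibbs n nb w F (\<lambda>\<sigma>. of_bool (\<sigma> x = fst st) * of_bool (\<sigma> y = snd st))"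
  unfolding marg2_def gibbs_def
  by (subst sum.inter_filter)
    (auto simp: of_bool_def intro!: sum.cong arg_cong[where f = "\<lambda>u. u / partition_fun n nb w F"])

lemma marg1_nonneg:
  "positive_on nb (w :: nat \<Rightarrow> 'w::finite list \<Rightarrow> real) F \<Longrightarrow> 0 \<le> marg1 n nb w F x s"
  unfolding marg1_eq_gibbs by (rule gibbs_bounds(1)[where B = 1]) auto

lemma sum_marg1:
  fixes w :: "nat \<Rightarrow> 'w::finite list \<Rightarrow> real"
  assumes "positive_on nb w F"
  shows "(\<Sum>s\<in>UNIV. marg1 n nb w F x s) = 1"
proof -
  have "(\<Sum>s\<in>UNIV. marg1 n nb w F x s) = gibbs n nb w F (\<lambda>\<sigma>. \<Sum>s\<in>UNIV. of_bool (\<sigma> x = s))"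
    by (simp only: marg1_eq_gibbs gibbs_sum)
  also have "(\<lambda>\<sigma>. \<Sum>s\<in>UNIV. of_bool (\<sigma> x = s)) = (\<lambda>\<sigma> :: nat \<Rightarrow> 'w. 1 :: real)"
    by (simp add: of_bool_def)
  finally show ?thesis using gibbs_const[OF assms, of n 1] by simp
qed

lemma gibbs_tilt:
  fixes w :: "nat \<Rightarrow> 'w::finite list \<Rightarrow> real"
  assumes "positive_on nb w F"
    and "\<And>\<sigma>. \<sigma> \<in> configs n \<Longrightarrow> gweight nb w F' \<sigma> = gweight nb w F \<sigma> * r \<sigma>"
  shows "gibbs n nb w F' f = gibbs n nb w F (\<lambda>\<sigma>. f \<sigma> * r \<sigma>) / gibbs n nb w F r"
  using assms partition_fun_pos[OF assms(1), of n]
  by (simp add: gibbs_def partition_fun_def mult_ac)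

lemma gibbs_nb_cong:
  assumes "\<And>a. a \<in> F \<Longrightarrow> nb a = nb' a"
  shows "gibbs n nb w F f = gibbs n nb' w F f"
  using assms by (simp add: gibbs_def partition_fun_def gweight_def)

section \<open>Covariances under the Gibbs measure\<close>

definition gcov :: "nat \<Rightarrow> (nat \<Rightarrow> nat list) \<Rightarrow> (nat \<Rightarrow> 'w list \<Rightarrow> real) \<Rightarrow> nat set
    \<Rightarrow> ((nat \<Rightarrow> 'w) \<Rightarrow> real) \<Rightarrow> ((nat \<Rightarrow> 'w) \<Rightarrow> real) \<Rightarrow> real" where
  "gcov n nb w F f g = gibbs n nb w F (\<lambda>\<sigma>. f \<sigma> * g \<sigma>) - gibbs n nb w F f * gibbs n nb w F g"

lemma gibbs_square_le:
  fixes w :: "nat \<Rightarrow> 'w::finite list \<Rightarrow> real"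
  assumes "positive_on nb w F"
  shows "(gibbs n nb w F f)\<^sup>2 \<le> gibbs n nb w F (\<lambda>\<sigma>. (f \<sigma>)\<^sup>2)"
proof -
  define e where "e = gibbs n nb w F f"
  have "0 \<le> gibbs n nb w F (\<lambda>\<sigma>. (f \<sigma> - e)\<^sup>2)"
    using gibbs_mono[OF assms, of n "\<lambda>_. 0" "\<lambda>\<sigma>. (f \<sigma> - e)\<^sup>2"] gibbs_const[OF assms, of n 0] by simp
  also have "(\<lambda>\<sigma>. (f \<sigma> - e)\<^sup>2) = (\<lambda>\<sigma>. ((f \<sigma>)\<^sup>2 - 2 * e * f \<sigma>) + e\<^sup>2)"
    by (auto simp: power2_eq_square algebra_simps)
  also have "gibbs n nb w F \<dots> = gibbs n nb w F (\<lambda>\<sigma>. (f \<sigma>)\<^sup>2) - 2 * e * e + e\<^sup>2"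
    by (simp only: gibbs_add gibbs_diff gibbs_cmult gibbs_const[OF assms] e_def)
  finally show ?thesis unfolding e_def by (simp add: power2_eq_square)
qed

text \<open>Let \<open>g\<close> be the sum of the centred \<open>h y\<close>, weighted by the signs
  of their covariances with \<open>f\<close>. Then the left-hand sum is the single expectation of
  \<open>f * g\<close>. Squaring inside the expectation extracts \<open>f\<close> at the cost of
  \<open>M^2\<close>, and the second moment of \<open>g\<close> is a signed sum of covariances among
  the \<open>h\<close>.\<close>

lemma sum_gcov_square_le:
  fixes w :: "nat \<Rightarrow> 'w::finite list \<Rightarrow> real"
  assumes pos: "positive_on nb w F" and M: "\<And>\<sigma>. \<sigma> \<in> configs n \<Longrightarrow> \<bar>f \<sigma>\<bar> \<le> M"
  shows "(\<Sum>y\<in>I. \<bar>gcov n nb w F f (h y)\<bar>)\<^sup>2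
    \<le> M\<^sup>2 * (\<Sum>x\<in>I. \<Sum>y\<in>I. \<bar>gcov n nb w F (h x) (h y)\<bar>)"
proof -
  let ?E = "gibbs n nb w F"
  define e where "e y = sgn (gcov n nb w F f (h y))" for y
  define g where "g \<sigma> = (\<Sum>y\<in>I. e y * (h y \<sigma> - ?E (h y)))" for \<sigma>
  have c: "?E (\<lambda>\<sigma>. u \<sigma> * (h y \<sigma> - ?E (h y))) = gcov n nb w F u (h y)" for u y
  proof -
    have "?E (\<lambda>\<sigma>. u \<sigma> * (h y \<sigma> - ?E (h y))) = ?E (\<lambda>\<sigma>. u \<sigma> * h y \<sigma> - u \<sigma> * ?E (h y))"
      by (simp add: algebra_simps)
    also have "\<dots> = gcov n nb w F u (h y)"
      by (simp only: gibbs_diff gibbs_multc gcov_def)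
    finally show ?thesis .
  qed
  have ug: "?E (\<lambda>\<sigma>. u \<sigma> * g \<sigma>) = (\<Sum>y\<in>I. e y * gcov n nb w F u (h y))" for u
  proof -
    have "?E (\<lambda>\<sigma>. u \<sigma> * g \<sigma>) = ?E (\<lambda>\<sigma>. \<Sum>y\<in>I. e y * (u \<sigma> * (h y \<sigma> - ?E (h y))))"
      by (simp add: g_def sum_distrib_left mult_ac)
    also have "\<dots> = (\<Sum>y\<in>I. e y * gcov n nb w F u (h y))"
      by (simp only: gibbs_sum gibbs_cmult c)
    finally show ?thesis .
  qed
  have "(\<Sum>y\<in>I. \<bar>gcov n nb w F f (h y)\<bar>) = ?E (\<lambda>\<sigma>. f \<sigma> * g \<sigma>)"
    unfolding ug by (simp add: e_def abs_sgn mult.commute)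
  then have "(\<Sum>y\<in>I. \<bar>gcov n nb w F f (h y)\<bar>)\<^sup>2 \<le> ?E (\<lambda>\<sigma>. (f \<sigma> * g \<sigma>)\<^sup>2)"
    using gibbs_square_le[OF pos] by simp
  also have "\<dots> \<le> ?E (\<lambda>\<sigma>. M\<^sup>2 * (g \<sigma>)\<^sup>2)"
  proof (rule gibbs_mono[OF pos])
    fix \<sigma> :: "nat \<Rightarrow> 'w" assume "\<sigma> \<in> configs n"
    then have "(f \<sigma>)\<^sup>2 \<le> M\<^sup>2" using M power_mono[of "\<bar>f \<sigma>\<bar>" M 2] by auto
    then show "(f \<sigma> * g \<sigma>)\<^sup>2 \<le> M\<^sup>2 * (g \<sigma>)\<^sup>2"
      by (simp add: power_mult_distrib mult_right_mono)
  qed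
  also have "\<dots> = M\<^sup>2 * ?E (\<lambda>\<sigma>. g \<sigma> * g \<sigma>)"
    by (simp add: gibbs_cmult power2_eq_square)
  also have "?E (\<lambda>\<sigma>. g \<sigma> * g \<sigma>) \<le> (\<Sum>x\<in>I. \<Sum>y\<in>I. \<bar>gcov n nb w F (h x) (h y)\<bar>)"
  proof -
    have "gcov n nb w F g (h y) = (\<Sum>x\<in>I. e x * gcov n nb w F (h y) (h x))" for y
    proof -
      \<comment> \<open>Centring makes \<open>g\<close> have mean zero, so its covariance with
        \<open>h y\<close> is the plain expectation of their product.\<close>
      have "?E g = 0"
      proof -
        have "?E g = (\<Sum>y\<in>I. e y * (?E (\<lambda>\<sigma>. h y \<sigma> - ?E (h y))))"
          unfolding g_def by (simp only: gibbs_sum gibbs_cmult)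
        also have "\<dots> = 0" by (simp add: gibbs_diff gibbs_const[OF pos])
        finally show ?thesis .
      qed
      then have "gcov n nb w F g (h y) = ?E (\<lambda>\<sigma>. h y \<sigma> * g \<sigma>)"
        by (simp add: gcov_def mult.commute)
      then show ?thesis unfolding ug .
    qed
    then have "?E (\<lambda>\<sigma>. g \<sigma> * g \<sigma>) = (\<Sum>y\<in>I. \<Sum>x\<in>I. e y * e x * gcov n nb w F (h y) (h x))"
      unfolding ug by (simp add: sum_distrib_left mult_ac)
    also have "\<dots> \<le> (\<Sum>x\<in>I. \<Sum>y\<in>I. \<bar>gcov n nb w F (h x) (h y)\<bar>)"
    proof (intro sum_mono)
      fix x y
      have "\<bar>e x * e y * gcov n nb w F (h x) (h y)\<bar> \<le> 1 * \<bar>gcov n nb w F (h x) (h y)\<bar>"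
        unfolding abs_mult by (intro mult_right_mono) (auto simp: e_def sgn_real_def)
      then show "e x * e y * gcov n nb w F (h x) (h y) \<le> \<bar>gcov n nb w F (h x) (h y)\<bar>" by simp
    qed
    finally show ?thesis .
  qed
  finally show ?thesis by (simp add: mult_left_mono)
qed

section \<open>Mixing\<close>

text \<open>The reference marginals \<open>v\<close> need not be those of the measure itself: keeping them fixed is what makes
  the property stable under reweighting.\<close>

definition mixing :: "nat \<Rightarrow> (nat \<Rightarrow> nat list) \<Rightarrow> (nat \<Rightarrow> 'w::finite list \<Rightarrow> real) \<Rightarrow> nat set
    \<Rightarrow> (nat \<Rightarrow> 'w \<Rightarrow> real) \<Rightarrow> real \<Rightarrow> bool" where
  "mixing n nb w F v \<eta> \<longleftrightarrow> (\<forall>f M. (\<forall>\<sigma>\<in>configs n. \<bar>f \<sigma>\<bar> \<le> M) \<longrightarrow>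
     (\<Sum>y<n. \<Sum>t\<in>UNIV. \<bar>gibbs n nb w F (\<lambda>\<sigma>. f \<sigma> * of_bool (\<sigma> y = t)) - gibbs n nb w F f * v y t\<bar>)
       \<le> M * \<eta> * real n)"

lemma mixingD:
  "mixing n nb w F v \<eta> \<Longrightarrow> (\<And>\<sigma>. \<sigma> \<in> configs n \<Longrightarrow> \<bar>f \<sigma>\<bar> \<le> M) \<Longrightarrow>
     (\<Sum>y<n. \<Sum>t\<in>UNIV. \<bar>gibbs n nb w F (\<lambda>\<sigma>. f \<sigma> * of_bool (\<sigma> y = t)) - gibbs n nb w F f * v y t\<bar>)
       \<le> M * \<eta> * real n"
  unfolding mixing_def by blast

lemma mixing_nb_cong:
  assumes "\<And>a. a \<in> F \<Longrightarrow> nb a = nb' a"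
  shows "mixing n nb w F v \<eta> \<longleftrightarrow> mixing n nb' w F v \<eta>"
proof -
  have "gibbs n nb w F = gibbs n nb' w F"
    using gibbs_nb_cong[of F nb nb'] assms by blast
  then show ?thesis unfolding mixing_def by simp
qed

text \<open>Test the original measure with \<open>f * r\<close> instead of \<open>f\<close>: the
  bound on the observable grows by \<open>R\<close>, and the normalisation \<open>1 / ?E r\<close>
  is at most \<open>R\<close>. As \<open>v\<close> is the same on both sides, both terms of each
  summand scale by this same normalisation.\<close>

lemma mixing_tilt:
  fixes w :: "nat \<Rightarrow> 'w::finite list \<Rightarrow> real"
  assumes pos: "positive_on nb w F" and mix: "mixing n nb w F v \<eta>"
    and tilt: "\<And>\<sigma>. \<sigma> \<in> configs n \<Longrightarrow> gweight nb w F' \<sigma> = gweight nb w F \<sigma> * r \<sigma>"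
    and R: "0 < R" and r: "\<And>\<sigma>. \<sigma> \<in> configs n \<Longrightarrow> 1 / R \<le> r \<sigma> \<and> r \<sigma> \<le> R"
  shows "mixing n nb w F' v (R\<^sup>2 * \<eta>)"
  unfolding mixing_def
proof (intro allI impI)
  fix f :: "(nat \<Rightarrow> 'w) \<Rightarrow> real" and M
  assume f: "\<forall>\<sigma>\<in>configs n. \<bar>f \<sigma>\<bar> \<le> M"
  let ?E = "gibbs n nb w F"
  have T: "gibbs n nb w F' g = ?E (\<lambda>\<sigma>. g \<sigma> * r \<sigma>) / ?E r" for g
    by (rule gibbs_tilt[OF pos]) (rule tilt)
  have r0: "0 \<le> r \<sigma>" if "\<sigma> \<in> configs n" for \<sigma>
    using r[OF that] R by (meson divide_nonneg_pos order_trans zero_le_one)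
  have Er: "1 / R \<le> ?E r" by (rule gibbs_bounds(1)[OF pos, where B = R]) (use r in auto)
  then have Erp: "0 < ?E r" using R by (meson less_le_trans zero_less_divide_1_iff)
  have iEr: "1 / ?E r \<le> R"
    using Er Erp R by (simp add: field_simps)
  have "\<bar>f \<sigma> * r \<sigma>\<bar> \<le> M * R" if "\<sigma> \<in> configs n" for \<sigma>
    unfolding abs_mult using f r[OF that] r0[OF that] that by (intro mult_mono) auto
  from mixingD[OF mix this]
  have *: "(\<Sum>y<n. \<Sum>t\<in>UNIV. \<bar>?E (\<lambda>\<sigma>. f \<sigma> * r \<sigma> * of_bool (\<sigma> y = t)) - ?E (\<lambda>\<sigma>. f \<sigma> * r \<sigma>) * v y t\<bar>)
      \<le> M * R * \<eta> * real n" .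
  have "(\<Sum>y<n. \<Sum>t\<in>UNIV. \<bar>gibbs n nb w F' (\<lambda>\<sigma>. f \<sigma> * of_bool (\<sigma> y = t)) - gibbs n nb w F' f * v y t\<bar>)
    = (\<Sum>y<n. \<Sum>t\<in>UNIV. \<bar>?E (\<lambda>\<sigma>. f \<sigma> * r \<sigma> * of_bool (\<sigma> y = t)) - ?E (\<lambda>\<sigma>. f \<sigma> * r \<sigma>) * v y t\<bar>) * (1 / ?E r)"
    unfolding sum_distrib_right
  proof (intro sum.cong refl)
    fix y t
    have "gibbs n nb w F' (\<lambda>\<sigma>. f \<sigma> * of_bool (\<sigma> y = t)) - gibbs n nb w F' f * v y t
      = (?E (\<lambda>\<sigma>. f \<sigma> * r \<sigma> * of_bool (\<sigma> y = t)) - ?E (\<lambda>\<sigma>. f \<sigma> * r \<sigma>) * v y t) / ?E r"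
      unfolding T by (simp add: diff_divide_distrib mult_ac)
    then show "\<bar>gibbs n nb w F' (\<lambda>\<sigma>. f \<sigma> * of_bool (\<sigma> y = t)) - gibbs n nb w F' f * v y t\<bar>
      = \<bar>?E (\<lambda>\<sigma>. f \<sigma> * r \<sigma> * of_bool (\<sigma> y = t)) - ?E (\<lambda>\<sigma>. f \<sigma> * r \<sigma>) * v y t\<bar> * (1 / ?E r)"
      using Erp by simp
  qed
  also have "\<dots> \<le> (M * R * \<eta> * real n) * R"
    using Erp iEr by (intro mult_mono * order_trans[OF _ *]) (auto intro!: sum_nonneg)
  finally show "(\<Sum>y<n. \<Sum>t\<in>UNIV. \<bar>gibbs n nb w F' (\<lambda>\<sigma>. f \<sigma> * of_bool (\<sigma> y = t)) - gibbs n nb w F' f * v y t\<bar>)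
    \<le> M * (R\<^sup>2 * \<eta>) * real n"
    by (simp add: power2_eq_square mult_ac)
qed

text \<open>Testing with the constant 1 shows that \<open>v\<close> is within
  \<open>\<eta> * n\<close> of the true marginals in total. Exchanging one for the other therefore
  costs a second \<open>\<eta>\<close>.\<close>

lemma mixing_own_marginals:
  fixes w :: "nat \<Rightarrow> 'w::finite list \<Rightarrow> real"
  assumes pos: "positive_on nb w F" and mix: "mixing n nb w F v \<eta>"
  shows "mixing n nb w F (marg1 n nb w F) (2 * \<eta>)"
  unfolding mixing_def
proof (intro allI impI)
  fix f :: "(nat \<Rightarrow> 'w) \<Rightarrow> real" and M
  assume f: "\<forall>\<sigma>\<in>configs n. \<bar>f \<sigma>\<bar> \<le> M"
  let ?E = "gibbs n nb w F" and ?p = "marg1 n nb w F"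
  have Ef: "\<bar>?E f\<bar> \<le> M" using f by (intro abs_gibbs_le[OF pos]) auto
  have 1: "(\<Sum>y<n. \<Sum>t\<in>UNIV. \<bar>?E (\<lambda>\<sigma>. f \<sigma> * of_bool (\<sigma> y = t)) - ?E f * v y t\<bar>) \<le> M * \<eta> * real n"
    using f by (intro mixingD[OF mix]) auto
  have 2: "(\<Sum>y<n. \<Sum>t\<in>UNIV. \<bar>?p y t - v y t\<bar>) \<le> \<eta> * real n"
    using mixingD[OF mix, of "\<lambda>_. 1" 1] by (simp add: gibbs_const[OF pos] marg1_eq_gibbs)
  have "(\<Sum>y<n. \<Sum>t\<in>UNIV. \<bar>?E (\<lambda>\<sigma>. f \<sigma> * of_bool (\<sigma> y = t)) - ?E f * ?p y t\<bar>)
    \<le> (\<Sum>y<n. \<Sum>t\<in>UNIV. \<bar>?E (\<lambda>\<sigma>. f \<sigma> * of_bool (\<sigma> y = t)) - ?E f * v y t\<bar> + M * \<bar>?p y t - v y t\<bar>)"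
  proof (intro sum_mono)
    fix y t
    have "\<bar>?E f * (v y t - ?p y t)\<bar> \<le> M * \<bar>?p y t - v y t\<bar>"
      unfolding abs_mult using Ef by (intro mult_mono) auto
    then show "\<bar>?E (\<lambda>\<sigma>. f \<sigma> * of_bool (\<sigma> y = t)) - ?E f * ?p y t\<bar>
      \<le> \<bar>?E (\<lambda>\<sigma>. f \<sigma> * of_bool (\<sigma> y = t)) - ?E f * v y t\<bar> + M * \<bar>?p y t - v y t\<bar>"
      by (simp add: algebra_simps)
  qed
  also have "\<dots> = (\<Sum>y<n. \<Sum>t\<in>UNIV. \<bar>?E (\<lambda>\<sigma>. f \<sigma> * of_bool (\<sigma> y = t)) - ?E f * v y t\<bar>)
      + M * (\<Sum>y<n. \<Sum>t\<in>UNIV. \<bar>?p y t - v y t\<bar>)"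
    by (simp add: sum.distrib sum_distrib_left)
  also have "\<dots> \<le> M * \<eta> * real n + M * (\<eta> * real n)"
    using 1 2 Ef by (intro add_mono mult_left_mono) auto
  finally show "(\<Sum>y<n. \<Sum>t\<in>UNIV. \<bar>?E (\<lambda>\<sigma>. f \<sigma> * of_bool (\<sigma> y = t)) - ?E f * ?p y t\<bar>)
    \<le> M * (2 * \<eta>) * real n" by simp
qed

text \<open>\<open>sum_gcov_square_le\<close> is applied to the indicators of one spin
  \<open>t\<close> at a time; their covariances are the entries \<open>(t, t)\<close> of the pair
  sums. The 2 under the root undoes the factor 1/2 of the total variation distance, and
  \<open>CARD('w)\<close> counts the spins \<open>t\<close>.\<close>

lemma mixing_if_tv_pair_small:
  fixes w :: "nat \<Rightarrow> 'w::finite list \<Rightarrow> real"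
  assumes pos: "positive_on nb w {..<m}"
    and tv: "(\<Sum>x<n. \<Sum>y<n. tv_pair n (m, nb, w) x y) \<le> \<delta> * (real n)\<^sup>2"
  shows "mixing n nb w {..<m} (marg1 n nb w {..<m}) (real CARD('w) * sqrt (2 * \<delta>))"
  unfolding mixing_def
proof (intro allI impI)
  fix f :: "(nat \<Rightarrow> 'w) \<Rightarrow> real" and M
  assume f: "\<forall>\<sigma>\<in>configs n. \<bar>f \<sigma>\<bar> \<le> M"
  let ?F = "{..<m}" and ?h = "\<lambda>t y (\<sigma> :: nat \<Rightarrow> 'w). of_bool (\<sigma> y = t) :: real"
  obtain \<sigma>0 :: "nat \<Rightarrow> 'w" where "\<sigma>0 \<in> configs n" using configs_nonempty by blast
  with f have M: "0 \<le> M" by fastforce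
  have tv2: "2 * tv_pair n (m, nb, w) x y
    = (\<Sum>st\<in>UNIV. \<bar>gcov n nb w ?F (?h (fst st) x) (?h (snd st) y)\<bar>)" for x y
    by (simp add: tv_pair_def mu1_def mu2_def marg2_eq_gibbs marg1_eq_gibbs gcov_def)
  have "(\<Sum>y<n. \<bar>gcov n nb w ?F f (?h t y)\<bar>) \<le> M * (sqrt (2 * \<delta>) * real n)" for t
  proof -
    have "(\<Sum>y<n. \<bar>gcov n nb w ?F f (?h t y)\<bar>)\<^sup>2
       \<le> M\<^sup>2 * (\<Sum>x<n. \<Sum>y<n. \<bar>gcov n nb w ?F (?h t x) (?h t y)\<bar>)"
      using f by (intro sum_gcov_square_le[OF pos]) auto
    also have "(\<Sum>x<n. \<Sum>y<n. \<bar>gcov n nb w ?F (?h t x) (?h t y)\<bar>)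
       \<le> (\<Sum>x<n. \<Sum>y<n. 2 * tv_pair n (m, nb, w) x y)"
      unfolding tv2
      by (intro sum_mono order_trans[OF _ member_le_sum[of "(t, t)"]]) auto
    also have "\<dots> = 2 * (\<Sum>x<n. \<Sum>y<n. tv_pair n (m, nb, w) x y)" by (simp add: sum_distrib_left)
    also have "\<dots> \<le> 2 * \<delta> * (real n)\<^sup>2" using tv by simp
    finally have "(\<Sum>y<n. \<bar>gcov n nb w ?F f (?h t y)\<bar>)\<^sup>2 \<le> M\<^sup>2 * (2 * \<delta> * (real n)\<^sup>2)"
      by (simp add: mult_left_mono)
    then have "(\<Sum>y<n. \<bar>gcov n nb w ?F f (?h t y)\<bar>) \<le> sqrt (M\<^sup>2 * (2 * \<delta> * (real n)\<^sup>2))"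
      by (rule real_le_rsqrt)
    also have "\<dots> = M * (sqrt (2 * \<delta>) * real n)" using M by (simp add: real_sqrt_mult)
    finally show ?thesis .
  qed
  then have "(\<Sum>t\<in>(UNIV :: 'w set). \<Sum>y<n. \<bar>gcov n nb w ?F f (?h t y)\<bar>)
    \<le> (\<Sum>t\<in>(UNIV :: 'w set). M * (sqrt (2 * \<delta>) * real n))" by (intro sum_mono)
  then show "(\<Sum>y<n. \<Sum>t\<in>UNIV. \<bar>gibbs n nb w ?F (\<lambda>\<sigma>. f \<sigma> * of_bool (\<sigma> y = t))
      - gibbs n nb w ?F f * marg1 n nb w ?F y t\<bar>) \<le> M * (real CARD('w) * sqrt (2 * \<delta>)) * real n"
    by (subst sum.swap) (simp add: gcov_def marg1_eq_gibbs mult_ac)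
qed

section \<open>Joint laws on tuples of variable nodes\<close>

abbreviation tuples :: "nat \<Rightarrow> nat \<Rightarrow> nat list set" where
  "tuples n l \<equiv> {ys. set ys \<subseteq> {..<n} \<and> length ys = l}"

text \<open>For \<open>f = 1\<close> this is the l1 distance between the joint law of the spins on
  \<open>Y\<close> and the product of the \<open>v y\<close>. The observable \<open>f\<close> is
  carried along so that an induction on \<open>Y\<close> can absorb revealed spins into it.\<close>

definition deviation :: "nat \<Rightarrow> (nat \<Rightarrow> nat list) \<Rightarrow> (nat \<Rightarrow> 'w::finite list \<Rightarrow> real) \<Rightarrow> nat set
    \<Rightarrow> (nat \<Rightarrow> 'w \<Rightarrow> real) \<Rightarrow> ((nat \<Rightarrow> 'w) \<Rightarrow> real) \<Rightarrow> nat set \<Rightarrow> real" where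
  "deviation n nb w F v f Y = (\<Sum>\<tau>\<in>PiE Y (\<lambda>_. UNIV).
     \<bar>gibbs n nb w F (\<lambda>\<sigma>. f \<sigma> * of_bool (\<forall>y\<in>Y. \<sigma> y = \<tau> y)) - gibbs n nb w F f * (\<Prod>y\<in>Y. v y (\<tau> y))\<bar>)"

lemma deviation_nonneg: "0 \<le> deviation n nb w F v f Y"
  by (simp add: deviation_def sum_nonneg)

lemma sum_PiE_insert:
  assumes "z \<notin> Y"
  shows "(\<Sum>\<tau>\<in>PiE (insert z Y) (\<lambda>_. UNIV :: 'b set). \<phi> \<tau>)
    = (\<Sum>t\<in>UNIV. \<Sum>\<tau>\<in>PiE Y (\<lambda>_. UNIV). \<phi> (\<tau>(z := t)))"
proof -
  have "(\<Sum>\<tau>\<in>PiE (insert z Y) (\<lambda>_. UNIV :: 'b set). \<phi> \<tau>)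
    = (\<Sum>(t, \<tau>)\<in>UNIV \<times> PiE Y (\<lambda>_. UNIV). \<phi> (\<tau>(z := t)))"
    unfolding PiE_insert_eq using inj_combinator[OF assms, of "\<lambda>_. UNIV :: 'b set"]
    by (subst sum.reindex) (auto intro!: sum.cong simp: case_prod_unfold)
  then show ?thesis by (simp add: sum.cartesian_product)
qed

text \<open>Reveal \<open>z\<close> before the rest and absorb the indicator of its spin into the
  observable. Replacing the expectation of that observable by \<open>v z t\<close> times that of
  \<open>f\<close> is paid for once per \<open>t\<close>, since the product weights over
  \<open>Y\<close> sum to 1.\<close>

lemma deviation_insert:
  fixes w :: "nat \<Rightarrow> 'w::finite list \<Rightarrow> real"
  assumes "finite Y" "z \<notin> Y"
    and v0: "\<And>y t. 0 \<le> v y t" and v1: "\<And>y. (\<Sum>t\<in>UNIV. v y t) = 1"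
  shows "deviation n nb w F v f (insert z Y)
    \<le> (\<Sum>t\<in>UNIV. deviation n nb w F v (\<lambda>\<sigma>. f \<sigma> * of_bool (\<sigma> z = t)) Y)
      + (\<Sum>t\<in>UNIV. \<bar>gibbs n nb w F (\<lambda>\<sigma>. f \<sigma> * of_bool (\<sigma> z = t)) - gibbs n nb w F f * v z t\<bar>)"
proof -
  let ?E = "gibbs n nb w F"
  let ?p = "\<lambda>\<tau>. \<Prod>y\<in>Y. v y (\<tau> y)"
  have p1: "(\<Sum>\<tau>\<in>PiE Y (\<lambda>_. UNIV). ?p \<tau>) = 1"
    using assms by (subst prod_sum_PiE[symmetric]) auto
  have "deviation n nb w F v f (insert z Y)
    = (\<Sum>t\<in>UNIV. \<Sum>\<tau>\<in>PiE Y (\<lambda>_. UNIV). \<bar>?E (\<lambda>\<sigma>. f \<sigma> * of_bool (\<sigma> z = t) * of_bool (\<forall>y\<in>Y. \<sigma> y = \<tau> y))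
        - ?E f * v z t * ?p \<tau>\<bar>)"
    unfolding deviation_def sum_PiE_insert[OF assms(2)]
  proof (intro sum.cong refl arg_cong2[where f = "\<lambda>a b. \<bar>a - b\<bar>"])
    fix t \<tau>
    have "(\<forall>y\<in>Y. \<sigma> y = (\<tau>(z := t)) y) \<longleftrightarrow> (\<forall>y\<in>Y. \<sigma> y = \<tau> y)" for \<sigma> :: "nat \<Rightarrow> 'w"
      using assms(2) by auto
    then show "?E (\<lambda>\<sigma>. f \<sigma> * of_bool (\<forall>y\<in>insert z Y. \<sigma> y = (\<tau>(z := t)) y))
      = ?E (\<lambda>\<sigma>. f \<sigma> * of_bool (\<sigma> z = t) * of_bool (\<forall>y\<in>Y. \<sigma> y = \<tau> y))"
      by (simp add: of_bool_conj mult_ac)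
    have "(\<Prod>y\<in>Y. v y ((\<tau>(z := t)) y)) = ?p \<tau>"
      using assms(2) by (intro prod.cong) auto
    then show "?E f * (\<Prod>y\<in>insert z Y. v y ((\<tau>(z := t)) y)) = ?E f * v z t * ?p \<tau>"
      using assms by simp
  qed
  also have "\<dots> \<le> (\<Sum>t\<in>UNIV. \<Sum>\<tau>\<in>PiE Y (\<lambda>_. UNIV).
      \<bar>?E (\<lambda>\<sigma>. f \<sigma> * of_bool (\<sigma> z = t) * of_bool (\<forall>y\<in>Y. \<sigma> y = \<tau> y)) - ?E (\<lambda>\<sigma>. f \<sigma> * of_bool (\<sigma> z = t)) * ?p \<tau>\<bar>
      + \<bar>?E (\<lambda>\<sigma>. f \<sigma> * of_bool (\<sigma> z = t)) - ?E f * v z t\<bar> * ?p \<tau>)"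
  proof (intro sum_mono)
    fix t \<tau>
    have "0 \<le> ?p \<tau>" by (intro prod_nonneg) (simp add: v0)
    then have "\<bar>?E (\<lambda>\<sigma>. f \<sigma> * of_bool (\<sigma> z = t)) - ?E f * v z t\<bar> * ?p \<tau>
      = \<bar>?E (\<lambda>\<sigma>. f \<sigma> * of_bool (\<sigma> z = t)) * ?p \<tau> - ?E f * v z t * ?p \<tau>\<bar>"
      by (simp add: abs_mult flip: left_diff_distrib)
    then show "\<bar>?E (\<lambda>\<sigma>. f \<sigma> * of_bool (\<sigma> z = t) * of_bool (\<forall>y\<in>Y. \<sigma> y = \<tau> y)) - ?E f * v z t * ?p \<tau>\<bar>
      \<le> \<bar>?E (\<lambda>\<sigma>. f \<sigma> * of_bool (\<sigma> z = t) * of_bool (\<forall>y\<in>Y. \<sigma> y = \<tau> y)) - ?E (\<lambda>\<sigma>. f \<sigma> * of_bool (\<sigma> z = t)) * ?p \<tau>\<bar>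
      + \<bar>?E (\<lambda>\<sigma>. f \<sigma> * of_bool (\<sigma> z = t)) - ?E f * v z t\<bar> * ?p \<tau>"
      by linarith
  qed
  also have "\<dots> = (\<Sum>t\<in>UNIV. deviation n nb w F v (\<lambda>\<sigma>. f \<sigma> * of_bool (\<sigma> z = t)) Y)
      + (\<Sum>t\<in>UNIV. \<bar>?E (\<lambda>\<sigma>. f \<sigma> * of_bool (\<sigma> z = t)) - ?E f * v z t\<bar>)"
    by (simp add: sum.distrib deviation_def p1 flip: sum_distrib_left)
  finally show ?thesis .
qed

lemma sum_tuples_Suc:
  "(\<Sum>ys\<in>tuples n (Suc l). \<phi> ys) = (\<Sum>z<n. \<Sum>zs\<in>tuples n l. \<phi> (z # zs))"
proof -
  have "(\<Sum>ys\<in>tuples n (Suc l). \<phi> ys) = (\<Sum>(zs, z)\<in>tuples n l \<times> {..<n}. \<phi> (z # zs))"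
    unfolding lists_length_Suc_eq
    by (subst sum.reindex) (auto simp: inj_on_def case_prod_unfold)
  also have "\<dots> = (\<Sum>z<n. \<Sum>zs\<in>tuples n l. \<phi> (z # zs))"
    by (subst sum.swap) (simp add: sum.cartesian_product)
  finally show ?thesis .
qed

text \<open>The set \<open>set zs - X\<close> forgets repetitions, so tuples with repeated entries need no separate treatment.\<close>

lemma sum_deviation_le:
  fixes w :: "nat \<Rightarrow> 'w::finite list \<Rightarrow> real"
  assumes pos: "positive_on nb w F" and mix: "mixing n nb w F v \<eta>" and \<eta>: "0 \<le> \<eta>"
    and v0: "\<And>y t. 0 \<le> v y t" and v1: "\<And>y. (\<Sum>t\<in>UNIV. v y t) = 1"
    and f: "\<And>\<sigma>. \<sigma> \<in> configs n \<Longrightarrow> \<bar>f \<sigma>\<bar> \<le> M"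
  shows "(\<Sum>zs\<in>tuples n l. deviation n nb w F v f (set zs - X))
    \<le> M * \<eta> * (real CARD('w) + 2) ^ l * real n ^ l"
  using f
proof (induction l arbitrary: f)
  case 0
  obtain \<sigma>0 :: "nat \<Rightarrow> 'w" where "\<sigma>0 \<in> configs n" using configs_nonempty by blast
  with 0 have M: "0 \<le> M" by fastforce
  have "tuples n 0 = {[]}" by auto
  then show ?case using M \<eta> by (simp add: deviation_def)
next
  case (Suc l)
  let ?q = "real CARD('w)" and ?E = "gibbs n nb w F" and ?dev = "deviation n nb w F v"
  let ?c = "(?q + 2) ^ l"
  let ?g = "\<lambda>z t \<sigma>. f \<sigma> * of_bool (\<sigma> z = t)"
  obtain \<sigma>0 :: "nat \<Rightarrow> 'w" where "\<sigma>0 \<in> configs n" using configs_nonempty by blast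
  with Suc.prems have M: "0 \<le> M" by fastforce
  have g: "\<bar>?g z t \<sigma>\<bar> \<le> M" if "\<sigma> \<in> configs n" for z t \<sigma>
    using Suc.prems[OF that] M by (simp add: of_bool_def)
  \<comment> \<open>The last term covers a \<open>z\<close> that lies in \<open>X\<close> or repeats
    an entry of \<open>zs\<close>. It raises the growth rate per entry from
    \<open>CARD('w) + 1\<close> to \<open>CARD('w) + 2\<close>.\<close>
  have step: "?dev f (set (z # zs) - X)
    \<le> (\<Sum>t\<in>UNIV. ?dev (?g z t) (set zs - X)) + (\<Sum>t\<in>UNIV. \<bar>?E (?g z t) - ?E f * v z t\<bar>)
      + ?dev f (set zs - X)" for z zs
  proof (cases "z \<in> X \<or> z \<in> set zs")
    case True
    then have "set (z # zs) - X = set zs - X" by auto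
    moreover have "0 \<le> (\<Sum>t\<in>UNIV. ?dev (?g z t) (set zs - X))"
      by (intro sum_nonneg deviation_nonneg)
    ultimately show ?thesis by (simp add: sum_nonneg)
  next
    case False
    then have "set (z # zs) - X = insert z (set zs - X)" by auto
    then show ?thesis
      using deviation_insert[of "set zs - X" z v n nb w F f] False v0 v1
        deviation_nonneg[of n nb w F v f "set zs - X"] by simp
  qed
  have "(\<Sum>ys\<in>tuples n (Suc l). ?dev f (set ys - X))
    \<le> (\<Sum>z<n. \<Sum>zs\<in>tuples n l. (\<Sum>t\<in>UNIV. ?dev (?g z t) (set zs - X))
        + (\<Sum>t\<in>UNIV. \<bar>?E (?g z t) - ?E f * v z t\<bar>) + ?dev f (set zs - X))"
    unfolding sum_tuples_Suc by (intro sum_mono step)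
  also have "\<dots> = (\<Sum>z<n. \<Sum>t\<in>UNIV. \<Sum>zs\<in>tuples n l. ?dev (?g z t) (set zs - X))
      + real (card (tuples n l)) * (\<Sum>z<n. \<Sum>t\<in>UNIV. \<bar>?E (?g z t) - ?E f * v z t\<bar>)
      + (\<Sum>z<n. \<Sum>zs\<in>tuples n l. ?dev f (set zs - X))"
    by (simp add: sum.distrib sum_distrib_left sum.swap[of _ UNIV "tuples n l"])
  also have "\<dots> \<le> (\<Sum>z<n. \<Sum>t\<in>(UNIV :: 'w set). M * \<eta> * ?c * real n ^ l)
      + real n ^ l * (M * \<eta> * real n) + (\<Sum>z<n. M * \<eta> * ?c * real n ^ l)"
  proof (intro add_mono sum_mono)
    show "real (card (tuples n l)) * (\<Sum>z<n. \<Sum>t\<in>UNIV. \<bar>?E (?g z t) - ?E f * v z t\<bar>)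
      \<le> real n ^ l * (M * \<eta> * real n)"
      using mixingD[OF mix Suc.prems]
      by (subst card_lists_length_eq) (auto intro: mult_left_mono)
  qed (use Suc.IH g Suc.prems in auto)
  also have "\<dots> = M * \<eta> * real n ^ Suc l * (?q * ?c + 1 + ?c)" by (simp add: algebra_simps)
  also have "\<dots> \<le> M * \<eta> * real n ^ Suc l * (?q + 2) ^ Suc l"
  proof (intro mult_left_mono)
    have "1 \<le> ?c" by simp
    then have "?q * ?c + 1 + ?c \<le> ?q * ?c + 2 * ?c" by linarith
    then show "?q * ?c + 1 + ?c \<le> (?q + 2) ^ Suc l" by (simp add: algebra_simps)
  qed (use M \<eta> in auto)
  finally show ?case by (simp add: mult_ac)
qed

text \<open>This separates the distinguished endpoint of an edge from the remaining entries: a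
  member of a tuple sits at one of \<open>Suc l\<close> positions, and removing a fixed position is
  a bijection onto pairs of a node and a shorter tuple. With \<open>x\<close> fixed, the remaining
  entries range freely, as \<open>sum_deviation_le\<close> requires.\<close>

lemma sum_tuples_members_le:
  fixes \<psi> :: "nat \<Rightarrow> nat set \<Rightarrow> real"
  assumes "\<And>x Y. 0 \<le> \<psi> x Y"
  shows "(\<Sum>ys\<in>tuples n (Suc l). \<Sum>x\<in>set ys. \<psi> x (set ys - {x}))
    \<le> real (Suc l) * (\<Sum>x<n. \<Sum>zs\<in>tuples n l. \<psi> x (set zs - {x}))"
proof -
  have "(\<Sum>ys\<in>tuples n (Suc l). \<Sum>x\<in>set ys. \<psi> x (set ys - {x}))
    \<le> (\<Sum>ys\<in>tuples n (Suc l). \<Sum>i<Suc l. \<psi> (ys ! i) (set ys - {ys ! i}))"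
  proof (intro sum_mono)
    fix ys assume "ys \<in> tuples n (Suc l)"
    then have "set ys = (!) ys ` {..<Suc l}" by (auto simp: set_conv_nth)
    then have "(\<Sum>x\<in>set ys. \<psi> x (set ys - {x})) = (\<Sum>x\<in>(!) ys ` {..<Suc l}. \<psi> x (set ys - {x}))"
      by simp
    also have "\<dots> \<le> (\<Sum>i<Suc l. \<psi> (ys ! i) (set ys - {ys ! i}))"
      using sum_image_le[of "{..<Suc l}" "\<lambda>x. \<psi> x (set ys - {x})" "(!) ys"] assms by (simp add: o_def)
    finally show "(\<Sum>x\<in>set ys. \<psi> x (set ys - {x})) \<le> (\<Sum>i<Suc l. \<psi> (ys ! i) (set ys - {ys ! i}))" .
  qed
  also have "\<dots> = (\<Sum>i<Suc l. \<Sum>ys\<in>tuples n (Suc l). \<psi> (ys ! i) (set ys - {ys ! i}))"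
    by (rule sum.swap)
  also have "\<dots> = (\<Sum>i<Suc l. \<Sum>(x, zs)\<in>{..<n} \<times> tuples n l. \<psi> x (set zs - {x}))"
  proof (intro sum.cong refl)
    fix i assume i: "i \<in> {..<Suc l}"
    show "(\<Sum>ys\<in>tuples n (Suc l). \<psi> (ys ! i) (set ys - {ys ! i}))
      = (\<Sum>(x, zs)\<in>{..<n} \<times> tuples n l. \<psi> x (set zs - {x}))"
    proof (rule sum.reindex_bij_witness[where
          i = "\<lambda>(x, zs). take i zs @ x # drop i zs" and
          j = "\<lambda>ys. (ys ! i, take i ys @ drop (Suc i) ys)"], goal_cases)
      case (1 ys)
      then show ?case using i by (simp add: id_take_nth_drop[symmetric])
    next
      case (2 ys)
      then have "set (take i ys) \<subseteq> {..<n}" "set (drop (Suc i) ys) \<subseteq> {..<n}"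
        by (auto dest!: in_set_takeD in_set_dropD)
      moreover have "ys ! i < n"
      proof -
        have "ys ! i \<in> set ys" using 2 i by (intro nth_mem) auto
        with 2 show ?thesis by blast
      qed
      ultimately show ?case using 2 i by auto
    next
      case (3 b)
      then show ?case using i by (auto simp: min_def nth_append)
    next
      case (4 b)
      then have "set (take i (snd b)) \<subseteq> {..<n}" "set (drop i (snd b)) \<subseteq> {..<n}"
        by (auto dest!: in_set_takeD in_set_dropD)
      then show ?case using 4 i by auto
    next
      case (5 ys)
      then have "set ys = insert (ys ! i) (set (take i ys) \<union> set (drop (Suc i) ys))"
        using i arg_cong[OF id_take_nth_drop[of i ys], of set] by simp
      then have "set ys - {ys ! i} = set (take i ys @ drop (Suc i) ys) - {ys ! i}" by auto
      then show ?case by simp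
    qed
  qed
  also have "\<dots> = real (Suc l) * (\<Sum>x<n. \<Sum>zs\<in>tuples n l. \<psi> x (set zs - {x}))"
    by (simp add: sum.cartesian_product)
  finally show ?thesis .
qed

section \<open>Belief Propagation errors\<close>

definition weights_bdd :: "real \<Rightarrow> (nat \<Rightarrow> nat list) \<Rightarrow> (nat \<Rightarrow> 'w list \<Rightarrow> real) \<Rightarrow> nat set \<Rightarrow> bool" where
  "weights_bdd K nb w F \<longleftrightarrow> (\<forall>a\<in>F. \<forall>ts. length ts = length (nb a) \<longrightarrow> 1 / K \<le> w a ts \<and> w a ts \<le> K)"

lemma weights_bddD:
  "weights_bdd K nb w F \<Longrightarrow> a \<in> F \<Longrightarrow> 1 / K \<le> w a (map \<sigma> (nb a)) \<and> w a (map \<sigma> (nb a)) \<le> K"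
  unfolding weights_bdd_def by simp

lemma weights_bdd_subset: "weights_bdd K nb w F \<Longrightarrow> F' \<subseteq> F \<Longrightarrow> weights_bdd K nb w F'"
  unfolding weights_bdd_def by blast

lemma weights_bdd_positive: "weights_bdd K nb w F \<Longrightarrow> 0 < K \<Longrightarrow> positive_on nb w F"
  unfolding positive_on_def using weights_bddD[of K nb w F]
  by (meson less_le_trans zero_less_divide_1_iff)

lemma prod_weight_bounds:
  fixes K :: real
  assumes K: "1 \<le> K" and B: "card B \<le> d" and f: "\<And>b. b \<in> B \<Longrightarrow> 1 / K \<le> f b \<and> f b \<le> K"
  shows "1 / K ^ d \<le> (\<Prod>b\<in>B. f b)" "(\<Prod>b\<in>B. f b) \<le> K ^ d"
proof -
  have "(\<Prod>b\<in>B. f b) \<le> (\<Prod>b\<in>B. K)"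
    using K f by (intro prod_mono) (meson divide_nonneg_pos less_le_trans order_trans zero_le_one zero_less_one)
  also have "\<dots> \<le> K ^ d" using K B by (simp add: power_increasing)
  finally show "(\<Prod>b\<in>B. f b) \<le> K ^ d" .
  have "1 / K ^ d \<le> 1 / K ^ card B" using K B by (simp add: field_simps power_increasing)
  also have "\<dots> = (\<Prod>b\<in>B. 1 / K)" by (simp add: power_divide)
  also have "\<dots> \<le> (\<Prod>b\<in>B. f b)" using K f by (intro prod_mono) auto
  finally show "1 / K ^ d \<le> (\<Prod>b\<in>B. f b)" .
qed

text \<open>No weight sees the spin of \<open>x\<close>, so that spin is uniform and independent of
  the others. Concretely, resetting \<open>x\<close> to \<open>s\<close> is a weight-preserving
  bijection from each class of configurations with a given spin at \<open>x\<close> onto the class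
  of spin \<open>s\<close>.\<close>

lemma gibbs_isolated:
  fixes w :: "nat \<Rightarrow> 'w::finite list \<Rightarrow> real"
  assumes "x < n" and iso: "\<And>a. a \<in> F \<Longrightarrow> x \<notin> set (nb a)"
  shows "gibbs n nb w F (\<lambda>\<sigma>. of_bool (\<sigma> x = s) * g \<sigma>)
    = gibbs n nb w F (\<lambda>\<sigma>. g (\<sigma>(x := s))) / real CARD('w)"
proof -
  let ?\<phi> = "\<lambda>\<sigma>. gweight nb w F \<sigma> * g \<sigma>" and ?C = "\<lambda>u. {\<sigma>\<in>configs n. \<sigma> x = u}"
  have gw: "gweight nb w F (\<sigma>(x := s)) = gweight nb w F \<sigma>" for \<sigma>
    unfolding gweight_def using iso
    by (intro prod.cong refl arg_cong[of _ _ "w _"]) (auto intro!: map_cong)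
  have "(\<Sum>\<sigma>\<in>configs n. gweight nb w F \<sigma> * g (\<sigma>(x := s))) = (\<Sum>\<sigma>\<in>configs n. ?\<phi> (\<sigma>(x := s)))"
    by (simp add: gw)
  also have "\<dots> = (\<Sum>u\<in>UNIV. \<Sum>\<sigma>\<in>?C u. ?\<phi> (\<sigma>(x := s)))"
    by (rule sum.group[symmetric]) auto
  also have "\<dots> = (\<Sum>u\<in>(UNIV :: 'w set). \<Sum>\<sigma>\<in>?C s. ?\<phi> \<sigma>)"
  proof (rule sum.cong[OF refl])
    fix u :: 'w
    show "(\<Sum>\<sigma>\<in>?C u. ?\<phi> (\<sigma>(x := s))) = (\<Sum>\<sigma>\<in>?C s. ?\<phi> \<sigma>)"
      by (rule sum.reindex_bij_witness[where i = "\<lambda>\<sigma>. \<sigma>(x := u)" and j = "\<lambda>\<sigma>. \<sigma>(x := s)"])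
        (use \<open>x < n\<close> in \<open>auto simp: configs_def PiE_def extensional_def\<close>)
  qed
  also have "\<dots> = real CARD('w) * (\<Sum>\<sigma>\<in>?C s. ?\<phi> \<sigma>)" by simp
  also have "(\<Sum>\<sigma>\<in>?C s. ?\<phi> \<sigma>) = (\<Sum>\<sigma>\<in>configs n. gweight nb w F \<sigma> * (of_bool (\<sigma> x = s) * g \<sigma>))"
    by (subst sum.inter_filter) (auto intro!: sum.cong)
  finally show ?thesis unfolding gibbs_def by (simp only:) simp
qed

lemma gweight_union:
  "finite F \<Longrightarrow> finite B \<Longrightarrow> F \<inter> B = {} \<Longrightarrow>
    gweight nb w (F \<union> B) \<sigma> = gweight nb w F \<sigma> * (\<Prod>b\<in>B. w b (map \<sigma> (nb b)))"
  unfolding gweight_def by (rule prod.union_disjoint)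

text \<open>Both kinds of message are instances: \<open>F\<close> lacks every constraint node at
  \<open>x\<close>, and \<open>B\<close> is either a single node at \<open>x\<close> or all nodes at
  \<open>x\<close> but one. The uniform factor \<open>1 / CARD('w)\<close> cancels in the
  normalisation.\<close>

lemma marg1_attach:
  fixes w :: "nat \<Rightarrow> 'w::finite list \<Rightarrow> real"
  assumes "x < n" "finite F" "finite B" "F \<inter> B = {}"
    and iso: "\<And>a. a \<in> F \<Longrightarrow> x \<notin> set (nb a)"
    and pos: "positive_on nb w F"
  shows "marg1 n nb w (F \<union> B) x s
    = gibbs n nb w F (\<lambda>\<sigma>. \<Prod>b\<in>B. w b (map (\<sigma>(x := s)) (nb b)))
      / (\<Sum>t\<in>UNIV. gibbs n nb w F (\<lambda>\<sigma>. \<Prod>b\<in>B. w b (map (\<sigma>(x := t)) (nb b))))"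
proof -
  let ?E = "gibbs n nb w F" and ?q = "real CARD('w)"
  define r where "r \<sigma> = (\<Prod>b\<in>B. w b (map \<sigma> (nb b)))" for \<sigma> :: "nat \<Rightarrow> 'w"
  have T: "gibbs n nb w (F \<union> B) g = ?E (\<lambda>\<sigma>. g \<sigma> * r \<sigma>) / ?E r" for g
    unfolding r_def by (rule gibbs_tilt[OF pos]) (simp add: gweight_union assms)
  have I: "?E (\<lambda>\<sigma>. of_bool (\<sigma> x = t) * r \<sigma>) = ?E (\<lambda>\<sigma>. r (\<sigma>(x := t))) / ?q" for t
    using \<open>x < n\<close> iso by (rule gibbs_isolated)
  have "?E r = ?E (\<lambda>\<sigma>. \<Sum>t\<in>UNIV. of_bool (\<sigma> x = t) * r \<sigma>)"
  proof -
    have "(\<Sum>t\<in>UNIV. of_bool (\<sigma> x = t) * r \<sigma>) = r \<sigma>" for \<sigma>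
      by (simp add: of_bool_def flip: sum_distrib_right)
    then show ?thesis by simp
  qed
  also have "\<dots> = (\<Sum>t\<in>UNIV. ?E (\<lambda>\<sigma>. r (\<sigma>(x := t))) / ?q)"
    by (simp only: gibbs_sum I)
  finally have "?E r = (\<Sum>t\<in>UNIV. ?E (\<lambda>\<sigma>. r (\<sigma>(x := t)))) / ?q"
    by (simp add: sum_divide_distrib)
  then have "marg1 n nb w (F \<union> B) x s = ?E (\<lambda>\<sigma>. r (\<sigma>(x := s))) / (\<Sum>t\<in>UNIV. ?E (\<lambda>\<sigma>. r (\<sigma>(x := t))))"
    unfolding marg1_eq_gibbs T I by simp
  then show ?thesis unfolding r_def .
qed

text \<open>Peeling off one factor at a time leaves a covariance between that factor and the product
  of those not yet peeled. Which products occur depends on the order of peeling; summing over all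
  subsets \<open>D\<close> gives a bound free of that order.\<close>

lemma gibbs_prod_approx:
  fixes w :: "nat \<Rightarrow> 'w::finite list \<Rightarrow> real"
  assumes pos: "positive_on nb w F" and K: "1 \<le> K" and "finite B"
    and f: "\<And>b \<sigma>. b \<in> B \<Longrightarrow> \<sigma> \<in> configs n \<Longrightarrow> 0 \<le> f b \<sigma> \<and> f b \<sigma> \<le> K"
  shows "\<bar>gibbs n nb w F (\<lambda>\<sigma>. \<Prod>b\<in>B. f b \<sigma>) - (\<Prod>b\<in>B. gibbs n nb w F (f b))\<bar>
    \<le> K ^ card B * (\<Sum>b\<in>B. \<Sum>D\<in>Pow (B - {b}). \<bar>gcov n nb w F (\<lambda>\<sigma>. \<Prod>b\<in>D. f b \<sigma>) (f b)\<bar>)"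
  using \<open>finite B\<close> f
proof (induction B rule: finite_induct)
  case empty
  then show ?case by (simp add: gibbs_const[OF pos])
next
  case (insert c B)
  let ?E = "gibbs n nb w F" and ?cov = "\<lambda>D b. \<bar>gcov n nb w F (\<lambda>\<sigma>. \<Prod>b\<in>D. f b \<sigma>) (f b)\<bar>"
  have Ec: "0 \<le> ?E (f c)" "?E (f c) \<le> K"
    using gibbs_bounds[OF pos, of n 0 "f c" K] insert.prems by auto
  have "?E (\<lambda>\<sigma>. \<Prod>b\<in>insert c B. f b \<sigma>) - (\<Prod>b\<in>insert c B. ?E (f b))
    = gcov n nb w F (\<lambda>\<sigma>. \<Prod>b\<in>B. f b \<sigma>) (f c) + ?E (f c) * (?E (\<lambda>\<sigma>. \<Prod>b\<in>B. f b \<sigma>) - (\<Prod>b\<in>B. ?E (f b)))"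
    using insert.hyps by (simp add: gcov_def algebra_simps)
  also have "\<bar>\<dots>\<bar> \<le> ?cov B c + K * \<bar>?E (\<lambda>\<sigma>. \<Prod>b\<in>B. f b \<sigma>) - (\<Prod>b\<in>B. ?E (f b))\<bar>"
    using Ec by (intro order_trans[OF abs_triangle_ineq] add_mono) (auto simp: abs_mult mult_right_mono)
  also have "\<dots> \<le> K ^ Suc (card B) * ?cov B c
      + K * (K ^ card B * (\<Sum>b\<in>B. \<Sum>D\<in>Pow (B - {b}). ?cov D b))"
  proof (intro add_mono mult_left_mono)
    have "1 * ?cov B c \<le> K ^ Suc (card B) * ?cov B c"
      using K by (intro mult_right_mono one_le_power) auto
    then show "?cov B c \<le> K ^ Suc (card B) * ?cov B c" by simp
  qed (use insert.IH insert.prems K in auto)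
  also have "\<dots> = K ^ Suc (card B) * (?cov B c + (\<Sum>b\<in>B. \<Sum>D\<in>Pow (B - {b}). ?cov D b))"
    by (simp add: algebra_simps)
  also have "\<dots> \<le> K ^ Suc (card B) * ((\<Sum>D\<in>Pow (insert c B - {c}). ?cov D c)
      + (\<Sum>b\<in>B. \<Sum>D\<in>Pow (insert c B - {b}). ?cov D b))"
  proof (intro mult_left_mono add_mono sum_mono)
    show "?cov B c \<le> (\<Sum>D\<in>Pow (insert c B - {c}). ?cov D c)"
      using insert.hyps by (intro member_le_sum) auto
    show "(\<Sum>D\<in>Pow (B - {b}). ?cov D b) \<le> (\<Sum>D\<in>Pow (insert c B - {b}). ?cov D b)" for b
      using insert.hyps by (intro sum_mono2) auto
  qed (use K in auto)
  also have "\<dots> = K ^ card (insert c B) * (\<Sum>b\<in>insert c B. \<Sum>D\<in>Pow (insert c B - {b}). ?cov D b)"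
    using insert.hyps by simp
  finally show ?case .
qed

text \<open>The only \<open>\<tau>\<close> that contributes is the restriction of
  \<open>\<sigma>\<close> to \<open>Y\<close>. The expansion reduces statements on weights to
  statements on the indicators in \<open>deviation\<close>.\<close>

lemma weight_expand:
  fixes W :: "'w::finite list \<Rightarrow> real"
  assumes "finite Y" "set ys \<subseteq> insert x Y"
  shows "W (map (\<sigma>(x := s)) ys)
    = (\<Sum>\<tau>\<in>PiE Y (\<lambda>_. UNIV). of_bool (\<forall>y\<in>Y. \<sigma> y = \<tau> y) * W (map (\<tau>(x := s)) ys))"
proof -
  have "(\<Sum>\<tau>\<in>PiE Y (\<lambda>_. UNIV). of_bool (\<forall>y\<in>Y. \<sigma> y = \<tau> y) * W (map (\<tau>(x := s)) ys))
    = (\<Sum>\<tau>\<in>PiE Y (\<lambda>_. UNIV). if \<tau> = restrict \<sigma> Y then W (map ((restrict \<sigma> Y)(x := s)) ys) else 0)"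
  proof (intro sum.cong refl)
    fix \<tau> :: "'a \<Rightarrow> 'w" assume "\<tau> \<in> PiE Y (\<lambda>_. UNIV)"
    then have "(\<forall>y\<in>Y. \<sigma> y = \<tau> y) \<longleftrightarrow> \<tau> = restrict \<sigma> Y"
      by (auto simp: fun_eq_iff restrict_def PiE_def extensional_def)
    then show "of_bool (\<forall>y\<in>Y. \<sigma> y = \<tau> y) * W (map (\<tau>(x := s)) ys)
      = (if \<tau> = restrict \<sigma> Y then W (map ((restrict \<sigma> Y)(x := s)) ys) else 0)" by simp
  qed
  also have "\<dots> = W (map ((restrict \<sigma> Y)(x := s)) ys)"
    using \<open>finite Y\<close> by (subst sum.delta) (auto simp: finite_PiE)
  also have "map ((restrict \<sigma> Y)(x := s)) ys = map (\<sigma>(x := s)) ys"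
    using assms(2) by (intro map_cong) auto
  finally show ?thesis ..
qed

text \<open>Once the spin of \<open>x\<close> is set to \<open>s\<close>, the weight depends on the
  spins on \<open>Y\<close> alone, so it may be averaged under the product of the \<open>v y\<close>
  instead, as the right-hand side of the Belief Propagation equation does.\<close>

lemma gibbs_weight_deviation:
  fixes w :: "nat \<Rightarrow> 'w::finite list \<Rightarrow> real" and W :: "'w list \<Rightarrow> real"
  assumes "finite Y" "set ys \<subseteq> insert x Y" and W: "\<And>\<tau>. \<bar>W (map \<tau> ys)\<bar> \<le> K"
  shows "\<bar>gibbs n nb w F (\<lambda>\<sigma>. g \<sigma> * W (map (\<sigma>(x := s)) ys))
      - gibbs n nb w F g * (\<Sum>\<tau>\<in>PiE Y (\<lambda>_. UNIV). W (map (\<tau>(x := s)) ys) * (\<Prod>y\<in>Y. v y (\<tau> y)))\<bar>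
    \<le> K * deviation n nb w F v g Y"
proof -
  let ?E = "gibbs n nb w F" and ?W = "\<lambda>\<tau>. W (map (\<tau>(x := s)) ys)"
  have "?E (\<lambda>\<sigma>. g \<sigma> * W (map (\<sigma>(x := s)) ys))
    = ?E (\<lambda>\<sigma>. \<Sum>\<tau>\<in>PiE Y (\<lambda>_. UNIV). ?W \<tau> * (g \<sigma> * of_bool (\<forall>y\<in>Y. \<sigma> y = \<tau> y)))"
    by (subst weight_expand[OF assms(1,2)]) (simp add: sum_distrib_left mult_ac)
  also have "\<dots> = (\<Sum>\<tau>\<in>PiE Y (\<lambda>_. UNIV). ?W \<tau> * ?E (\<lambda>\<sigma>. g \<sigma> * of_bool (\<forall>y\<in>Y. \<sigma> y = \<tau> y)))"
    by (simp only: gibbs_sum gibbs_cmult)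
  finally have "?E (\<lambda>\<sigma>. g \<sigma> * W (map (\<sigma>(x := s)) ys))
      - ?E g * (\<Sum>\<tau>\<in>PiE Y (\<lambda>_. UNIV). ?W \<tau> * (\<Prod>y\<in>Y. v y (\<tau> y)))
    = (\<Sum>\<tau>\<in>PiE Y (\<lambda>_. UNIV). ?W \<tau> * (?E (\<lambda>\<sigma>. g \<sigma> * of_bool (\<forall>y\<in>Y. \<sigma> y = \<tau> y)) - ?E g * (\<Prod>y\<in>Y. v y (\<tau> y))))"
    by (simp add: sum_distrib_left sum_subtractf algebra_simps)
  also have "\<bar>\<dots>\<bar> \<le> (\<Sum>\<tau>\<in>PiE Y (\<lambda>_. UNIV).
      K * \<bar>?E (\<lambda>\<sigma>. g \<sigma> * of_bool (\<forall>y\<in>Y. \<sigma> y = \<tau> y)) - ?E g * (\<Prod>y\<in>Y. v y (\<tau> y))\<bar>)"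
    by (intro order_trans[OF sum_abs] sum_mono) (auto simp: abs_mult intro!: mult_right_mono W)
  finally show ?thesis by (simp add: deviation_def sum_distrib_left)
qed

text \<open>The average \<open>?S\<close> of the weight under the product of the \<open>v y\<close>
  serves as an intermediate value: both the expectation of the product and the product of the
  expectations are close to \<open>?E g * ?S\<close>.\<close>

lemma gcov_weight_le:
  fixes w :: "nat \<Rightarrow> 'w::finite list \<Rightarrow> real" and W :: "'w list \<Rightarrow> real"
  assumes pos: "positive_on nb w F"
    and Y: "finite Y" "set ys \<subseteq> insert x Y" and W: "\<And>\<tau>. \<bar>W (map \<tau> ys)\<bar> \<le> K"
    and g: "\<And>\<sigma>. \<sigma> \<in> configs n \<Longrightarrow> \<bar>g \<sigma>\<bar> \<le> M"
  shows "\<bar>gcov n nb w F g (\<lambda>\<sigma>. W (map (\<sigma>(x := s)) ys))\<bar>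
    \<le> K * (deviation n nb w F v g Y + M * deviation n nb w F v (\<lambda>_. 1) Y)"
proof -
  let ?E = "gibbs n nb w F"
  let ?S = "\<Sum>\<tau>\<in>PiE Y (\<lambda>_. UNIV). W (map (\<tau>(x := s)) ys) * (\<Prod>y\<in>Y. v y (\<tau> y))"
  have 1: "\<bar>?E (\<lambda>\<sigma>. g \<sigma> * W (map (\<sigma>(x := s)) ys)) - ?E g * ?S\<bar> \<le> K * deviation n nb w F v g Y"
    by (rule gibbs_weight_deviation[where W = W, OF Y W])
  have "\<bar>?E (\<lambda>\<sigma>. W (map (\<sigma>(x := s)) ys)) - ?S\<bar> \<le> K * deviation n nb w F v (\<lambda>_. 1) Y"
    using gibbs_weight_deviation[where W = W, OF Y W, of n nb w F "\<lambda>_. 1" s v] by (simp add: gibbs_const[OF pos])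
  moreover have "\<bar>?E g\<bar> \<le> M" using g by (rule abs_gibbs_le[OF pos])
  ultimately have 2: "\<bar>?E g * (?E (\<lambda>\<sigma>. W (map (\<sigma>(x := s)) ys)) - ?S)\<bar> \<le> M * (K * deviation n nb w F v (\<lambda>_. 1) Y)"
    unfolding abs_mult by (intro mult_mono) auto
  have "gcov n nb w F g (\<lambda>\<sigma>. W (map (\<sigma>(x := s)) ys))
    = (?E (\<lambda>\<sigma>. g \<sigma> * W (map (\<sigma>(x := s)) ys)) - ?E g * ?S) - ?E g * (?E (\<lambda>\<sigma>. W (map (\<sigma>(x := s)) ys)) - ?S)"
    by (simp add: gcov_def algebra_simps)
  then show ?thesis using 1 2 by (simp add: algebra_simps)
qed

text \<open>Split the difference as \<open>(P s - Q s) / p + Q s * (q - p) / (p * q)\<close>. Summed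
  over \<open>s\<close>, the \<open>Q s\<close> give a \<open>q\<close> that cancels, so each part
  contributes at most the l1 distance divided by \<open>p\<close>, and \<open>p\<close> is at least
  \<open>c\<close>.\<close>

lemma sum_normalize_diff_le:
  fixes P Q :: "'w::finite \<Rightarrow> real"
  assumes c: "0 < c" "\<And>s. c \<le> P s" and Q: "\<And>s. 0 < Q s"
  shows "(\<Sum>s\<in>UNIV. \<bar>P s / (\<Sum>t\<in>UNIV. P t) - Q s / (\<Sum>t\<in>UNIV. Q t)\<bar>)
    \<le> 2 / c * (\<Sum>s\<in>UNIV. \<bar>P s - Q s\<bar>)"
proof -
  define p q where "p = (\<Sum>t\<in>UNIV. P t)" and "q = (\<Sum>t\<in>UNIV. Q t)"
  let ?\<Delta> = "\<Sum>s\<in>UNIV. \<bar>P s - Q s\<bar>"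
  have q: "0 < q" unfolding q_def using Q by (intro sum_pos) auto
  \<comment> \<open>Any one spin already bounds the total from below.\<close>
  have "c \<le> P undefined" by (rule c)
  also have "\<dots> \<le> p" unfolding p_def
    using c by (intro member_le_sum) (auto intro: order_trans[of 0 c] less_imp_le)
  finally have p: "c \<le> p" .
  with c have p0: "0 < p" by simp
  have "\<bar>P s / p - Q s / q\<bar> \<le> \<bar>P s - Q s\<bar> / p + Q s * (?\<Delta> / (p * q))" for s
  proof -
    have "P s / p - Q s / q = (P s - Q s) / p + Q s * ((q - p) / (p * q))"
      using p0 q by (simp add: field_simps)
    also have "\<bar>\<dots>\<bar> \<le> \<bar>(P s - Q s) / p\<bar> + \<bar>Q s * ((q - p) / (p * q))\<bar>" by (rule abs_triangle_ineq)
    also have "\<bar>Q s * ((q - p) / (p * q))\<bar> = Q s * (\<bar>q - p\<bar> / (p * q))"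
      using p0 q Q[of s] by (simp add: abs_mult)
    also have "\<bar>q - p\<bar> \<le> ?\<Delta>"
      using sum_abs[of "\<lambda>s. P s - Q s" UNIV] by (simp add: p_def q_def sum_subtractf abs_minus_commute)
    then have "Q s * (\<bar>q - p\<bar> / (p * q)) \<le> Q s * (?\<Delta> / (p * q))"
      using p0 q Q[of s] by (intro mult_left_mono divide_right_mono) auto
    finally show ?thesis using p0 by simp
  qed
  then have "(\<Sum>s\<in>UNIV. \<bar>P s / p - Q s / q\<bar>) \<le> (\<Sum>s\<in>UNIV. \<bar>P s - Q s\<bar> / p + Q s * (?\<Delta> / (p * q)))"
    by (rule sum_mono)
  also have "\<dots> = ?\<Delta> / p + q * (?\<Delta> / (p * q))"
    by (simp add: sum.distrib q_def flip: sum_divide_distrib sum_distrib_right)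
  also have "\<dots> = 2 / p * ?\<Delta>" using q by simp
  also have "\<dots> \<le> 2 / c * ?\<Delta>"
    using p c by (intro mult_right_mono divide_left_mono) (auto intro: sum_nonneg)
  finally show ?thesis unfolding p_def q_def .
qed

text \<open>The summand \<open>D = {}\<close> controls the constraint-to-variable message; the other ones control the
  correlations between the constraint nodes at \<open>x\<close>, which enter the variable-to-constraint messages.\<close>

definition edge_error :: "nat \<Rightarrow> nat \<Rightarrow> (nat \<Rightarrow> nat list) \<Rightarrow> (nat \<Rightarrow> 'w::finite list \<Rightarrow> real) \<Rightarrow> nat \<Rightarrow> nat \<Rightarrow> real" where
  "edge_error n m nb w x a = (\<Sum>s\<in>UNIV. \<Sum>D\<in>Pow (var_nbhd m nb x - {a}).
     deviation n nb w ({..<m} - var_nbhd m nb x) (marg1 n nb w ({..<m} - {a}))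
       (\<lambda>\<sigma>. \<Prod>b\<in>D. w b (map (\<sigma>(x := s)) (nb b))) (set (nb a) - {x}))"

lemma edge_error_nonneg: "0 \<le> edge_error n m nb w x a"
  unfolding edge_error_def by (intro sum_nonneg deviation_nonneg)

lemma finite_var_nbhd [simp]: "finite (var_nbhd m nb x)"
  by (simp add: var_nbhd_def)

context
  fixes n m d :: nat and nb :: "nat \<Rightarrow> nat list" and w :: "nat \<Rightarrow> 'w::finite list \<Rightarrow> real"
    and K :: real and x :: nat
  assumes K: "1 \<le> K" and bdd: "weights_bdd K nb w {..<m}"
    and x: "x < n" and deg: "card (var_nbhd m nb x) \<le> d"
begin

private abbreviation "N \<equiv> var_nbhd m nb x"
private abbreviation "F0 \<equiv> {..<m} - N"
private abbreviation "E0 \<equiv> gibbs n nb w F0"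
private abbreviation "fw b s \<equiv> (\<lambda>\<sigma> :: nat \<Rightarrow> 'w. w b (map (\<sigma>(x := s)) (nb b)))"

private lemma pos: "F \<subseteq> {..<m} \<Longrightarrow> positive_on nb w F"
  using weights_bdd_positive[OF weights_bdd_subset[OF bdd]] K by simp

private lemma fw_bounds: "b \<in> {..<m} \<Longrightarrow> 1 / K \<le> fw b s \<sigma> \<and> fw b s \<sigma> \<le> K"
  by (rule weights_bddD[OF bdd])

private lemma abs_weight_le: "b \<in> {..<m} \<Longrightarrow> \<bar>w b (map \<sigma> (nb b))\<bar> \<le> K"
proof -
  assume "b \<in> {..<m}"
  then have "1 / K \<le> w b (map \<sigma> (nb b)) \<and> w b (map \<sigma> (nb b)) \<le> K" by (rule weights_bddD[OF bdd])
  moreover have "0 \<le> 1 / K" using K by simp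
  ultimately show ?thesis by linarith
qed

private lemma N_sub: "N \<subseteq> {..<m}" by (auto simp: var_nbhd_def)

private lemma marg1_attach_N:
  assumes "B \<subseteq> N"
  shows "marg1 n nb w (F0 \<union> B) x s
    = E0 (\<lambda>\<sigma>. \<Prod>b\<in>B. fw b s \<sigma>) / (\<Sum>t\<in>UNIV. E0 (\<lambda>\<sigma>. \<Prod>b\<in>B. fw b t \<sigma>))"
  using x finite_subset[OF assms] assms pos[of F0]
  by (intro marg1_attach) (auto simp: var_nbhd_def)

text \<open>\<open>gcov_weight_le\<close> bounds each covariance by the deviation for
  \<open>D\<close> plus \<open>K ^ d\<close> times the deviation for the constant observable. The
  latter is the summand \<open>D = {}\<close> and is charged at most \<open>2 ^ d\<close> times,
  once per subset.\<close>

private lemma sum_gcov_le: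
  assumes "b \<in> N" "B \<subseteq> N"
  shows "(\<Sum>D\<in>Pow (B - {b}). \<bar>gcov n nb w F0 (\<lambda>\<sigma>. \<Prod>c\<in>D. fw c s \<sigma>) (fw b s)\<bar>)
    \<le> K * (1 + 2 ^ d * K ^ d) * (\<Sum>D\<in>Pow (N - {b}).
      deviation n nb w F0 (marg1 n nb w ({..<m} - {b})) (\<lambda>\<sigma>. \<Prod>c\<in>D. fw c s \<sigma>) (set (nb b) - {x}))"
proof -
  let ?dev = "\<lambda>D. deviation n nb w F0 (marg1 n nb w ({..<m} - {b})) (\<lambda>\<sigma>. \<Prod>c\<in>D. fw c s \<sigma>) (set (nb b) - {x})"
  let ?cov = "\<lambda>D. \<bar>gcov n nb w F0 (\<lambda>\<sigma>. \<Prod>c\<in>D. fw c s \<sigma>) (fw b s)\<bar>"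
  have fN: "finite (Pow (N - {b}))" by simp
  have "(\<Sum>D\<in>Pow (B - {b}). ?cov D) \<le> (\<Sum>D\<in>Pow (N - {b}). ?cov D)"
    using assms by (intro sum_mono2) auto
  also have "\<dots> \<le> (\<Sum>D\<in>Pow (N - {b}). K * (?dev D + K ^ d * ?dev {}))"
  proof (intro sum_mono)
    fix D assume D: "D \<in> Pow (N - {b})"
    have "D \<subseteq> N" using D by auto
    then have "card D \<le> d" using deg card_mono[of N D] by simp
    then have "\<bar>\<Prod>c\<in>D. fw c s \<sigma>\<bar> \<le> K ^ d" for \<sigma>
    proof -
      have f: "1 / K \<le> fw c s \<sigma> \<and> fw c s \<sigma> \<le> K" if "c \<in> D" for c
        using \<open>D \<subseteq> N\<close> N_sub that by (intro fw_bounds) auto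
      have "1 / K ^ d \<le> (\<Prod>c\<in>D. fw c s \<sigma>)" "(\<Prod>c\<in>D. fw c s \<sigma>) \<le> K ^ d"
        using prod_weight_bounds[OF K \<open>card D \<le> d\<close>, of "\<lambda>c. fw c s \<sigma>"] f by auto
      moreover have "0 \<le> 1 / K ^ d" using K by simp
      ultimately show ?thesis by linarith
    qed
    then show "?cov D \<le> K * (?dev D + K ^ d * ?dev {})"
      using gcov_weight_le[of nb w F0 "set (nb b) - {x}" "nb b" x "w b" K n "\<lambda>\<sigma>. \<Prod>c\<in>D. fw c s \<sigma>" "K ^ d" s
          "marg1 n nb w ({..<m} - {b})"]
        pos[of F0] abs_weight_le N_sub assms by auto
  qed
  also have "\<dots> = K * (\<Sum>D\<in>Pow (N - {b}). ?dev D) + K * (real (card (Pow (N - {b}))) * K ^ d * ?dev {})"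
    by (simp add: sum.distrib sum_distrib_left algebra_simps)
  also have "\<dots> \<le> K * (\<Sum>D\<in>Pow (N - {b}). ?dev D) + K * (2 ^ d * K ^ d * (\<Sum>D\<in>Pow (N - {b}). ?dev D))"
  proof (intro add_mono mult_left_mono mult_mono order_refl)
    have "card (N - {b}) \<le> d" using deg card_mono[of N "N - {b}"] by auto
    then show "real (card (Pow (N - {b}))) \<le> 2 ^ d"
      by (simp add: card_Pow power_increasing)
    show "?dev {} \<le> (\<Sum>D\<in>Pow (N - {b}). ?dev D)"
      by (intro member_le_sum deviation_nonneg) auto
  qed (use K in \<open>auto intro: deviation_nonneg\<close>)
  finally show ?thesis by (simp add: algebra_simps)
qed

text \<open>By \<open>marg1_attach_N\<close> the message is the normalisation of \<open>P\<close>,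
  an expectation of a product over the other constraint nodes at \<open>x\<close>. The Belief
  Propagation expression is the normalisation of \<open>Q\<close>, the product of the separate
  expectations. Hence the error stems only from correlations between constraint nodes that share
  \<open>x\<close>.\<close>

lemma variable_message_error_le:
  assumes a: "a \<in> N"
  shows "(\<Sum>s\<in>UNIV. \<bar>msg_va n (m, nb, w) x a s
        - (\<Prod>b\<in>N - {a}. msg_av n (m, nb, w) b x s) / (\<Sum>t\<in>UNIV. \<Prod>b\<in>N - {a}. msg_av n (m, nb, w) b x t)\<bar>)
    \<le> 2 * K ^ (2 * d + 1) * (1 + 2 ^ d * K ^ d) * (\<Sum>b\<in>N. edge_error n m nb w x b)"
proof -
  let ?B = "N - {a}" and ?L = "K * (1 + 2 ^ d * K ^ d)"
  define P where "P s = E0 (\<lambda>\<sigma>. \<Prod>b\<in>?B. fw b s \<sigma>)" for s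
  define p where "p b s = E0 (fw b s)" for b s
  define Q where "Q s = (\<Prod>b\<in>?B. p b s)" for s
  define dev where "dev b s = (\<Sum>D\<in>Pow (N - {b}).
      deviation n nb w F0 (marg1 n nb w ({..<m} - {b})) (\<lambda>\<sigma>. \<Prod>c\<in>D. fw c s \<sigma>) (set (nb b) - {x}))" for b s
  have pos0: "positive_on nb w F0" by (rule pos) auto
  have cB: "card ?B \<le> d" using deg card_mono[of N ?B] by auto
  have p_pos: "0 < p b s" if "b \<in> N" for b s
  proof -
    have "1 / K \<le> p b s"
      unfolding p_def using fw_bounds[of b _ s] that N_sub
      by (intro gibbs_bounds(1)[OF pos0, where B = K]) auto
    then show ?thesis using K by (meson less_le_trans zero_less_divide_1_iff zero_less_one)
  qed
  have va: "msg_va n (m, nb, w) x a s = P s / (\<Sum>t\<in>UNIV. P t)" for s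
  proof -
    have "{..<m} - {a} = F0 \<union> ?B" using a N_sub by auto
    then show ?thesis using marg1_attach_N[of ?B s] by (simp add: msg_va_def P_def)
  qed
  have av: "msg_av n (m, nb, w) b x s = p b s / (\<Sum>t\<in>UNIV. p b t)" if "b \<in> N" for b s
  proof -
    have "{..<m} - (N - {b}) = F0 \<union> {b}" using that N_sub by auto
    then show ?thesis using marg1_attach_N[of "{b}" s] that by (simp add: msg_av_def p_def)
  qed
  \<comment> \<open>\<open>z\<close> collects the normalisations of the incoming messages. It does
    not depend on the spin, so it cancels in the Belief Propagation quotient.\<close>
  define z where "z = (\<Prod>b\<in>?B. \<Sum>t\<in>UNIV. p b t)"
  have "0 < (\<Sum>t\<in>UNIV. p b t)" if "b \<in> N" for b using p_pos[OF that] by (intro sum_pos) auto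
  then have z: "0 < z" unfolding z_def by (intro prod_pos) auto
  have prod_av: "(\<Prod>b\<in>?B. msg_av n (m, nb, w) b x s) = Q s / z" for s
    by (simp add: av Q_def z_def prod_dividef)
  have rhs: "(\<Prod>b\<in>?B. msg_av n (m, nb, w) b x s) / (\<Sum>t\<in>UNIV. \<Prod>b\<in>?B. msg_av n (m, nb, w) b x t)
    = Q s / (\<Sum>t\<in>UNIV. Q t)" for s
    unfolding prod_av using z by (simp flip: sum_divide_distrib)
  have P_ge: "1 / K ^ d \<le> P s" for s
  proof -
    have f: "1 / K \<le> fw c s \<sigma> \<and> fw c s \<sigma> \<le> K" if "c \<in> ?B" for c \<sigma>
      using N_sub that by (intro fw_bounds) auto
    show ?thesis unfolding P_def
      by (rule gibbs_bounds(1)[OF pos0, where B = "K ^ d"])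
        (use prod_weight_bounds[OF K cB, of "\<lambda>c. fw c s _"] f in blast)+
  qed
  have PQ: "\<bar>P s - Q s\<bar> \<le> K ^ d * (?L * (\<Sum>b\<in>N. dev b s))" for s
  proof -
    have f: "0 \<le> fw b s \<sigma> \<and> fw b s \<sigma> \<le> K" if "b \<in> ?B" for b \<sigma>
    proof -
      have "1 / K \<le> fw b s \<sigma> \<and> fw b s \<sigma> \<le> K" using that N_sub by (intro fw_bounds) auto
      moreover have "0 \<le> 1 / K" using K by simp
      ultimately show ?thesis by linarith
    qed
    have "\<bar>P s - Q s\<bar> \<le> K ^ card ?B * (\<Sum>b\<in>?B. \<Sum>D\<in>Pow (?B - {b}).
        \<bar>gcov n nb w F0 (\<lambda>\<sigma>. \<Prod>c\<in>D. fw c s \<sigma>) (fw b s)\<bar>)"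
      unfolding P_def Q_def p_def
      by (rule gibbs_prod_approx[OF pos0 K, of ?B n "\<lambda>b. fw b s"]) (use f in auto)
    also have "\<dots> \<le> K ^ d * (\<Sum>b\<in>?B. ?L * dev b s)"
    proof (rule mult_mono)
      show "K ^ card ?B \<le> K ^ d" using K cB by (rule power_increasing[rotated])
      show "(\<Sum>b\<in>?B. \<Sum>D\<in>Pow (?B - {b}). \<bar>gcov n nb w F0 (\<lambda>\<sigma>. \<Prod>c\<in>D. fw c s \<sigma>) (fw b s)\<bar>)
        \<le> (\<Sum>b\<in>?B. ?L * dev b s)"
        unfolding dev_def by (rule sum_mono, rule sum_gcov_le) auto
    qed (use K in \<open>auto intro!: sum_nonneg\<close>)
    also have "\<dots> \<le> K ^ d * (\<Sum>b\<in>N. ?L * dev b s)"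
      using K by (intro mult_left_mono sum_mono2) (auto simp: dev_def intro!: mult_nonneg_nonneg sum_nonneg deviation_nonneg)
    finally show ?thesis by (simp add: sum_distrib_left)
  qed
  have "(\<Sum>s\<in>UNIV. \<bar>P s / (\<Sum>t\<in>UNIV. P t) - Q s / (\<Sum>t\<in>UNIV. Q t)\<bar>)
    \<le> 2 / (1 / K ^ d) * (\<Sum>s\<in>UNIV. \<bar>P s - Q s\<bar>)"
    using K P_ge p_pos by (intro sum_normalize_diff_le) (auto simp: Q_def intro!: prod_pos)
  also have "\<dots> \<le> 2 * K ^ d * (\<Sum>s\<in>UNIV. K ^ d * (?L * (\<Sum>b\<in>N. dev b s)))"
  proof -
    have "2 / (1 / K ^ d) = 2 * K ^ d" by simp
    then show ?thesis using K PQ by (simp only:) (intro mult_left_mono sum_mono, auto)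
  qed
  also have "\<dots> = 2 * K ^ (2 * d + 1) * (1 + 2 ^ d * K ^ d) * (\<Sum>b\<in>N. \<Sum>s\<in>UNIV. dev b s)"
  proof -
    have "(\<Sum>b\<in>N. \<Sum>s\<in>UNIV. dev b s) = (\<Sum>s\<in>UNIV. \<Sum>b\<in>N. dev b s)" by (rule sum.swap)
    moreover have "K ^ (2 * d + 1) = K ^ d * K ^ d * K" by (simp add: power_add mult_2)
    moreover have "(\<Sum>s\<in>UNIV. K ^ d * (?L * (\<Sum>b\<in>N. dev b s))) = K ^ d * (?L * (\<Sum>s\<in>UNIV. \<Sum>b\<in>N. dev b s))"
      by (simp only: sum_distrib_left)
    ultimately show ?thesis by (simp only: mult_ac)
  qed
  finally show ?thesis unfolding va rhs dev_def edge_error_def .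
qed

text \<open>The message is the normalisation of the expected weight \<open>p\<close>, and the Belief
  Propagation expression that of \<open>R\<close>, the average of the same weight under the product
  of the messages into \<open>a\<close>. These messages are the marginals without \<open>a\<close>,
  exactly the reference marginals in \<open>edge_error\<close>, so the summand \<open>D = {}\<close>
  suffices.\<close>

lemma factor_message_error_le:
  assumes a: "a \<in> N"
  shows "(\<Sum>s\<in>UNIV. \<bar>msg_av n (m, nb, w) a x s
        - (\<Sum>\<tau>\<in>{\<tau>\<in>PiE (set (nb a)) (\<lambda>_. UNIV). \<tau> x = s}.
             w a (map \<tau> (nb a)) * (\<Prod>y\<in>set (nb a) - {x}. msg_va n (m, nb, w) y a (\<tau> y)))
          / (\<Sum>\<tau>\<in>PiE (set (nb a)) (\<lambda>_. UNIV).
             w a (map \<tau> (nb a)) * (\<Prod>y\<in>set (nb a) - {x}. msg_va n (m, nb, w) y a (\<tau> y)))\<bar>)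
    \<le> 2 * K\<^sup>2 * edge_error n m nb w x a"
proof -
  let ?Y = "set (nb a) - {x}"
  define v where "v = marg1 n nb w ({..<m} - {a})"
  have v: "msg_va n (m, nb, w) y a = v y" for y by (simp add: msg_va_def v_def)
  have pos0: "positive_on nb w F0" by (rule pos) auto
  have v0: "0 \<le> v y t" and v1: "(\<Sum>t\<in>UNIV. v y t) = 1" for y t
    unfolding v_def by (auto intro!: marg1_nonneg sum_marg1 pos)
  have am: "a \<in> {..<m}" and xa: "insert x ?Y = set (nb a)" using a by (auto simp: var_nbhd_def)
  define R where "R s = (\<Sum>\<tau>\<in>PiE ?Y (\<lambda>_. UNIV). w a (map (\<tau>(x := s)) (nb a)) * (\<Prod>y\<in>?Y. v y (\<tau> y)))" for s
  define p where "p s = E0 (fw a s)" for s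
  have num: "(\<Sum>\<tau>\<in>{\<tau>\<in>PiE (set (nb a)) (\<lambda>_. UNIV). \<tau> x = s}. w a (map \<tau> (nb a)) * (\<Prod>y\<in>?Y. v y (\<tau> y))) = R s" for s
  proof -
    let ?\<phi> = "\<lambda>\<tau>. w a (map \<tau> (nb a)) * (\<Prod>y\<in>?Y. v y (\<tau> y))"
    have "(\<Sum>\<tau>\<in>{\<tau>\<in>PiE (set (nb a)) (\<lambda>_. UNIV). \<tau> x = s}. ?\<phi> \<tau>)
      = (\<Sum>\<tau>\<in>PiE (insert x ?Y) (\<lambda>_. UNIV). if \<tau> x = s then ?\<phi> \<tau> else 0)"
      unfolding xa by (rule sum.inter_filter) (simp add: finite_PiE)
    also have "\<dots> = (\<Sum>t\<in>UNIV. if t = s then \<Sum>\<tau>\<in>PiE ?Y (\<lambda>_. UNIV). ?\<phi> (\<tau>(x := s)) else 0)"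
    proof (subst sum_PiE_insert, simp, rule sum.cong[OF refl])
      fix t
      show "(\<Sum>\<tau>\<in>PiE ?Y (\<lambda>_. UNIV). if (\<tau>(x := t)) x = s then ?\<phi> (\<tau>(x := t)) else 0)
        = (if t = s then \<Sum>\<tau>\<in>PiE ?Y (\<lambda>_. UNIV). ?\<phi> (\<tau>(x := s)) else 0)"
        by (cases "t = s") simp_all
    qed
    also have "\<dots> = (\<Sum>\<tau>\<in>PiE ?Y (\<lambda>_. UNIV). ?\<phi> (\<tau>(x := s)))" by simp
    also have "\<dots> = R s"
      unfolding R_def by (intro sum.cong refl arg_cong2[where f = "(*)"] prod.cong) auto
    finally show ?thesis .
  qed
  have den: "(\<Sum>\<tau>\<in>PiE (set (nb a)) (\<lambda>_. UNIV). w a (map \<tau> (nb a)) * (\<Prod>y\<in>?Y. v y (\<tau> y))) = (\<Sum>t\<in>UNIV. R t)"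
    unfolding num[symmetric] by (rule sum.group[symmetric]) (auto simp: finite_PiE)
  have av: "msg_av n (m, nb, w) a x s = p s / (\<Sum>t\<in>UNIV. p t)" for s
  proof -
    have "{..<m} - (N - {a}) = F0 \<union> {a}" using a N_sub by auto
    then show ?thesis using marg1_attach_N[of "{a}" s] a by (simp add: msg_av_def p_def)
  qed
  have p_ge: "1 / K \<le> p s" for s
    unfolding p_def using fw_bounds[OF am, of _ s] by (intro gibbs_bounds(1)[OF pos0, where B = K]) auto
  have R_pos: "0 < R s" for s
  proof -
    have "(\<Sum>\<tau>\<in>PiE ?Y (\<lambda>_. UNIV). 1 / K * (\<Prod>y\<in>?Y. v y (\<tau> y))) \<le> R s"
      unfolding R_def using fw_bounds[OF am, of _ s] v0
      by (intro sum_mono mult_right_mono prod_nonneg) auto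
    also have "(\<Sum>\<tau>\<in>PiE ?Y (\<lambda>_. UNIV). 1 / K * (\<Prod>y\<in>?Y. v y (\<tau> y))) = 1 / K * (\<Prod>y\<in>?Y. \<Sum>t\<in>UNIV. v y t)"
      by (subst prod_sum_PiE) (auto simp: sum_distrib_left)
    finally have "1 / K \<le> R s" by (simp add: v1)
    then show ?thesis using K by (meson less_le_trans zero_less_divide_1_iff zero_less_one)
  qed
  have pR: "\<bar>p s - R s\<bar> \<le> K * deviation n nb w F0 v (\<lambda>_. 1) ?Y" for s
    using gibbs_weight_deviation[of ?Y "nb a" x "w a" K n nb w F0 "\<lambda>_. 1" s v] abs_weight_le[OF am]
    by (auto simp: p_def R_def gibbs_const[OF pos0])
  have "(\<Sum>s\<in>UNIV. \<bar>p s / (\<Sum>t\<in>UNIV. p t) - R s / (\<Sum>t\<in>UNIV. R t)\<bar>)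
    \<le> 2 / (1 / K) * (\<Sum>s\<in>UNIV. \<bar>p s - R s\<bar>)"
    using K p_ge R_pos by (intro sum_normalize_diff_le) auto
  also have "\<dots> \<le> 2 * K * (\<Sum>s\<in>(UNIV :: 'w set). K * deviation n nb w F0 v (\<lambda>_. 1) ?Y)"
    using K pR by (simp del: sum_constant) (intro sum_mono)
  also have "\<dots> = 2 * K\<^sup>2 * (\<Sum>s\<in>(UNIV :: 'w set). deviation n nb w F0 v (\<lambda>\<sigma>. \<Prod>b\<in>{}. fw b s \<sigma>) ?Y)"
    by (simp add: power2_eq_square)
  also have "\<dots> \<le> 2 * K\<^sup>2 * edge_error n m nb w x a"
    unfolding edge_error_def v_def
    by (intro mult_left_mono sum_mono member_le_sum[where i = "{}"] deviation_nonneg) auto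
  finally show ?thesis unfolding v num den av .
qed

end

text \<open>The two terms stem from the two kinds of message. The bound for the message from
  \<open>x\<close> to \<open>a\<close> is a sum over all constraint nodes at \<open>x\<close> that
  is the same for every \<open>a\<close>; summing it over \<open>a\<close> yields the factor
  \<open>d\<close>.\<close>

definition bp_const :: "nat \<Rightarrow> real \<Rightarrow> real" where
  "bp_const d K = 2 * K ^ (2 * d + 1) * (1 + 2 ^ d * K ^ d) * real d + 2 * K\<^sup>2"

lemma bp_error_le:
  fixes w :: "nat \<Rightarrow> 'w::finite list \<Rightarrow> real"
  assumes K: "1 \<le> K" and bdd: "weights_bdd K nb w {..<m}"
    and deg: "\<And>x. x < n \<Longrightarrow> card (var_nbhd m nb x) \<le> d"
  shows "bp_error n (m, nb, w) \<le> bp_const d K * (\<Sum>x<n. \<Sum>a\<in>var_nbhd m nb x. edge_error n m nb w x a)"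
proof -
  let ?L = "2 * K ^ (2 * d + 1) * (1 + 2 ^ d * K ^ d)"
  let ?e = "edge_error n m nb w" and ?N = "var_nbhd m nb"
  have "bp_error n (m, nb, w) \<le> (\<Sum>x<n. \<Sum>a\<in>?N x. ?L * (\<Sum>b\<in>?N x. ?e x b) + 2 * K\<^sup>2 * ?e x a)"
    unfolding bp_error_def prod.case
  proof (rule sum_mono, rule sum_mono)
    fix x a assume "x \<in> {..<n}" and a: "a \<in> ?N x"
    then have x: "x < n" by simp
    show "(\<Sum>s\<in>UNIV. \<bar>msg_va n (m, nb, w) x a s
          - (\<Prod>b\<in>?N x - {a}. msg_av n (m, nb, w) b x s)
            / (\<Sum>t\<in>UNIV. \<Prod>b\<in>?N x - {a}. msg_av n (m, nb, w) b x t)\<bar>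
      + \<bar>msg_av n (m, nb, w) a x s
          - (\<Sum>\<tau>\<in>{\<tau>\<in>PiE (set (nb a)) (\<lambda>_. UNIV). \<tau> x = s}.
               w a (map \<tau> (nb a)) * (\<Prod>y\<in>set (nb a) - {x}. msg_va n (m, nb, w) y a (\<tau> y)))
            / (\<Sum>\<tau>\<in>PiE (set (nb a)) (\<lambda>_. UNIV).
               w a (map \<tau> (nb a)) * (\<Prod>y\<in>set (nb a) - {x}. msg_va n (m, nb, w) y a (\<tau> y)))\<bar>)
      \<le> ?L * (\<Sum>b\<in>?N x. ?e x b) + 2 * K\<^sup>2 * ?e x a"
      unfolding sum.distrib
      by (intro add_mono variable_message_error_le[OF K bdd x deg[OF x] a]
          factor_message_error_le[OF K bdd x deg[OF x] a])
  qed
  also have "\<dots> = (\<Sum>x<n. real (card (?N x)) * (?L * (\<Sum>b\<in>?N x. ?e x b)) + 2 * K\<^sup>2 * (\<Sum>a\<in>?N x. ?e x a))"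
    by (rule sum.cong[OF refl]) (simp only: sum.distrib sum_distrib_left[symmetric] sum_constant mult_ac)
  also have "\<dots> \<le> (\<Sum>x<n. real d * (?L * (\<Sum>b\<in>?N x. ?e x b)) + 2 * K\<^sup>2 * (\<Sum>a\<in>?N x. ?e x a))"
  proof (rule sum_mono, rule add_right_mono, rule mult_right_mono)
    fix x
    show "0 \<le> ?L * (\<Sum>b\<in>?N x. ?e x b)"
      using K by (intro mult_nonneg_nonneg sum_nonneg edge_error_nonneg) auto
  qed (use deg in auto)
  also have "\<dots> = bp_const d K * (\<Sum>x<n. \<Sum>a\<in>?N x. ?e x a)"
    unfolding bp_const_def sum.distrib sum_distrib_left[symmetric] by (simp add: algebra_simps)
  finally show ?thesis .
qed

section \<open>Resampling one neighbour tuple\<close>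

text \<open>Deleting constraint nodes tilts the measure by the product of their inverse weights,
  which lies between \<open>1 / K ^ e\<close> and \<open>K ^ e\<close>.\<close>

lemma mixing_remove:
  fixes w :: "nat \<Rightarrow> 'w::finite list \<Rightarrow> real"
  assumes K: "1 \<le> K" and bdd: "weights_bdd K nb w F" and "finite F" "D \<subseteq> F" "card D \<le> e"
    and mix: "mixing n nb w F v \<eta>"
  shows "mixing n nb w (F - D) v ((K ^ e)\<^sup>2 * \<eta>)"
proof -
  define r where "r \<sigma> = (\<Prod>b\<in>D. 1 / w b (map \<sigma> (nb b)))" for \<sigma> :: "nat \<Rightarrow> 'w"
  have pos: "positive_on nb w F" using weights_bdd_positive[OF bdd] K by simp
  show ?thesis
  proof (rule mixing_tilt[OF pos mix, where r = r])
    fix \<sigma> :: "nat \<Rightarrow> 'w"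
    have p: "0 < w b (map \<sigma> (nb b))" if "b \<in> D" for b
      using pos that \<open>D \<subseteq> F\<close> by (auto simp: positive_on_def)
    have "gweight nb w F \<sigma> = gweight nb w (F - D) \<sigma> * (\<Prod>b\<in>D. w b (map \<sigma> (nb b)))"
      unfolding gweight_def using assms by (subst prod.subset_diff[of D F]) auto
    moreover have "(\<Prod>b\<in>D. w b (map \<sigma> (nb b))) * r \<sigma> = 1"
      unfolding r_def prod.distrib[symmetric] using p by (intro prod.neutral) fastforce
    ultimately show "gweight nb w (F - D) \<sigma> = gweight nb w F \<sigma> * r \<sigma>"
      by (simp add: mult.assoc)
    have "1 / K \<le> 1 / w b (map \<sigma> (nb b)) \<and> 1 / w b (map \<sigma> (nb b)) \<le> K" if "b \<in> D" for b
      using weights_bddD[OF bdd, of b \<sigma>] p[OF that] that \<open>D \<subseteq> F\<close> K by (auto simp: field_simps subset_iff)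
    then show "1 / K ^ e \<le> r \<sigma> \<and> r \<sigma> \<le> K ^ e"
      unfolding r_def using prod_weight_bounds[OF K \<open>card D \<le> e\<close>] by auto
  qed (use K in auto)
qed

lemma deviation_nb_cong:
  assumes "\<And>a. a \<in> F \<Longrightarrow> nb a = nb' a"
  shows "deviation n nb w F v f Y = deviation n nb' w F v f Y"
proof -
  have "gibbs n nb w F = gibbs n nb' w F"
    using gibbs_nb_cong[of F nb nb'] assms by blast
  then show ?thesis by (simp add: deviation_def)
qed

lemma marg1_nb_cong:
  fixes w :: "nat \<Rightarrow> 'w::finite list \<Rightarrow> real"
  assumes "\<And>a. a \<in> F \<Longrightarrow> nb a = nb' a"
  shows "marg1 n nb w F = marg1 n nb' w F"
  by (intro ext) (simp add: marg1_eq_gibbs gibbs_nb_cong[of F nb nb', OF assms])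

text \<open>In order: the positions of \<open>x\<close> in the tuple, the spins \<open>s\<close>,
  the subsets \<open>D\<close>, the bound on the observable, the doubling of
  \<open>mixing_own_marginals\<close> together with the deletion of the constraint nodes at
  \<open>x\<close>, and the growth in \<open>sum_deviation_le\<close>.\<close>

definition resample_const :: "'w::finite itself \<Rightarrow> nat \<Rightarrow> nat \<Rightarrow> real \<Rightarrow> real" where
  "resample_const _ d k K = real k * real CARD('w) * 2 ^ d * K ^ d * (2 * (K ^ d)\<^sup>2) * (real CARD('w) + 2) ^ k"

text \<open>The sum runs over all tuples without a degree constraint. This works because, for
  \<open>x\<close> in \<open>ys\<close>, the measure, the observables and the reference marginals in
  the edge error all live on the graph without \<open>a\<close>; the tuple enters only through the
  set \<open>set ys - {x}\<close>.\<close>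

lemma sum_edge_error_resample_le:
  fixes w :: "nat \<Rightarrow> 'w::finite list \<Rightarrow> real"
  assumes K: "1 \<le> K" and bdd: "weights_bdd K nb w ({..<m} - {a})" and a: "a < m"
    and deg: "\<And>x. x < n \<Longrightarrow> card {c\<in>{..<m} - {a}. x \<in> set (nb c)} \<le> d"
    and mix: "mixing n nb w ({..<m} - {a}) v0 \<eta>" and \<eta>: "0 \<le> \<eta>" and l: "Suc l \<le> k"
  shows "(\<Sum>ys\<in>tuples n (Suc l). \<Sum>x\<in>set ys. edge_error n m (nb(a := ys)) w x a)
    \<le> resample_const TYPE('w) d k K * \<eta> * real n ^ Suc l"
proof -
  let ?F = "{..<m} - {a}" and ?q = "real CARD('w)"
  define N where "N x = {c\<in>?F. x \<in> set (nb c)}" for x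
  define v where "v = marg1 n nb w ?F"
  define g where "g D x s \<sigma> = (\<Prod>b\<in>D. w b (map (\<sigma>(x := s)) (nb b)))" for D x s and \<sigma> :: "nat \<Rightarrow> 'w"
  define \<psi> where "\<psi> x Y = (\<Sum>s\<in>UNIV. \<Sum>D\<in>Pow (N x). deviation n nb w (?F - N x) v (g D x s) Y)" for x Y
  have pos: "positive_on nb w ?F" using weights_bdd_positive[OF bdd] K by simp
  \<comment> \<open>Membership of \<open>x\<close> in \<open>ys\<close> puts \<open>a\<close> among
    the constraint nodes at \<open>x\<close>, so \<open>a\<close> is deleted too and the new tuple
    disappears from the measure.\<close>
  have edge: "edge_error n m (nb(a := ys)) w x a = \<psi> x (set ys - {x})" if "x \<in> set ys" for x ys
  proof -
    have N1: "var_nbhd m (nb(a := ys)) x - {a} = N x" "{..<m} - var_nbhd m (nb(a := ys)) x = ?F - N x"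
      using that a by (auto simp: var_nbhd_def N_def)
    have v': "marg1 n (nb(a := ys)) w ?F = v"
      unfolding v_def by (rule marg1_nb_cong) auto
    have dv: "deviation n (nb(a := ys)) w (?F - N x) v f Y = deviation n nb w (?F - N x) v f Y" for f Y
      by (rule deviation_nb_cong) auto
    have gw: "(\<lambda>\<sigma>. \<Prod>b\<in>D. w b (map (\<sigma>(x := s)) ((nb(a := ys)) b))) = g D x s" if "D \<in> Pow (N x)" for D s
      unfolding g_def using that by (intro ext prod.cong) (auto simp: N_def)
    show ?thesis
      unfolding edge_error_def N1 v' dv \<psi>_def
      by (rule sum.cong[OF refl], rule sum.cong[OF refl]) (simp only: gw, simp)
  qed
  have mix1: "mixing n nb w ?F v (2 * \<eta>)"
    unfolding v_def by (rule mixing_own_marginals[OF pos mix])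
  have v0: "0 \<le> v y t" and v1: "(\<Sum>t\<in>UNIV. v y t) = 1" for y t
    unfolding v_def by (auto intro!: marg1_nonneg sum_marg1 pos)
  have \<psi>: "(\<Sum>zs\<in>tuples n l. \<psi> x (set zs - {x}))
    \<le> ?q * 2 ^ d * (K ^ d * ((K ^ d)\<^sup>2 * (2 * \<eta>)) * (?q + 2) ^ l * real n ^ l)" if "x < n" for x
  proof -
    have cN: "card (N x) \<le> d" unfolding N_def by (rule deg[OF that])
    have fN: "finite (N x)" by (simp add: N_def)
    have mixx: "mixing n nb w (?F - N x) v ((K ^ d)\<^sup>2 * (2 * \<eta>))"
      by (rule mixing_remove[OF K bdd _ _ cN mix1]) (auto simp: N_def)
    have posx: "positive_on nb w (?F - N x)" using pos by (auto simp: positive_on_def)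
    have D: "(\<Sum>zs\<in>tuples n l. deviation n nb w (?F - N x) v (g D x s) (set zs - {x}))
        \<le> K ^ d * ((K ^ d)\<^sup>2 * (2 * \<eta>)) * (?q + 2) ^ l * real n ^ l" if "D \<in> Pow (N x)" for D s
    proof (rule sum_deviation_le[OF posx mixx _ v0 v1])
      fix \<sigma> :: "nat \<Rightarrow> 'w"
      have "card D \<le> d" using that cN card_mono[OF fN, of D] by auto
      have f: "1 / K \<le> w b (map (\<sigma>(x := s)) (nb b)) \<and> w b (map (\<sigma>(x := s)) (nb b)) \<le> K" if "b \<in> D" for b
        using that \<open>D \<in> Pow (N x)\<close> by (intro weights_bddD[OF bdd]) (auto simp: N_def)
      have "1 / K ^ d \<le> g D x s \<sigma>" "g D x s \<sigma> \<le> K ^ d"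
        unfolding g_def using prod_weight_bounds[OF K \<open>card D \<le> d\<close>] f by auto
      moreover have "0 \<le> 1 / K ^ d" using K by simp
      ultimately show "\<bar>g D x s \<sigma>\<bar> \<le> K ^ d" by linarith
    qed (use \<eta> in auto)
    have "(\<Sum>zs\<in>tuples n l. \<psi> x (set zs - {x}))
      = (\<Sum>s\<in>UNIV. \<Sum>D\<in>Pow (N x). \<Sum>zs\<in>tuples n l. deviation n nb w (?F - N x) v (g D x s) (set zs - {x}))"
      unfolding \<psi>_def sum.swap[of _ UNIV "tuples n l"] sum.swap[of _ "Pow (N x)" "tuples n l"] ..
    also have "\<dots> \<le> (\<Sum>s\<in>(UNIV :: 'w set). \<Sum>D\<in>Pow (N x). K ^ d * ((K ^ d)\<^sup>2 * (2 * \<eta>)) * (?q + 2) ^ l * real n ^ l)"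
      by (rule sum_mono, rule sum_mono, rule D)
    also have "\<dots> = ?q * real (2 ^ card (N x)) * (K ^ d * ((K ^ d)\<^sup>2 * (2 * \<eta>)) * (?q + 2) ^ l * real n ^ l)"
      using fN by (simp add: card_Pow)
    also have "\<dots> \<le> ?q * 2 ^ d * (K ^ d * ((K ^ d)\<^sup>2 * (2 * \<eta>)) * (?q + 2) ^ l * real n ^ l)"
      using cN K \<eta> by (intro mult_right_mono mult_left_mono) (auto simp: power_increasing)
    finally show ?thesis .
  qed
  have "(\<Sum>ys\<in>tuples n (Suc l). \<Sum>x\<in>set ys. edge_error n m (nb(a := ys)) w x a)
    = (\<Sum>ys\<in>tuples n (Suc l). \<Sum>x\<in>set ys. \<psi> x (set ys - {x}))"
    by (rule sum.cong[OF refl], rule sum.cong[OF refl]) (rule edge)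
  also have "\<dots> \<le> real (Suc l) * (\<Sum>x<n. \<Sum>zs\<in>tuples n l. \<psi> x (set zs - {x}))"
    by (rule sum_tuples_members_le) (auto simp: \<psi>_def intro!: sum_nonneg deviation_nonneg)
  also have "\<dots> \<le> real k * (\<Sum>x<n. ?q * 2 ^ d * (K ^ d * ((K ^ d)\<^sup>2 * (2 * \<eta>)) * (?q + 2) ^ l * real n ^ l))"
  proof (rule mult_mono)
    show "(\<Sum>x<n. \<Sum>zs\<in>tuples n l. \<psi> x (set zs - {x}))
      \<le> (\<Sum>x<n. ?q * 2 ^ d * (K ^ d * ((K ^ d)\<^sup>2 * (2 * \<eta>)) * (?q + 2) ^ l * real n ^ l))"
      by (rule sum_mono, rule \<psi>) simp
  qed (use l in \<open>auto simp: \<psi>_def intro!: sum_nonneg deviation_nonneg\<close>)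
  also have "\<dots> = real k * ?q * 2 ^ d * K ^ d * (2 * (K ^ d)\<^sup>2) * (?q + 2) ^ l * (\<eta> * real n ^ Suc l)"
    by simp
  also have "\<dots> \<le> real k * ?q * 2 ^ d * K ^ d * (2 * (K ^ d)\<^sup>2) * (?q + 2) ^ k * (\<eta> * real n ^ Suc l)"
    using l K \<eta> by (intro mult_right_mono mult_left_mono power_increasing) auto
  finally show ?thesis by (simp add: resample_const_def mult.assoc)
qed

text \<open>This is conditioning on all coordinates but \<open>a\<close> in counting form:
  \<open>S\<close> splits into fibres on which only \<open>f a\<close> varies, and a bound on the
  average over each fibre is one over \<open>S\<close>. Overwriting with \<open>undefined\<close>
  merely labels the fibres.\<close>

lemma sum_coordinate_le:
  fixes S :: "('a \<Rightarrow> 'b) set" and g :: "('a \<Rightarrow> 'b) \<Rightarrow> real"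
  assumes "finite S"
    and le: "\<And>f. f \<in> S \<Longrightarrow> (\<Sum>y\<in>{y. f(a := y) \<in> S}. g (f(a := y))) \<le> \<kappa> * real (card {y. f(a := y) \<in> S})"
  shows "(\<Sum>f\<in>S. g f) \<le> \<kappa> * real (card S)"
proof -
  define h where "h f = f(a := undefined)" for f :: "'a \<Rightarrow> 'b"
  have fib: "(\<Sum>f\<in>{f\<in>S. h f = u}. g f) \<le> (\<Sum>f\<in>{f\<in>S. h f = u}. \<kappa>)" if u: "u \<in> h ` S" for u
  proof -
    obtain f0 where f0: "f0 \<in> S" "u = h f0" using u by auto
    let ?A = "{y. f0(a := y) \<in> S}" and ?j = "\<lambda>y. f0(a := y)"
    have img: "{f\<in>S. h f = u} = ?j ` ?A"
    proof (intro equalityI subsetI)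
      fix f assume f: "f \<in> {f\<in>S. h f = u}"
      then have "f0(a := f a) = f" using f0 by (auto simp: h_def fun_eq_iff split: if_splits)
      then show "f \<in> ?j ` ?A" using f by (intro image_eqI[of _ _ "f a"]) auto
    qed (use f0 in \<open>auto simp: h_def\<close>)
    have inj: "inj_on ?j ?A" by (rule inj_onI) (metis fun_upd_same)
    have "(\<Sum>f\<in>{f\<in>S. h f = u}. g f) = (\<Sum>y\<in>?A. g (?j y))"
      unfolding img by (simp add: sum.reindex[OF inj])
    also have "\<dots> \<le> \<kappa> * real (card ?A)" by (rule le[OF f0(1)])
    also have "\<dots> = (\<Sum>f\<in>{f\<in>S. h f = u}. \<kappa>)" unfolding img using card_image[OF inj] by simp
    finally show ?thesis .
  qed
  have "(\<Sum>f\<in>S. g f) = (\<Sum>u\<in>h ` S. \<Sum>f\<in>{f\<in>S. h f = u}. g f)"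
    using assms by (intro sum.group[symmetric]) auto
  also have "\<dots> \<le> (\<Sum>u\<in>h ` S. \<Sum>f\<in>{f\<in>S. h f = u}. \<kappa>)" by (rule sum_mono) (rule fib)
  also have "\<dots> = (\<Sum>f\<in>S. \<kappa>)" using assms by (intro sum.group) auto
  finally show ?thesis by (simp add: mult.commute)
qed

text \<open>The count is a falling factorial, each of whose \<open>l\<close> factors is at least
  \<open>u\<close>.\<close>

lemma card_distinct_lists_ge:
  assumes "finite U" "0 \<le> u" "u + real l \<le> real (card U)"
  shows "u ^ l \<le> real (card {ys. length ys = l \<and> distinct ys \<and> set ys \<subseteq> U})"
proof -
  have l: "l \<le> card U" using assms by linarith
  have "u ^ l = (\<Prod>i\<in>{card U - l + 1..card U}. u)" using l by simp
  also have "\<dots> \<le> (\<Prod>i\<in>{card U - l + 1..card U}. real i)"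
    using assms l by (intro prod_mono) auto
  also have "\<dots> = real (card {ys. length ys = l \<and> distinct ys \<and> set ys \<subseteq> U})"
    using card_lists_distinct_length_eq[OF assms(1) l] by simp
  finally show ?thesis .
qed

section \<open>Slot assignments and the size of their fibres\<close>

lemma slot_assignmentsD:
  assumes "nb \<in> slot_assignments n d m sl"
  shows "i < m \<Longrightarrow> length (nb i) = sl i" "i < m \<Longrightarrow> set (nb i) \<subseteq> {..<n}"
    "x < n \<Longrightarrow> (\<Sum>i<m. count_list (nb i) x) \<le> d"
  using assms by (auto simp: slot_assignments_def PiE_def Pi_def)

lemma finite_slot_assignments: "finite (slot_assignments n d m sl)"
proof -
  have "finite {xs :: nat list. length xs = sl i \<and> set xs \<subseteq> {..<n}}" for i
    using finite_lists_length_eq[of "{..<n}" "sl i"] by (simp add: conj_commute)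
  then show ?thesis
    unfolding slot_assignments_def by (intro finite_subset[OF Collect_restrict] finite_PiE) auto
qed

lemma card_var_nbhd_le:
  assumes "nb \<in> slot_assignments n d m sl" "x < n"
  shows "card (var_nbhd m nb x) \<le> d"
proof -
  have "card (var_nbhd m nb x) = (\<Sum>i\<in>var_nbhd m nb x. 1)" by simp
  also have "\<dots> \<le> (\<Sum>i\<in>var_nbhd m nb x. count_list (nb i) x)"
    by (intro sum_mono) (auto simp: var_nbhd_def Suc_le_eq count_list_0_iff simp flip: neq0_conv)
  also have "\<dots> \<le> (\<Sum>i<m. count_list (nb i) x)"
    by (intro sum_mono2) (auto simp: var_nbhd_def)
  also have "\<dots> \<le> d" by (rule slot_assignmentsD(3)[OF assms])
  finally show ?thesis .
qed

text \<open>A saturated variable node occupies \<open>d\<close> slots, so at most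
  \<open>(1 - c) * n\<close> are saturated and at least \<open>c * n\<close> have room. Every tuple
  of distinct nodes with room is admissible, because each node gains at most one slot. Half of
  \<open>c * n\<close> is given away to absorb the loss from distinctness.\<close>

lemma card_resample_ge:
  fixes c :: real
  assumes nb: "nb \<in> slot_assignments n d m sl" and a: "a < m" and d: "0 < d"
    and total: "real (\<Sum>i<m. sl i) \<le> (1 - c) * real d * real n"
    and n: "2 * real (sl a) \<le> c * real n"
  shows "(c * real n / 2) ^ sl a \<le> real (card {ys. nb(a := ys) \<in> slot_assignments n d m sl})"
proof -
  define deg where "deg x = (\<Sum>i<m. count_list (nb i) x)" for x
  define U where "U = {x\<in>{..<n}. deg x < d}"
  have fU: "finite U" by (simp add: U_def)
  have "(\<Sum>x<n. deg x) = (\<Sum>i<m. \<Sum>x<n. count_list (nb i) x)" unfolding deg_def by (rule sum.swap)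
  also have "\<dots> = (\<Sum>i<m. sl i)"
  proof (rule sum.cong[OF refl])
    fix i assume "i \<in> {..<m}"
    then show "(\<Sum>x<n. count_list (nb i) x) = sl i"
      using slot_assignmentsD(1,2)[OF nb, of i] by (simp add: sum_count_set)
  qed
  finally have tot: "(\<Sum>x<n. deg x) = (\<Sum>i<m. sl i)" .
  have "(\<Sum>x\<in>{..<n} - U. d) \<le> (\<Sum>x\<in>{..<n} - U. deg x)"
    by (intro sum_mono) (auto simp: U_def)
  also have "\<dots> \<le> (\<Sum>x<n. deg x)" by (intro sum_mono2) auto
  finally have "card ({..<n} - U) * d \<le> (\<Sum>i<m. sl i)" using tot by simp
  moreover have "card ({..<n} - U) = n - card U" "card U \<le> n"
  proof -
    have "U \<subseteq> {..<n}" by (auto simp: U_def)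
    then show "card ({..<n} - U) = n - card U" "card U \<le> n"
      using card_mono[of "{..<n}" U] fU by (auto simp: card_Diff_subset)
  qed
  ultimately have "(real n - real (card U)) * real d \<le> real (\<Sum>i<m. sl i)"
    by (metis of_nat_diff of_nat_le_iff of_nat_mult)
  also note total
  finally have "(real n - real (card U)) * real d \<le> ((1 - c) * real n) * real d" by (simp add: mult_ac)
  then have cU: "c * real n \<le> real (card U)" using d by (simp add: algebra_simps)
  have "(c * real n / 2) ^ sl a \<le> real (card {ys. length ys = sl a \<and> distinct ys \<and> set ys \<subseteq> U})"
    using n cU by (intro card_distinct_lists_ge fU) auto
  also have "\<dots> \<le> real (card {ys. nb(a := ys) \<in> slot_assignments n d m sl})"
  proof (intro of_nat_mono card_mono)
    have "inj_on (\<lambda>ys. nb(a := ys)) {ys. nb(a := ys) \<in> slot_assignments n d m sl}"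
      by (rule inj_onI) (metis fun_upd_same)
    then show "finite {ys. nb(a := ys) \<in> slot_assignments n d m sl}"
      by (rule finite_imageD[rotated]) (rule finite_subset[OF _ finite_slot_assignments], auto)
    show "{ys. length ys = sl a \<and> distinct ys \<and> set ys \<subseteq> U} \<subseteq> {ys. nb(a := ys) \<in> slot_assignments n d m sl}"
    proof
      fix ys assume "ys \<in> {ys. length ys = sl a \<and> distinct ys \<and> set ys \<subseteq> U}"
      then have ys: "length ys = sl a" "distinct ys" "set ys \<subseteq> U" by auto
      have "(\<Sum>i<m. count_list ((nb(a := ys)) i) x) \<le> d" if "x < n" for x
      proof -
        have "(\<Sum>i<m. count_list ((nb(a := ys)) i) x) = count_list ys x + (\<Sum>i\<in>{..<m} - {a}. count_list (nb i) x)"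
          using a by (subst sum.remove[of _ a]) (auto intro!: sum.cong)
        \<comment> \<open>\<open>deg\<close> still counts the old tuple of \<open>a\<close>; this
          only makes the test for room stricter.\<close>
        also have "\<dots> \<le> count_list ys x + deg x"
          unfolding deg_def by (intro add_left_mono sum_mono2) auto
        also have "\<dots> \<le> d"
        proof (cases "x \<in> set ys")
          case True
          then have "deg x < d" using ys by (auto simp: U_def)
          moreover have "count_list ys x \<le> 1"
            using \<open>distinct ys\<close> by (induction ys) auto
          ultimately show ?thesis by simp
        next
          case False
          then show ?thesis using slot_assignmentsD(3)[OF nb that] by (simp add: deg_def)
        qed
        finally show ?thesis .
      qed
      moreover have "set ys \<subseteq> {..<n}" using ys by (auto simp: U_def)
      ultimately show "ys \<in> {ys. nb(a := ys) \<in> slot_assignments n d m sl}"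
        using nb a ys by (auto simp: slot_assignments_def PiE_def Pi_def extensional_def)
    qed
  qed
  finally show ?thesis .
qed


section \<open>Averaging the error over all slot assignments\<close>

definition tv_total :: "nat \<Rightarrow> 'w::finite fgraph \<Rightarrow> real" where
  "tv_total n G = (\<Sum>x<n. \<Sum>y<n. tv_pair n G x y)"

text \<open>The factors are the passage from edge errors to the Belief Propagation error, the at
  most \<open>d * n\<close> slots, resampling of one tuple, the mixing rate after deleting
  \<open>a\<close> (whence \<open>K^2\<close>) without its \<open>sqrt \<delta>\<close>, and the
  comparison of a fibre with all tuples.\<close>

definition total_const :: "'w::finite itself \<Rightarrow> nat \<Rightarrow> nat \<Rightarrow> real \<Rightarrow> real \<Rightarrow> real" where
  "total_const T d k K c = bp_const d K * (real d * (resample_const T d k K * (K\<^sup>2 * (real CARD('w) * sqrt 2)) * (2 / c) ^ k))"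

lemma sum_factor_edge_error_le:
  fixes w :: "nat \<Rightarrow> 'w::finite list \<Rightarrow> real" and c :: real
  assumes K: "1 \<le> K" and bdd: "\<And>i ts. i < m \<Longrightarrow> length ts = sl i \<Longrightarrow> 1 / K \<le> w i ts \<and> w i ts \<le> K"
    and d: "0 < d" and a: "a < m" "sl a = Suc l" "Suc l \<le> k"
    and total: "real (\<Sum>i<m. sl i) \<le> (1 - c) * real d * real n"
    and c: "0 < c" "c \<le> 1" and n: "2 * real k \<le> c * real n" and \<delta>: "0 \<le> \<delta>"
  shows "(\<Sum>nb\<in>slot_assignments n d m sl. of_bool (tv_total n (m, nb, w) \<le> \<delta> * (real n)\<^sup>2)
        * (\<Sum>x\<in>set (nb a). edge_error n m nb w x a))
    \<le> resample_const TYPE('w) d k K * (K\<^sup>2 * (real CARD('w) * sqrt 2)) * (2 / c) ^ k * sqrt \<delta>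
      * real (card (slot_assignments n d m sl))"
proof (rule sum_coordinate_le[where a = a, OF finite_slot_assignments])
  let ?S = "slot_assignments n d m sl" and ?q = "real CARD('w)" and ?C = "resample_const TYPE('w) d k K"
  let ?\<kappa> = "?C * (K\<^sup>2 * (?q * sqrt 2)) * (2 / c) ^ k * sqrt \<delta>"
  let ?good = "\<lambda>nb. tv_total n (m, nb, w) \<le> \<delta> * (real n)\<^sup>2"
  let ?e = "\<lambda>nb. \<Sum>x\<in>set (nb a). edge_error n m nb w x a"
  fix nb assume nb: "nb \<in> ?S"
  let ?A = "{ys. nb(a := ys) \<in> ?S}"
  define \<eta> where "\<eta> = K\<^sup>2 * (?q * sqrt (2 * \<delta>))"
  have \<eta>: "0 \<le> \<eta>" using K \<delta> by (simp add: \<eta>_def)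
  have C: "0 \<le> ?C" using K by (simp add: resample_const_def)
  have \<kappa>: "0 \<le> ?\<kappa>" using K \<delta> c C by simp
  have wb: "weights_bdd K nb' w {..<m}" if "nb' \<in> ?S" for nb'
    unfolding weights_bdd_def using bdd slot_assignmentsD(1)[OF that] by auto
  show "(\<Sum>ys\<in>?A. of_bool (?good (nb(a := ys))) * ?e (nb(a := ys))) \<le> ?\<kappa> * real (card ?A)"
  proof (cases "\<exists>ys\<in>?A. ?good (nb(a := ys))")
    case False
    then have "(\<Sum>ys\<in>?A. of_bool (?good (nb(a := ys))) * ?e (nb(a := ys))) = 0"
      by (intro sum.neutral) auto
    then show ?thesis using \<kappa> by simp
  next
    case True
    then obtain ys0 where ys0: "nb(a := ys0) \<in> ?S" "?good (nb(a := ys0))" by blast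
    let ?nb0 = "nb(a := ys0)"
    have "mixing n ?nb0 w {..<m} (marg1 n ?nb0 w {..<m}) (?q * sqrt (2 * \<delta>))"
      using ys0 weights_bdd_positive[OF wb[OF ys0(1)]] K
      by (intro mixing_if_tv_pair_small) (auto simp: tv_total_def)
    then have "mixing n ?nb0 w ({..<m} - {a}) (marg1 n ?nb0 w {..<m}) ((K ^ 1)\<^sup>2 * (?q * sqrt (2 * \<delta>)))"
      using a by (intro mixing_remove[OF K wb[OF ys0(1)]]) auto
    \<comment> \<open>The reference marginals are still those of the good completion. They are
      exchanged for the marginals without \<open>a\<close> inside
      \<open>sum_edge_error_resample_le\<close>.\<close>
    then have mix: "mixing n nb w ({..<m} - {a}) (marg1 n ?nb0 w {..<m}) \<eta>"
      unfolding \<eta>_def using mixing_nb_cong[of "{..<m} - {a}" ?nb0 nb n w] by simp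
    have sub: "?A \<subseteq> tuples n (Suc l)"
      using slot_assignmentsD(1,2)[of _ n d m sl a] a by fastforce
    have "(\<Sum>ys\<in>?A. of_bool (?good (nb(a := ys))) * ?e (nb(a := ys))) \<le> (\<Sum>ys\<in>?A. ?e (nb(a := ys)))"
      by (intro sum_mono) (auto simp: of_bool_def intro!: sum_nonneg edge_error_nonneg)
    also have "\<dots> \<le> (\<Sum>ys\<in>tuples n (Suc l). ?e (nb(a := ys)))"
      using sub by (intro sum_mono2) (auto intro!: sum_nonneg edge_error_nonneg finite_lists_length_eq)
    also have "\<dots> = (\<Sum>ys\<in>tuples n (Suc l). \<Sum>x\<in>set ys. edge_error n m (nb(a := ys)) w x a)" by simp
    also have "\<dots> \<le> ?C * \<eta> * real n ^ Suc l"
    proof (rule sum_edge_error_resample_le[OF K _ a(1) _ mix \<eta> a(3)])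
      show "weights_bdd K nb w ({..<m} - {a})" by (rule weights_bdd_subset[OF wb[OF nb]]) auto
      fix x assume "x < n"
      have "card {c\<in>{..<m} - {a}. x \<in> set (nb c)} \<le> card (var_nbhd m nb x)"
        by (intro card_mono) (auto simp: var_nbhd_def)
      also have "\<dots> \<le> d" by (rule card_var_nbhd_le[OF nb \<open>x < n\<close>])
      finally show "card {c\<in>{..<m} - {a}. x \<in> set (nb c)} \<le> d" .
    qed
    \<comment> \<open>The number of all tuples is rewritten in terms of the lower bound of
      \<open>card_resample_ge\<close> on the fibre.\<close>
    also have "\<dots> = ?C * \<eta> * ((2 / c) ^ Suc l * (c * real n / 2) ^ Suc l)"
      using c by (simp add: power_mult_distrib[symmetric] del: power_Suc)
    also have "\<dots> \<le> ?C * \<eta> * ((2 / c) ^ k * real (card ?A))"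
    proof (intro mult_left_mono mult_mono power_increasing a(3))
      show "(c * real n / 2) ^ Suc l \<le> real (card ?A)"
        using card_resample_ge[OF nb a(1) d total] n a by simp
    qed (use c C \<eta> in auto)
    also have "\<dots> = ?\<kappa> * real (card ?A)"
      by (simp add: \<eta>_def real_sqrt_mult mult_ac)
    finally show ?thesis .
  qed
qed

text \<open>Edges are regrouped by their constraint node. The number \<open>m\<close> of nodes has
  no bound here, since a node may lose all its slots; charging node \<open>a\<close> with weight
  \<open>sl a\<close> makes the total at most \<open>d * n\<close>.\<close>

lemma sum_bp_error_le:
  fixes w :: "nat \<Rightarrow> 'w::finite list \<Rightarrow> real" and c :: real
  assumes K: "1 \<le> K" and bdd: "\<And>i ts. i < m \<Longrightarrow> length ts = sl i \<Longrightarrow> 1 / K \<le> w i ts \<and> w i ts \<le> K"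
    and d: "0 < d" and sl: "\<And>i. i < m \<Longrightarrow> sl i \<le> k"
    and total: "real (\<Sum>i<m. sl i) \<le> (1 - c) * real d * real n"
    and c: "0 < c" "c \<le> 1" and n: "2 * real k \<le> c * real n" and \<delta>: "0 \<le> \<delta>"
  shows "(\<Sum>nb\<in>slot_assignments n d m sl. of_bool (tv_total n (m, nb, w) \<le> \<delta> * (real n)\<^sup>2) * bp_error n (m, nb, w))
    \<le> total_const TYPE('w) d k K c * sqrt \<delta> * real n * real (card (slot_assignments n d m sl))"
proof -
  let ?S = "slot_assignments n d m sl"
  let ?\<kappa> = "resample_const TYPE('w) d k K * (K\<^sup>2 * (real CARD('w) * sqrt 2)) * (2 / c) ^ k"
  let ?g = "\<lambda>nb. of_bool (tv_total n (m, nb, w) \<le> \<delta> * (real n)\<^sup>2) :: real"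
  let ?e = "\<lambda>a nb. ?g nb * (\<Sum>x\<in>set (nb a). edge_error n m nb w x a)"
  have \<kappa>: "0 \<le> ?\<kappa>" using K c by (simp add: resample_const_def)
  have b: "0 \<le> bp_const d K" using K by (simp add: bp_const_def)
  have "(\<Sum>nb\<in>?S. ?g nb * bp_error n (m, nb, w)) \<le> (\<Sum>nb\<in>?S. bp_const d K * (\<Sum>a<m. ?e a nb))"
  proof (rule sum_mono)
    fix nb assume nb: "nb \<in> ?S"
    have "weights_bdd K nb w {..<m}"
      unfolding weights_bdd_def using bdd slot_assignmentsD(1)[OF nb] by auto
    from bp_error_le[OF K this card_var_nbhd_le[OF nb]]
    have "bp_error n (m, nb, w) \<le> bp_const d K * (\<Sum>x<n. \<Sum>a\<in>var_nbhd m nb x. edge_error n m nb w x a)" .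
    also have "(\<Sum>x<n. \<Sum>a\<in>var_nbhd m nb x. edge_error n m nb w x a)
      = (\<Sum>a<m. \<Sum>x\<in>{x\<in>{..<n}. x \<in> set (nb a)}. edge_error n m nb w x a)"
      unfolding var_nbhd_def by (rule sum.swap_restrict) auto
    also have "\<dots> = (\<Sum>a<m. \<Sum>x\<in>set (nb a). edge_error n m nb w x a)"
      using slot_assignmentsD(2)[OF nb] by (intro sum.cong refl) blast
    finally have "?g nb * bp_error n (m, nb, w)
      \<le> ?g nb * (bp_const d K * (\<Sum>a<m. \<Sum>x\<in>set (nb a). edge_error n m nb w x a))"
      by (rule mult_left_mono) auto
    then show "?g nb * bp_error n (m, nb, w) \<le> bp_const d K * (\<Sum>a<m. ?e a nb)"
      by (simp add: sum_distrib_left mult_ac)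
  qed
  also have "\<dots> = bp_const d K * (\<Sum>a<m. \<Sum>nb\<in>?S. ?e a nb)"
    by (subst sum.swap) (simp add: sum_distrib_left)
  also have "\<dots> \<le> bp_const d K * (\<Sum>a<m. real (sl a) * (?\<kappa> * sqrt \<delta> * real (card ?S)))"
  proof (rule mult_left_mono[OF sum_mono b])
    fix a assume "a \<in> {..<m}"
    then have a: "a < m" by simp
    show "(\<Sum>nb\<in>?S. ?e a nb) \<le> real (sl a) * (?\<kappa> * sqrt \<delta> * real (card ?S))"
    proof (cases "sl a")
      \<comment> \<open>A node without slots has no edges, which matches its zero charge.\<close>
      case 0
      have "?e a nb = 0" if "nb \<in> ?S" for nb
      proof -
        have "nb a = []" using slot_assignmentsD(1)[OF that a] 0 by simp
        then show ?thesis by simp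
      qed
      then have "(\<Sum>nb\<in>?S. ?e a nb) = 0" by (intro sum.neutral ballI)
      then show ?thesis using 0 by simp
    next
      case (Suc l)
      have "(\<Sum>nb\<in>?S. ?e a nb) \<le> ?\<kappa> * sqrt \<delta> * real (card ?S)"
        using sl[OF a] Suc by (intro sum_factor_edge_error_le[OF K bdd d a Suc _ total c n \<delta>]) auto
      also have "\<dots> \<le> real (sl a) * (?\<kappa> * sqrt \<delta> * real (card ?S))"
        using Suc \<kappa> \<delta> mult_right_mono[of 1 "real (sl a)" "?\<kappa> * sqrt \<delta> * real (card ?S)"] by simp
      finally show ?thesis .
    qed
  qed
  also have "\<dots> = bp_const d K * (real (\<Sum>a<m. sl a) * (?\<kappa> * sqrt \<delta> * real (card ?S)))"
    by (simp add: sum_distrib_right)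
  also have "\<dots> \<le> bp_const d K * ((real d * real n) * (?\<kappa> * sqrt \<delta> * real (card ?S)))"
  proof (intro mult_left_mono mult_right_mono)
    have "(1 - c) * real d * real n \<le> 1 * real d * real n" using c by (intro mult_right_mono) auto
    with total show "real (\<Sum>a<m. sl a) \<le> real d * real n" by simp
  qed (use b \<kappa> \<delta> in auto)
  finally show ?thesis by (simp add: total_const_def mult_ac)
qed

section \<open>The percolated regular model\<close>

text \<open>Greedy choice: take any \<open>x\<close> with remaining capacity and lower that capacity
  by one.\<close>

lemma exists_bounded_list:
  fixes f :: "nat \<Rightarrow> nat"
  assumes "l \<le> (\<Sum>x<n. f x)"
  shows "\<exists>ys. length ys = l \<and> set ys \<subseteq> {..<n} \<and> (\<forall>x<n. count_list ys x \<le> f x)"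
  using assms
proof (induction l arbitrary: f)
  case (Suc l)
  then have "(\<Sum>x<n. f x) \<noteq> 0" by linarith
  then obtain x where x: "x < n" "f x \<noteq> 0" by (auto intro: ccontr)
  have "(\<Sum>y<n. f y) = f x + (\<Sum>y\<in>{..<n} - {x}. f y)" using x by (subst sum.remove[of _ x]) auto
  moreover have "(\<Sum>y<n. (f(x := f x - 1)) y) = (f x - 1) + (\<Sum>y\<in>{..<n} - {x}. f y)"
    using x by (subst sum.remove[of _ x]) (auto intro!: sum.cong)
  ultimately have "l \<le> (\<Sum>y<n. (f(x := f x - 1)) y)" using Suc.prems x by linarith
  from Suc.IH[OF this] obtain ys where ys: "length ys = l" "set ys \<subseteq> {..<n}"
      "\<forall>y<n. count_list ys y \<le> (f(x := f x - 1)) y"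
    by blast
  have "count_list (x # ys) y \<le> f y" if "y < n" for y
    using ys(3)[rule_format, OF that] x by (auto split: if_splits)
  then show ?case using ys x by (intro exI[of _ "x # ys"]) auto
qed simp

text \<open>Needed for \<open>pmf_of_set\<close> to be the uniform distribution. Nodes are filled
  one after the other; the capacity left before node \<open>m\<close> is \<open>d * n\<close> minus
  the slots already used, hence at least \<open>sl m\<close>.\<close>

lemma slot_assignments_nonempty:
  assumes "(\<Sum>i<m. sl i) \<le> d * n"
  shows "slot_assignments n d m sl \<noteq> {}"
  using assms
proof (induction m)
  case 0
  then show ?case by (simp add: slot_assignments_def)
next
  case (Suc m)
  then obtain nb where nb: "nb \<in> slot_assignments n d m sl" by fastforce
  define f where "f x = d - (\<Sum>i<m. count_list (nb i) x)" for x
  have deg: "(\<Sum>i<m. count_list (nb i) x) \<le> d" if "x < n" for x by (rule slot_assignmentsD(3)[OF nb that])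
  have "(\<Sum>x<n. \<Sum>i<m. count_list (nb i) x) = (\<Sum>i<m. \<Sum>x<n. count_list (nb i) x)" by (rule sum.swap)
  also have "\<dots> = (\<Sum>i<m. sl i)"
    by (rule sum.cong[OF refl]) (use slot_assignmentsD(1,2)[OF nb] in \<open>simp add: sum_count_set\<close>)
  finally have tot: "(\<Sum>x<n. \<Sum>i<m. count_list (nb i) x) = (\<Sum>i<m. sl i)" .
  have "(\<Sum>x<n. f x) + (\<Sum>x<n. \<Sum>i<m. count_list (nb i) x) = (\<Sum>x<n. d)"
    unfolding sum.distrib[symmetric] by (rule sum.cong[OF refl]) (use deg in \<open>simp add: f_def\<close>)
  then have "sl m \<le> (\<Sum>x<n. f x)" using Suc.prems tot by (simp add: mult.commute)
  from exists_bounded_list[OF this] obtain ys where ys: "length ys = sl m" "set ys \<subseteq> {..<n}"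
      "\<forall>x<n. count_list ys x \<le> f x" by blast
  have "(\<Sum>i<Suc m. count_list ((nb(m := ys)) i) x) \<le> d" if "x < n" for x
  proof -
    have "(\<Sum>i<Suc m. count_list ((nb(m := ys)) i) x) = (\<Sum>i<m. count_list (nb i) x) + count_list ys x"
      by (auto intro!: sum.cong)
    then show ?thesis using ys(3) that deg[OF that] by (auto simp: f_def)
  qed
  moreover have "nb(m := ys) \<in> PiE {..<Suc m} (\<lambda>i. {xs. length xs = sl i \<and> set xs \<subseteq> {..<n}})"
    using nb ys by (auto simp: slot_assignments_def PiE_def Pi_def extensional_def less_Suc_eq)
  ultimately have "nb(m := ys) \<in> slot_assignments n d (Suc m) sl"
    by (simp add: slot_assignments_def)
  then show ?case by blast
qed

text \<open>Guarantees that the sum defining \<open>psi_restrict\<close> is not empty, and so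
  positive. Positions outside \<open>J\<close> may carry any spin; \<open>undefined\<close> is used
  there.\<close>

lemma exists_nths_eq:
  assumes "J \<subseteq> {..<k}" "length ts = card J"
  shows "\<exists>\<tau>. length \<tau> = k \<and> nths \<tau> J = ts"
  using assms
proof (induction k arbitrary: J ts)
  case (Suc k)
  have cong: "nths \<tau> (J - {k}) = nths \<tau> J" if "length \<tau> = k" for \<tau> :: "'a list"
    unfolding nths_def using that by (intro arg_cong[of _ _ "map fst"] filter_cong refl) (auto simp: in_set_zip)
  have app: "nths (\<tau> @ [t]) J = nths \<tau> J @ (if k \<in> J then [t] else [])" if "length \<tau> = k" for \<tau> :: "'a list" and t
    using that by (simp add: nths_append)
  have sub: "J - {k} \<subseteq> {..<k}" using Suc.prems by auto
  have fJ: "finite J" using Suc.prems(1) finite_subset by blast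
  show ?case
  proof (cases "k \<in> J")
    case True
    then have "ts \<noteq> []" using Suc.prems fJ by (auto simp: card_eq_0_iff)
    have "length (butlast ts) = card (J - {k})" using Suc.prems True fJ by simp
    from Suc.IH[OF sub this] obtain \<tau> where "length \<tau> = k" "nths \<tau> (J - {k}) = butlast ts" by blast
    then show ?thesis using True app[of \<tau> "last ts"] cong[of \<tau>] \<open>ts \<noteq> []\<close>
      by (intro exI[of _ "\<tau> @ [last ts]"]) auto
  next
    case False
    then have "length ts = card (J - {k})" using Suc.prems by simp
    from Suc.IH[OF sub this] obtain \<tau> where "length \<tau> = k" "nths \<tau> (J - {k}) = ts" by blast
    then show ?thesis using False app[of \<tau> undefined] cong[of \<tau>]
      by (intro exI[of _ "\<tau> @ [undefined]"]) auto
  qed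
qed simp

lemma psi_restrict_pos:
  fixes psi :: "'w::finite list \<Rightarrow> real"
  assumes "J \<subseteq> {..<k}" "length ts = card J" and psi: "\<And>\<tau>. length \<tau> = k \<Longrightarrow> 0 < psi \<tau>"
  shows "0 < psi_restrict k psi J ts"
  unfolding psi_restrict_def
proof (intro mult_pos_pos sum_pos)
  show "finite {\<tau> :: 'w list. length \<tau> = k \<and> nths \<tau> J = ts}"
    by (rule finite_subset[OF _ finite_lists_length_eq[of UNIV k]]) auto
  show "{\<tau>. length \<tau> = k \<and> nths \<tau> J = ts} \<noteq> {}" using exists_nths_eq[OF assms(1,2)] by auto
qed (use psi in auto)

lemma psi_restrict_bounds:
  fixes \<Psi> :: "('w::finite list \<Rightarrow> real) set"
  assumes "finite \<Psi>" and psi: "\<forall>psi\<in>\<Psi>. \<forall>\<tau>. length \<tau> = k \<longrightarrow> 0 < psi \<tau>"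
  obtains K where "1 \<le> K" "\<And>psi J ts. psi \<in> \<Psi> \<Longrightarrow> J \<subseteq> {..<k} \<Longrightarrow> length ts = card J \<Longrightarrow>
      1 / K \<le> psi_restrict k psi J ts \<and> psi_restrict k psi J ts \<le> K"
proof -
  let ?I = "\<Psi> \<times> (SIGMA J : Pow {..<k}. {ts :: 'w list. set ts \<subseteq> UNIV \<and> length ts = card J})"
  let ?v = "\<lambda>(psi, J, ts). psi_restrict k psi J ts"
  define V where "V = ?v ` ?I"
  have "finite ?I"
    using \<open>finite \<Psi>\<close> by (intro finite_cartesian_product finite_SigmaI finite_lists_length_eq) auto
  then have fV: "finite V" by (simp add: V_def)
  have pos: "0 < v" if "v \<in> V" for v
    using that psi by (auto simp: V_def intro!: psi_restrict_pos)
  \<comment> \<open>There are only finitely many values, all positive, and this sum dominates each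
    of them together with its inverse.\<close>
  define K where "K = 1 + (\<Sum>v\<in>V. v + 1 / v)"
  have nn: "0 \<le> v + 1 / v" if "v \<in> V" for v using pos[OF that] by simp
  have K1: "1 \<le> K" unfolding K_def using nn by (simp add: sum_nonneg)
  have "1 / K \<le> v \<and> v \<le> K" if "v \<in> V" for v
  proof -
    have "v + 1 / v \<le> (\<Sum>v\<in>V. v + 1 / v)" using that fV nn by (intro member_le_sum) auto
    then have le: "v + 1 / v \<le> K" unfolding K_def by simp
    have "0 < 1 / v" using pos[OF that] by simp
    then have "v \<le> K" "1 / v \<le> K" using le pos[OF that] by linarith+
    then show ?thesis using pos[OF that] K1 by (simp add: field_simps)
  qed
  moreover have "psi_restrict k psi J ts \<in> V" if "psi \<in> \<Psi>" "J \<subseteq> {..<k}" "length ts = card J" for psi J ts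
    unfolding V_def using that by (intro image_eqI[of _ _ "(psi, J, ts)"]) auto
  ultimately show thesis using K1 that by blast
qed

section \<open>Large deviations of the number of slots\<close>

definition unconditioned_stage1 :: "nat \<Rightarrow> nat \<Rightarrow> real \<Rightarrow> ('w list \<Rightarrow> real) pmf \<Rightarrow> nat \<Rightarrow> (nat \<times> (nat \<Rightarrow> nat set \<times> ('w list \<Rightarrow> real))) pmf" where
  "unconditioned_stage1 d k eps \<rho> n = bind_pmf (poisson_pmf (real d * real n / real k)) (\<lambda>m.
     map_pmf (\<lambda>c. (m, c)) (Pi_pmf {..<m} undefined (\<lambda>_. pair_pmf (J_pmf k eps) \<rho>)))"

definition slot_total :: "nat \<times> (nat \<Rightarrow> nat set \<times> 'b) \<Rightarrow> nat" where
  "slot_total = (\<lambda>(m, c). \<Sum>i<m. card (fst (c i)))"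

lemma reg_stage1_eq:
  "reg_stage1 d k eps \<rho> n = cond_pmf (unconditioned_stage1 d k eps \<rho> n) {z. slot_total z \<le> d * n}"
  by (simp add: reg_stage1_def unconditioned_stage1_def slot_total_def case_prod_unfold)

text \<open>For \<open>eps > 1\<close> the parameter is negative and acts as 0, so every slot is
  removed. This is why \<open>min eps 1\<close> appears throughout.\<close>

lemma bernoulli_pmf_clip:
  assumes "0 < eps"
  shows "bernoulli_pmf (1 - eps) = bernoulli_pmf (1 - min eps 1)"
proof (cases "eps \<le> 1")
  case False
  have "pmf (bernoulli_pmf (1 - eps)) b = pmf (bernoulli_pmf 0) b" for b
    using False by (cases b) (simp_all add: bernoulli_pmf.rep_eq)
  with False show ?thesis by (intro pmf_eqI) (simp add: min_def)
qed simp

lemma nn_integral_exp_card_J: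
  fixes t eps :: real and k :: nat
  assumes "0 < eps"
  defines "p \<equiv> 1 - min eps 1"
  shows "(\<integral>\<^sup>+J. ennreal (exp (t * real (card J))) \<partial>J_pmf k eps) = ennreal ((1 + p * (exp t - 1)) ^ k)"
proof -
  have p: "0 \<le> p" "p \<le> 1" using assms by auto
  have "(\<integral>\<^sup>+J. ennreal (exp (t * real (card J))) \<partial>J_pmf k eps)
    = (\<integral>\<^sup>+b. (\<Prod>j<k. ennreal (exp (t * of_bool (b j)))) \<partial>Pi_pmf {..<k} False (\<lambda>_. bernoulli_pmf p))"
    unfolding J_pmf_def nn_integral_map_pmf bernoulli_pmf_clip[OF assms(1)] p_def[symmetric]
  proof (rule nn_integral_cong)
    fix b :: "nat \<Rightarrow> bool"
    have "real (card {j\<in>{..<k}. b j}) = (\<Sum>j<k. of_bool (b j))"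
      by (simp add: of_bool_def sum.If_cases Int_def)
    then have "exp (t * real (card {j\<in>{..<k}. b j})) = (\<Prod>j<k. exp (t * of_bool (b j)))"
      by (simp only: sum_distrib_left exp_sum[OF finite_lessThan])
    then show "ennreal (exp (t * real (card {j\<in>{..<k}. b j}))) = (\<Prod>j<k. ennreal (exp (t * of_bool (b j))))"
      by (simp add: prod_ennreal)
  qed
  also have "\<dots> = (\<Prod>j<k. \<integral>\<^sup>+b. ennreal (exp (t * of_bool b)) \<partial>bernoulli_pmf p)"
    by (rule nn_integral_prod_Pi_pmf) simp
  also have "(\<integral>\<^sup>+b. ennreal (exp (t * of_bool b)) \<partial>bernoulli_pmf p) = ennreal (1 + p * (exp t - 1))"
  proof -
    have "(\<integral>\<^sup>+b. ennreal (exp (t * of_bool b)) \<partial>bernoulli_pmf p) = ennreal (exp t) * ennreal p + ennreal 1 * ennreal (1 - p)"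
      using p by (subst nn_integral_measure_pmf_support[of UNIV]) (auto simp: UNIV_bool add.commute)
    also have "\<dots> = ennreal (exp t * p + 1 * (1 - p))"
      using p by (simp add: ennreal_mult ennreal_plus)
    finally show ?thesis by (simp add: algebra_simps)
  qed
  moreover have "0 \<le> 1 + p * (exp t - 1)"
  proof -
    have "1 + p * (exp t - 1) = (1 - p) + p * exp t" by (simp add: algebra_simps)
    also have "0 \<le> \<dots>" using p by (intro add_nonneg_nonneg mult_nonneg_nonneg) auto
    finally show ?thesis .
  qed
  ultimately show ?thesis by (simp add: ennreal_power)
qed

lemma nn_integral_power_poisson:
  assumes "0 < r" "0 \<le> z"
  shows "(\<integral>\<^sup>+m. ennreal (z ^ m) \<partial>poisson_pmf r) = ennreal (exp (r * (z - 1)))"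
proof -
  have s: "(\<lambda>m. (r * z) ^ m / fact m * exp (- r)) sums (exp (r * z) * exp (- r))"
    using exp_converges[of "r * z"] by (intro sums_mult2) (simp add: divide_inverse mult.commute)
  have "(\<integral>\<^sup>+m. ennreal (z ^ m) \<partial>poisson_pmf r) = (\<integral>\<^sup>+m. ennreal ((r * z) ^ m / fact m * exp (- r)) \<partial>count_space UNIV)"
    unfolding nn_integral_measure_pmf using assms
    by (intro nn_integral_cong) (simp add: ennreal_mult[symmetric] power_mult_distrib mult_ac)
  also have "\<dots> = (\<Sum>m. ennreal ((r * z) ^ m / fact m * exp (- r)))"
    by (rule nn_integral_count_space_nat)
  also have "\<dots> = ennreal (exp (r * z) * exp (- r))"
    using assms s by (intro suminf_ennreal_eq) auto
  finally show ?thesis by (simp add: exp_add[symmetric] algebra_simps)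
qed

text \<open>The slot total is compound Poisson: the generating function of the Poisson number of
  nodes is evaluated at the moment generating function of one binomial
  \<open>card J\<close>.\<close>

lemma nn_integral_exp_slot_total:
  fixes \<rho> :: "('w list \<Rightarrow> real) pmf"
  assumes "0 < eps" "0 < d" "0 < k" "0 < n"
  shows "(\<integral>\<^sup>+z. ennreal (exp (t * real (slot_total z))) \<partial>unconditioned_stage1 d k eps \<rho> n)
    = ennreal (exp (real d * real n / real k * ((1 + (1 - min eps 1) * (exp t - 1)) ^ k - 1)))"
proof -
  let ?E = "(1 + (1 - min eps 1) * (exp t - 1)) ^ k"
  have E0: "0 \<le> ?E"
  proof -
    have "1 + (1 - min eps 1) * (exp t - 1) = min eps 1 + (1 - min eps 1) * exp t" by (simp add: algebra_simps)
    then show ?thesis using assms by simp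
  qed
  have "(\<integral>\<^sup>+c. ennreal (exp (t * real (slot_total (m, c)))) \<partial>Pi_pmf {..<m} undefined (\<lambda>_. pair_pmf (J_pmf k eps) \<rho>))
    = ennreal (?E ^ m)" for m
  proof -
    have "(\<integral>\<^sup>+c. ennreal (exp (t * real (slot_total (m, c)))) \<partial>Pi_pmf {..<m} undefined (\<lambda>_. pair_pmf (J_pmf k eps) \<rho>))
      = (\<integral>\<^sup>+c. (\<Prod>i<m. ennreal (exp (t * real (card (fst (c i)))))) \<partial>Pi_pmf {..<m} undefined (\<lambda>_. pair_pmf (J_pmf k eps) \<rho>))"
      by (intro nn_integral_cong) (simp add: slot_total_def sum_distrib_left exp_sum prod_ennreal)
    also have "\<dots> = (\<Prod>i<m. \<integral>\<^sup>+y. ennreal (exp (t * real (card (fst y)))) \<partial>pair_pmf (J_pmf k eps) \<rho>)"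
      by (rule nn_integral_prod_Pi_pmf) simp
    also have "(\<integral>\<^sup>+y. ennreal (exp (t * real (card (fst y)))) \<partial>pair_pmf (J_pmf k eps) \<rho>)
      = (\<integral>\<^sup>+J. ennreal (exp (t * real (card J))) \<partial>map_pmf fst (pair_pmf (J_pmf k eps) \<rho>))"
      by simp
    also have "\<dots> = ennreal ?E"
      unfolding map_fst_pair_pmf by (rule nn_integral_exp_card_J[OF assms(1)])
    finally show ?thesis using E0 by (simp add: ennreal_power)
  qed
  then show ?thesis
    unfolding unconditioned_stage1_def using assms E0
    by (simp add: nn_integral_power_poisson)
qed

text \<open>Both sides vanish at \<open>t = 0\<close>, with slopes \<open>1 - e\<close> and
  \<open>1 - e / 2\<close>, so the strict inequality holds for small positive
  \<open>t\<close>.\<close>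

lemma exists_chernoff_exponent:
  fixes e :: real and k :: nat
  assumes "0 < e" "0 < k"
  shows "\<exists>t>0. ((1 + (1 - e) * (exp t - 1)) ^ k - 1) / real k < t * (1 - e / 2)"
proof -
  let ?f = "\<lambda>t. ((1 + (1 - e) * (exp t - 1)) ^ k - 1) / real k - t * (1 - e / 2)"
  have "(?f has_real_derivative - (e / 2)) (at 0)"
    using assms by (auto intro!: derivative_eq_intros simp: field_simps)
  from DERIV_neg_dec_right[OF this] assms obtain D where D: "0 < D" "\<And>h. 0 < h \<Longrightarrow> h < D \<Longrightarrow> ?f (0 + h) < ?f 0"
    by auto
  have "?f (0 + D / 2) < ?f 0" using D by (intro D(2)) auto
  then show ?thesis using D(1) by (intro exI[of _ "D / 2"]) simp
qed

lemma slot_total_tail: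
  fixes \<rho> :: "('w list \<Rightarrow> real) pmf"
  assumes "0 < eps" "0 < d" "0 < k"
  obtains \<beta> where "0 < \<beta>"
    "\<And>n. 0 < n \<Longrightarrow> measure_pmf.prob (unconditioned_stage1 d k eps \<rho> n)
        {z. (1 - min eps 1 / 2) * real d * real n < real (slot_total z)} \<le> exp (- \<beta> * real n)"
proof -
  let ?e = "min eps 1"
  let ?\<phi> = "\<lambda>t. (1 + (1 - ?e) * (exp t - 1)) ^ k - 1"
  obtain t where t: "0 < t" "?\<phi> t / real k < t * (1 - ?e / 2)"
    using exists_chernoff_exponent[of ?e k] assms by auto
  \<comment> \<open>The exponent per variable node after Markov's inequality for
    \<open>exp (t * slot_total z)\<close>.\<close>
  define \<beta> where "\<beta> = (t * (1 - ?e / 2) - ?\<phi> t / real k) * real d"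
  have "0 < \<beta>" using t assms by (simp add: \<beta>_def)
  moreover have "measure_pmf.prob (unconditioned_stage1 d k eps \<rho> n)
        {z. (1 - ?e / 2) * real d * real n < real (slot_total z)} \<le> exp (- \<beta> * real n)" if n: "0 < n" for n
  proof -
    let ?M = "unconditioned_stage1 d k eps \<rho> n" and ?b = "t * ((1 - ?e / 2) * real d * real n)"
    let ?A = "{z. (1 - ?e / 2) * real d * real n < real (slot_total z)}"
    have "emeasure ?M ?A = (\<integral>\<^sup>+z. indicator ?A z \<partial>?M)" by simp
    also have "\<dots> \<le> (\<integral>\<^sup>+z. ennreal (exp (- ?b)) * ennreal (exp (t * real (slot_total z))) \<partial>?M)"
    proof (rule nn_integral_mono)
      fix z
      show "indicator ?A z \<le> ennreal (exp (- ?b)) * ennreal (exp (t * real (slot_total z)))"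
      proof (cases "z \<in> ?A")
        case True
        then have "?b \<le> t * real (slot_total z)" using t by (intro mult_left_mono) auto
        then have "1 \<le> exp (- ?b) * exp (t * real (slot_total z))" by (simp add: exp_add[symmetric])
        then show ?thesis using True by (simp add: ennreal_mult[symmetric])
      qed simp
    qed
    also have "\<dots> = ennreal (exp (- ?b)) * ennreal (exp (real d * real n / real k * ?\<phi> t))"
      using nn_integral_exp_slot_total[OF assms n, of \<rho> t] by (simp add: nn_integral_cmult)
    also have "\<dots> = ennreal (exp (- \<beta> * real n))"
    proof -
      have "- ?b + real d * real n / real k * ?\<phi> t = - \<beta> * real n"
      proof -
        have "- (t * (A * D * N)) + D * N / \<kappa> * B = - ((t * A - B / \<kappa>) * D) * N" for A B D N \<kappa> :: real
          by (simp add: field_simps)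
        then show ?thesis unfolding \<beta>_def .
      qed
      then show ?thesis by (simp only: ennreal_mult[symmetric] exp_ge_zero exp_add[symmetric])
    qed
    finally show ?thesis
      by (simp add: measure_pmf.emeasure_eq_measure)
  qed
  ultimately show thesis by (rule that)
qed

lemma set_unconditioned_stage1:
  assumes "0 < d" "0 < k" "0 < n" "(m, c) \<in> set_pmf (unconditioned_stage1 d k eps \<rho> n)" "i < m"
  shows "fst (c i) \<subseteq> {..<k}" "snd (c i) \<in> set_pmf \<rho>"
proof -
  have "c \<in> set_pmf (Pi_pmf {..<m} undefined (\<lambda>_. pair_pmf (J_pmf k eps) \<rho>))"
    using assms by (auto simp: unconditioned_stage1_def)
  then have "c i \<in> set_pmf (pair_pmf (J_pmf k eps) \<rho>)"
    using \<open>i < m\<close> by (auto simp: set_Pi_pmf PiE_dflt_def)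
  then show "fst (c i) \<subseteq> {..<k}" "snd (c i) \<in> set_pmf \<rho>"
    by (auto simp: J_pmf_def)
qed

lemma unconditioned_stage1_meets:
  assumes "0 < d" "0 < k" "0 < n"
  shows "set_pmf (unconditioned_stage1 d k eps \<rho> n) \<inter> {z. slot_total z \<le> d * n} \<noteq> {}"
proof -
  \<comment> \<open>The Poisson law charges \<open>m = 0\<close>, where no slots are used and
    \<open>undefined\<close> is the default value of the empty product.\<close>
  have "(0, \<lambda>_. undefined) \<in> set_pmf (unconditioned_stage1 d k eps \<rho> n)"
    using assms by (auto simp: unconditioned_stage1_def intro!: exI[of _ 0])
  then show ?thesis by (force simp: slot_total_def)
qed

lemma measure_cond_pmf:
  assumes "set_pmf p \<inter> S \<noteq> {}"
  shows "measure_pmf.prob (cond_pmf p S) A = measure_pmf.prob p (S \<inter> A) / measure_pmf.prob p S"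
  unfolding cond_pmf.rep_eq[OF assms] using emeasure_measure_pmf_not_zero[OF assms]
  by (subst measure_uniform_measure) (auto simp: measure_pmf.emeasure_eq_measure)

text \<open>Conditioning is harmless: the complement of the tail event lies inside the conditioning
  event, whose probability is therefore at least \<open>1 - exp (- \<beta> * n)\<close>.\<close>

lemma reg_stage1_tail_tendsto_0:
  fixes \<rho> :: "('w list \<Rightarrow> real) pmf"
  assumes "0 < eps" "0 < d" "0 < k"
  shows "(\<lambda>n. measure_pmf.prob (reg_stage1 d k eps \<rho> n)
    {z. (1 - min eps 1 / 2) * real d * real n < real (slot_total z)}) \<longlonglongrightarrow> 0"
proof -
  obtain \<beta> where \<beta>: "0 < \<beta>"
    "\<And>n. 0 < n \<Longrightarrow> measure_pmf.prob (unconditioned_stage1 d k eps \<rho> n)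
        {z. (1 - min eps 1 / 2) * real d * real n < real (slot_total z)} \<le> exp (- \<beta> * real n)"
    using slot_total_tail[OF assms, of \<rho>] by blast
  let ?A = "\<lambda>n. {z :: nat \<times> (nat \<Rightarrow> nat set \<times> ('w list \<Rightarrow> real)). (1 - min eps 1 / 2) * real d * real n < real (slot_total z)}"
  let ?S = "\<lambda>n. {z :: nat \<times> (nat \<Rightarrow> nat set \<times> ('w list \<Rightarrow> real)). slot_total z \<le> d * n}"
  let ?P = "\<lambda>n. measure_pmf.prob (unconditioned_stage1 d k eps \<rho> n)"
  have lim: "(\<lambda>n. exp (- \<beta> * real n) / (1 - exp (- \<beta> * real n))) \<longlonglongrightarrow> 0"
  proof -
    have "(\<lambda>n. exp (- \<beta> * real n)) \<longlonglongrightarrow> 0"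
      unfolding exp_of_nat2_mult using \<beta>(1) by (intro LIMSEQ_realpow_zero) auto
    from tendsto_divide[OF this tendsto_diff[OF tendsto_const[of 1] this]] show ?thesis by simp
  qed
  have "measure_pmf.prob (reg_stage1 d k eps \<rho> n) (?A n) \<le> exp (- \<beta> * real n) / (1 - exp (- \<beta> * real n))"
    if n: "0 < n" for n
  proof -
    have lt: "exp (- \<beta> * real n) < 1" using \<beta>(1) n by simp
    have "1 - exp (- \<beta> * real n) \<le> 1 - ?P n (?A n)" using \<beta>(2)[OF n] by simp
    also have "\<dots> = ?P n (- ?A n)" using measure_pmf.prob_compl[of "?A n" "unconditioned_stage1 d k eps \<rho> n"]
      by (simp add: Compl_eq_Diff_UNIV)
    also have "\<dots> \<le> ?P n (?S n)"
    proof (rule measure_pmf.finite_measure_mono)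
      show "- ?A n \<subseteq> ?S n"
      proof
        fix z assume "z \<in> - ?A n"
        then have "real (slot_total z) \<le> (1 - min eps 1 / 2) * real d * real n" by simp
        also have "\<dots> \<le> 1 * real d * real n" using assms by (intro mult_right_mono) auto
        finally show "z \<in> ?S n" by (simp flip: of_nat_mult)
      qed
    qed simp
    finally have S: "1 - exp (- \<beta> * real n) \<le> ?P n (?S n)" .
    have "measure_pmf.prob (reg_stage1 d k eps \<rho> n) (?A n) = ?P n (?S n \<inter> ?A n) / ?P n (?S n)"
      unfolding reg_stage1_eq using unconditioned_stage1_meets[of d k n eps \<rho>] assms n
      by (intro measure_cond_pmf) auto
    also have "\<dots> \<le> ?P n (?A n) / ?P n (?S n)"
      by (intro divide_right_mono measure_pmf.finite_measure_mono) auto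
    also have "\<dots> \<le> exp (- \<beta> * real n) / (1 - exp (- \<beta> * real n))"
      using \<beta>(2)[OF n] S lt by (intro frac_le) auto
    finally show ?thesis .
  qed
  then have "\<forall>\<^sub>F n in sequentially. measure_pmf.prob (reg_stage1 d k eps \<rho> n) (?A n)
      \<le> exp (- \<beta> * real n) / (1 - exp (- \<beta> * real n))"
    using eventually_gt_at_top[of 0] by (rule eventually_mono[rotated])
  then show ?thesis by (intro tendsto_sandwich[OF _ _ tendsto_const lim]) auto
qed

section \<open>Probability bounds in the model\<close>

lemma tv_pair_nonneg: "0 \<le> tv_pair n G x y"
  by (simp add: tv_pair_def sum_nonneg)

lemma tv_pair_le:
  fixes w :: "nat \<Rightarrow> 'w::finite list \<Rightarrow> real"
  assumes "positive_on nb w {..<m}"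
  shows "tv_pair n (m, nb, w) x y \<le> real CARD('w \<times> 'w)"
proof -
  have m1: "\<bar>marg1 n nb w {..<m} u s\<bar> \<le> 1" for u s
    unfolding marg1_eq_gibbs by (intro abs_gibbs_le assms) auto
  have m2: "\<bar>marg2 n nb w {..<m} x y st\<bar> \<le> 1" for st
    unfolding marg2_eq_gibbs by (intro abs_gibbs_le assms) auto
  have "(\<Sum>st\<in>UNIV. \<bar>mu2 n (m, nb, w) x y st - mu1 n (m, nb, w) x (fst st) * mu1 n (m, nb, w) y (snd st)\<bar>)
    \<le> (\<Sum>st\<in>(UNIV :: ('w \<times> 'w) set). 2)"
  proof (rule sum_mono)
    fix st :: "'w \<times> 'w"
    have "\<bar>marg1 n nb w {..<m} x (fst st) * marg1 n nb w {..<m} y (snd st)\<bar> \<le> 1 * 1"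
      unfolding abs_mult by (intro mult_mono m1) auto
    with m2[of st] show "\<bar>mu2 n (m, nb, w) x y st - mu1 n (m, nb, w) x (fst st) * mu1 n (m, nb, w) y (snd st)\<bar> \<le> 2"
      by (simp add: mu1_def mu2_def)
  qed
  then show ?thesis by (simp add: tv_pair_def)
qed

context
  fixes d k :: nat and eps K :: real and \<Psi> :: "('w::finite list \<Rightarrow> real) set" and \<rho> :: "('w list \<Rightarrow> real) pmf"
  assumes d: "0 < d" and k: "0 < k" and \<rho>: "set_pmf \<rho> \<subseteq> \<Psi>" and eps: "0 < eps" and K: "1 \<le> K"
    and bounds: "\<And>psi J ts. psi \<in> \<Psi> \<Longrightarrow> J \<subseteq> {..<k} \<Longrightarrow> length ts = card J \<Longrightarrow>
      1 / K \<le> psi_restrict k psi J ts \<and> psi_restrict k psi J ts \<le> K"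
begin

lemma reg_stage1_support:
  assumes "0 < n" "(m, c) \<in> set_pmf (reg_stage1 d k eps \<rho> n)"
  shows "slot_total (m, c) \<le> d * n" "\<And>i. i < m \<Longrightarrow> fst (c i) \<subseteq> {..<k}" "\<And>i. i < m \<Longrightarrow> snd (c i) \<in> \<Psi>"
proof -
  have "(m, c) \<in> set_pmf (unconditioned_stage1 d k eps \<rho> n) \<inter> {z. slot_total z \<le> d * n}"
    using assms(2) unconditioned_stage1_meets[OF d k assms(1), of eps \<rho>] by (simp add: reg_stage1_eq)
  then show "slot_total (m, c) \<le> d * n" "\<And>i. i < m \<Longrightarrow> fst (c i) \<subseteq> {..<k}" "\<And>i. i < m \<Longrightarrow> snd (c i) \<in> \<Psi>"
    using set_unconditioned_stage1[OF d k assms(1)] \<rho> by blast+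
qed

lemma reg_model_support_positive:
  assumes "0 < n" "G \<in> set_pmf (reg_model d k eps \<rho> n)"
  obtains m nb w where "G = (m, nb, w)" "positive_on nb w {..<m}"
proof -
  from assms(2) obtain m c nb where mc: "(m, c) \<in> set_pmf (reg_stage1 d k eps \<rho> n)"
    and nb: "nb \<in> set_pmf (pmf_of_set (slot_assignments n d m (\<lambda>i. card (fst (c i)))))"
    and G: "G = (m, nb, \<lambda>i. psi_restrict k (snd (c i)) (fst (c i)))"
    unfolding reg_model_def by auto
  note supp = reg_stage1_support[OF assms(1) mc]
  have "slot_assignments n d m (\<lambda>i. card (fst (c i))) \<noteq> {}"
    using supp(1) by (intro slot_assignments_nonempty) (simp add: slot_total_def)
  then have "nb \<in> slot_assignments n d m (\<lambda>i. card (fst (c i)))"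
    using nb finite_slot_assignments by (simp add: set_pmf_of_set)
  then have "weights_bdd K nb (\<lambda>i. psi_restrict k (snd (c i)) (fst (c i))) {..<m}"
    unfolding weights_bdd_def using bounds supp(2,3) slot_assignmentsD(1) by fastforce
  then have "positive_on nb (\<lambda>i. psi_restrict k (snd (c i)) (fst (c i))) {..<m}"
    using weights_bdd_positive K by fastforce
  with G that show thesis by blast
qed

text \<open>A non-integrable function has Bochner integral 0, so the hypothesis on expectations can
  be used only with this fact. Boundedness holds on the support of the model, where all weights are
  positive.\<close>

lemma integrable_tv_pair:
  assumes "0 < n"
  shows "integrable (measure_pmf (reg_model d k eps \<rho> n)) (\<lambda>G. tv_pair n G x y)"
proof (rule measure_pmf.integrable_const_bound[where B = "real CARD('w \<times> 'w)"])
  show "AE G in measure_pmf (reg_model d k eps \<rho> n). norm (tv_pair n G x y) \<le> real CARD('w \<times> 'w)"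
  proof (rule AE_pmfI)
    fix G assume "G \<in> set_pmf (reg_model d k eps \<rho> n)"
    then obtain m nb w where "G = (m, nb, w)" "positive_on nb w {..<m}"
      by (rule reg_model_support_positive[OF assms])
    then show "norm (tv_pair n G x y) \<le> real CARD('w \<times> 'w)"
      using tv_pair_le[of nb w m n x y] tv_pair_nonneg[of n G x y] by simp
  qed
qed simp

lemma prob_tv_total_le:
  assumes "0 < n" "0 < \<delta>"
  shows "measure_pmf.prob (reg_model d k eps \<rho> n) {G. \<delta> * (real n)\<^sup>2 < tv_total n G}
    \<le> (1 / (real n)\<^sup>2) * (\<Sum>i<n. \<Sum>j<n. measure_pmf.expectation (reg_model d k eps \<rho> n) (\<lambda>G. tv_pair n G i j)) / \<delta>"
proof -
  let ?M = "reg_model d k eps \<rho> n"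
  have int: "integrable (measure_pmf ?M) (tv_total n)"
    unfolding tv_total_def using integrable_tv_pair[OF assms(1)] by (intro Bochner_Integration.integrable_sum)
  have "measure_pmf.prob ?M {G. \<delta> * (real n)\<^sup>2 < tv_total n G}
    \<le> measure_pmf.prob ?M {G \<in> space ?M. \<delta> * (real n)\<^sup>2 \<le> tv_total n G}"
    by (intro measure_pmf.finite_measure_mono) auto
  also have "\<dots> \<le> measure_pmf.expectation ?M (tv_total n) / (\<delta> * (real n)\<^sup>2)"
    using assms by (intro integral_Markov_inequality_measure[OF int, where A = "{}"])
      (auto simp: tv_total_def intro!: sum_nonneg tv_pair_nonneg AE_pmfI)
  also have "measure_pmf.expectation ?M (tv_total n) = (\<Sum>i<n. \<Sum>j<n. measure_pmf.expectation ?M (\<lambda>G. tv_pair n G i j))"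
    unfolding tv_total_def using integrable_tv_pair[OF assms(1)] by simp
  finally show ?thesis by (simp add: mult.commute)
qed

text \<open>Markov's inequality for the uniform slot assignment, in counting form: every bad
  assignment contributes at least \<open>\<delta>' * n\<close> to the sum bounded by
  \<open>sum_bp_error_le\<close>.\<close>

lemma prob_bp_error_given_stage1_le:
  assumes n: "0 < n" "2 * real k \<le> min eps 1 / 2 * real n" and \<delta>: "0 < \<delta>" and \<delta>': "0 < \<delta>'"
    and mc: "(m, c) \<in> set_pmf (reg_stage1 d k eps \<rho> n)"
    and total: "real (slot_total (m, c)) \<le> (1 - min eps 1 / 2) * real d * real n"
  shows "measure_pmf.prob (map_pmf (\<lambda>nb. (m, nb, \<lambda>i. psi_restrict k (snd (c i)) (fst (c i))))
        (pmf_of_set (slot_assignments n d m (\<lambda>i. card (fst (c i))))))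
      {G. tv_total n G \<le> \<delta> * (real n)\<^sup>2 \<and> \<delta>' * real n \<le> bp_error n G}
    \<le> total_const TYPE('w) d k K (min eps 1 / 2) * sqrt \<delta> / \<delta>'"
proof -
  note supp = reg_stage1_support[OF n(1) mc]
  let ?sl = "\<lambda>i. card (fst (c i))" and ?w = "\<lambda>i. psi_restrict k (snd (c i)) (fst (c i))"
  let ?S = "slot_assignments n d m ?sl" and ?C = "total_const TYPE('w) d k K (min eps 1 / 2)"
  let ?B = "{nb\<in>?S. tv_total n (m, nb, ?w) \<le> \<delta> * (real n)\<^sup>2 \<and> \<delta>' * real n \<le> bp_error n (m, nb, ?w)}"
  have ne: "?S \<noteq> {}" using supp(1) by (intro slot_assignments_nonempty) (simp add: slot_total_def)
  have fin: "finite ?S" by (rule finite_slot_assignments)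
  have bp0: "0 \<le> bp_error n G" for G :: "'w fgraph"
    by (cases G) (auto simp: bp_error_def intro!: sum_nonneg)
  have "(\<delta>' * real n) * real (card ?B) = (\<Sum>nb\<in>?B. \<delta>' * real n)" by simp
  also have "\<dots> \<le> (\<Sum>nb\<in>?B. of_bool (tv_total n (m, nb, ?w) \<le> \<delta> * (real n)\<^sup>2) * bp_error n (m, nb, ?w))"
    by (intro sum_mono) auto
  also have "\<dots> \<le> (\<Sum>nb\<in>?S. of_bool (tv_total n (m, nb, ?w) \<le> \<delta> * (real n)\<^sup>2) * bp_error n (m, nb, ?w))"
    using fin bp0 by (intro sum_mono2) auto
  also have "\<dots> \<le> ?C * sqrt \<delta> * real n * real (card ?S)"
  proof (rule sum_bp_error_le[OF K _ d])
    show "1 / K \<le> ?w i ts \<and> ?w i ts \<le> K" if "i < m" "length ts = ?sl i" for i ts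
      using bounds supp(2,3) that by blast
    show "?sl i \<le> k" if "i < m" for i
      using card_mono[OF _ supp(2)[OF that]] by simp
    show "real (\<Sum>i<m. ?sl i) \<le> (1 - min eps 1 / 2) * real d * real n"
      using total by (simp add: slot_total_def)
  qed (use n eps \<delta> in auto)
  finally have "real (card ?B) / real (card ?S) \<le> ?C * sqrt \<delta> / \<delta>'"
    using n \<delta>' fin ne by (simp add: field_simps card_gt_0_iff)
  moreover have "?S \<inter> (\<lambda>nb. (m, nb, ?w)) -` {G. tv_total n G \<le> \<delta> * (real n)\<^sup>2 \<and> \<delta>' * real n \<le> bp_error n G} = ?B"
    by auto
  ultimately show ?thesis using ne fin by (simp add: measure_pmf_of_set)
qed

lemma prob_bp_error_le:
  assumes n: "0 < n" "2 * real k \<le> min eps 1 / 2 * real n" and \<delta>: "0 < \<delta>" and \<delta>': "0 < \<delta>'"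
  shows "measure_pmf.prob (reg_model d k eps \<rho> n)
      {G. tv_total n G \<le> \<delta> * (real n)\<^sup>2 \<and> \<delta>' * real n \<le> bp_error n G}
    \<le> measure_pmf.prob (reg_stage1 d k eps \<rho> n) {z. (1 - min eps 1 / 2) * real d * real n < real (slot_total z)}
      + total_const TYPE('w) d k K (min eps 1 / 2) * sqrt \<delta> / \<delta>'"
proof -
  let ?A = "{G. tv_total n G \<le> \<delta> * (real n)\<^sup>2 \<and> \<delta>' * real n \<le> bp_error n G} :: 'w fgraph set"
  let ?bad = "{z :: nat \<times> (nat \<Rightarrow> nat set \<times> ('w list \<Rightarrow> real)). (1 - min eps 1 / 2) * real d * real n < real (slot_total z)}"
  let ?p = "reg_stage1 d k eps \<rho> n"
  let ?r = "total_const TYPE('w) d k K (min eps 1 / 2) * sqrt \<delta> / \<delta>'"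
  let ?N = "\<lambda>(m, c). map_pmf (\<lambda>nb. (m, nb, \<lambda>i. psi_restrict k (snd (c i)) (fst (c i))))
        (pmf_of_set (slot_assignments n d m (\<lambda>i. card (fst (c i)))))"
  have r: "0 \<le> ?r" using K \<delta> \<delta>' eps by (auto simp: total_const_def bp_const_def resample_const_def)
  have "emeasure (reg_model d k eps \<rho> n) ?A = (\<integral>\<^sup>+z. emeasure (?N z) ?A \<partial>?p)"
    unfolding reg_model_def by (rule emeasure_bind_pmf)
  also have "\<dots> \<le> (\<integral>\<^sup>+z. indicator ?bad z + ennreal ?r \<partial>?p)"
  proof (rule nn_integral_mono_AE, rule AE_pmfI)
    fix z assume z: "z \<in> set_pmf ?p"
    obtain m c where mc: "z = (m, c)" by (cases z)
    show "emeasure (?N z) ?A \<le> indicator ?bad z + ennreal ?r"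
    proof (cases "z \<in> ?bad")
      case True
      then have "emeasure (?N z) ?A \<le> indicator ?bad z"
        using measure_pmf.emeasure_le_1 by simp
      then show ?thesis by (rule order_trans) simp
    next
      case False
      then have "measure_pmf.prob (?N z) ?A \<le> ?r"
        using prob_bp_error_given_stage1_le[OF n \<delta> \<delta>', of m c] z by (simp add: mc)
      then have "emeasure (?N z) ?A \<le> ennreal ?r"
        by (simp add: measure_pmf.emeasure_eq_measure ennreal_leI)
      then show ?thesis by (rule order_trans) simp
    qed
  qed
  also have "\<dots> = emeasure ?p ?bad + ennreal ?r"
    by (subst nn_integral_add) (auto simp: measure_pmf.emeasure_space_1[simplified])
  also have "\<dots> = ennreal (measure_pmf.prob ?p ?bad + ?r)"
    using r by (simp add: measure_pmf.emeasure_eq_measure ennreal_plus)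
  finally have "ennreal (measure_pmf.prob (reg_model d k eps \<rho> n) ?A) \<le> ennreal (measure_pmf.prob ?p ?bad + ?r)"
    unfolding measure_pmf.emeasure_eq_measure .
  then show ?thesis using r by (subst (asm) ennreal_le_iff) auto
qed

end

theorem theorem4:
  fixes d k :: nat and eps :: real
    and \<Psi> :: "('w::finite list \<Rightarrow> real) set" and \<rho> :: "('w list \<Rightarrow> real) pmf"
  assumes "d > 0" and "k \<ge> 3"
    and "finite \<Psi>" and "\<Psi> \<noteq> {}"
    and "\<forall>psi\<in>\<Psi>. \<forall>\<tau>. length \<tau> = k \<longrightarrow> psi \<tau> > 0"
    and "set_pmf \<rho> \<subseteq> \<Psi>"
    and "eps > 0"
    and "(\<lambda>n. (1 / (real n)^2) * (\<Sum>i<n. \<Sum>j<n.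
            measure_pmf.expectation (reg_model d k eps \<rho> n) (\<lambda>G. tv_pair n G i j)))
          \<longlonglongrightarrow> 0"
  shows "\<exists>\<delta> :: nat \<Rightarrow> real. \<delta> \<longlonglongrightarrow> 0 \<and>
           (\<lambda>n. measure_pmf.prob (reg_model d k eps \<rho> n) {G. is_bp_fixpoint (\<delta> n) n G})
             \<longlonglongrightarrow> 1"
proof -
  obtain K where K: "1 \<le> K" and bounds: "\<And>psi J ts. psi \<in> \<Psi> \<Longrightarrow> J \<subseteq> {..<k} \<Longrightarrow> length ts = card J \<Longrightarrow>
      1 / K \<le> psi_restrict k psi J ts \<and> psi_restrict k psi J ts \<le> K"
    by (rule psi_restrict_bounds[OF assms(3,5)]) blast
  have k: "0 < k" using assms(2) by simp
  define t where "t n = (1 / (real n)^2) * (\<Sum>i<n. \<Sum>j<n.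
      measure_pmf.expectation (reg_model d k eps \<rho> n) (\<lambda>G. tv_pair n G i j))" for n
  have t: "t \<longlonglongrightarrow> 0" unfolding t_def using assms(8) .
  have t0: "0 \<le> t n" for n
    unfolding t_def by (intro mult_nonneg_nonneg sum_nonneg Bochner_Integration.integral_nonneg tv_pair_nonneg) simp
  define C where "C = total_const TYPE('w) d k K (min eps 1 / 2)"
  have C: "0 \<le> C" using K assms(7) by (auto simp: C_def total_const_def bp_const_def resample_const_def)
  \<comment> \<open>\<open>a\<close> is the threshold for the average correlation. Being at least
    \<open>sqrt (t n)\<close>, it makes Markov's bound \<open>t n / a n\<close> at most
    \<open>sqrt (t n)\<close>; the summand \<open>1 / n\<close> keeps it positive when
    \<open>t n = 0\<close>.\<close>
  define a where "a n = sqrt (t n) + 1 / real n" for n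
  define b where "b n = C * sqrt (a n)" for n
  \<comment> \<open>The same device a second time: the failure probability
    \<open>b n / \<delta> n\<close> is at most \<open>sqrt (b n)\<close>.\<close>
  define \<delta> where "\<delta> n = sqrt (b n) + 1 / real n" for n
  define p where "p n = measure_pmf.prob (reg_stage1 d k eps \<rho> n)
      {z. (1 - min eps 1 / 2) * real d * real n < real (slot_total z)}" for n
  have inv: "(\<lambda>n. 1 / real n) \<longlonglongrightarrow> 0" by (rule lim_1_over_n)
  have st: "(\<lambda>n. sqrt (t n)) \<longlonglongrightarrow> 0" using tendsto_real_sqrt[OF t] by simp
  have a: "a \<longlonglongrightarrow> 0" unfolding a_def using tendsto_add[OF st inv] by simp
  have b: "b \<longlonglongrightarrow> 0"
    unfolding b_def using tendsto_mult[OF tendsto_const[of C] tendsto_real_sqrt[OF a]] by simp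
  have sb: "(\<lambda>n. sqrt (b n)) \<longlonglongrightarrow> 0" using tendsto_real_sqrt[OF b] by simp
  have \<delta>: "\<delta> \<longlonglongrightarrow> 0" unfolding \<delta>_def using tendsto_add[OF sb inv] by simp
  have p: "p \<longlonglongrightarrow> 0" unfolding p_def by (rule reg_stage1_tail_tendsto_0[OF assms(7,1) k])
  have lower: "1 - (sqrt (t n) + p n + sqrt (b n)) \<le> measure_pmf.prob (reg_model d k eps \<rho> n) {G. is_bp_fixpoint (\<delta> n) n G}"
    if n: "0 < n" "2 * real k \<le> min eps 1 / 2 * real n" for n
  proof -
    let ?M = "reg_model d k eps \<rho> n" and ?fix = "{G. is_bp_fixpoint (\<delta> n) n G} :: 'w fgraph set"
    let ?X = "{G. a n * (real n)\<^sup>2 < tv_total n G} :: 'w fgraph set"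
    let ?Y = "{G. tv_total n G \<le> a n * (real n)\<^sup>2 \<and> \<delta> n * real n \<le> bp_error n G} :: 'w fgraph set"
    have a0: "0 < a n" "sqrt (t n) \<le> a n"
      unfolding a_def using n real_sqrt_ge_zero[OF t0[of n]] by (simp_all add: add_nonneg_pos)
    have b0: "0 \<le> b n" using C a0 by (simp add: b_def)
    then have \<delta>0: "0 < \<delta> n" "sqrt (b n) \<le> \<delta> n"
      unfolding \<delta>_def using n by (simp_all add: add_nonneg_pos)
    have X: "measure_pmf.prob ?M ?X \<le> sqrt (t n)"
    proof -
      have "measure_pmf.prob ?M ?X \<le> t n / a n"
        unfolding t_def using prob_tv_total_le[OF assms(1) k assms(6,7) K bounds n(1) a0(1)] .
      also have "\<dots> = sqrt (t n) * sqrt (t n) / a n" using t0 by simp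
      also have "\<dots> \<le> sqrt (t n) * a n / a n"
        using a0 t0 by (intro divide_right_mono mult_left_mono) auto
      finally show ?thesis using a0 by simp
    qed
    have Y: "measure_pmf.prob ?M ?Y \<le> p n + sqrt (b n)"
    proof -
      have "measure_pmf.prob ?M ?Y \<le> p n + b n / \<delta> n"
        unfolding p_def b_def C_def
        using prob_bp_error_le[OF assms(1) k assms(6,7) K bounds n a0(1) \<delta>0(1)] .
      also have "b n / \<delta> n = sqrt (b n) * sqrt (b n) / \<delta> n" using b0 by simp
      also have "\<dots> \<le> sqrt (b n) * \<delta> n / \<delta> n"
        using \<delta>0 b0 by (intro divide_right_mono mult_left_mono) auto
      finally show ?thesis using \<delta>0 by simp
    qed
    have "1 - measure_pmf.prob ?M ?fix = measure_pmf.prob ?M (- ?fix)"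
      using measure_pmf.prob_compl[of ?fix ?M] by (simp add: Compl_eq_Diff_UNIV)
    \<comment> \<open>A graph that is not a fixed point has large correlations (\<open>?X\<close>),
      or it has small correlations and a large error (\<open>?Y\<close>).\<close>
    also have "\<dots> \<le> measure_pmf.prob ?M (?X \<union> ?Y)"
      by (intro measure_pmf.finite_measure_mono) (auto simp: is_bp_fixpoint_def)
    also have "\<dots> \<le> measure_pmf.prob ?M ?X + measure_pmf.prob ?M ?Y"
      by (intro measure_Un_le) auto
    finally show ?thesis using X Y by linarith
  qed
  have "\<forall>\<^sub>F n in sequentially. 2 * real k \<le> min eps 1 / 2 * real n"
  proof -
    have "filterlim (\<lambda>n. min eps 1 / 2 * real n) at_top sequentially"
      using assms(7) by (intro filterlim_tendsto_pos_mult_at_top[OF tendsto_const _ filterlim_real_sequentially]) auto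
    then show ?thesis unfolding filterlim_at_top by blast
  qed
  then have "\<forall>\<^sub>F n in sequentially. 1 - (sqrt (t n) + p n + sqrt (b n))
      \<le> measure_pmf.prob (reg_model d k eps \<rho> n) {G. is_bp_fixpoint (\<delta> n) n G}"
    using eventually_gt_at_top[of 0] by eventually_elim (rule lower)
  then have "(\<lambda>n. measure_pmf.prob (reg_model d k eps \<rho> n) {G. is_bp_fixpoint (\<delta> n) n G}) \<longlonglongrightarrow> 1"
  proof (rule tendsto_sandwich[OF _ _ _ tendsto_const])
    show "(\<lambda>n. 1 - (sqrt (t n) + p n + sqrt (b n))) \<longlonglongrightarrow> 1"
      using tendsto_diff[OF tendsto_const[of 1] tendsto_add[OF tendsto_add[OF st p] sb]] by simp
  qed simp
  with \<delta> show ?thesis by blast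
qed

end
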